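(* Let $m\ge 3$, let $W=I_2(m)$ be the dihedral group of order $2m$, and write $r=m/2$ if $m$ is even. Let $\mathcal S\subset\mathrm{Irr}(W)$ be a set of irreducible characters containing $\chi_0,\chi_1,\epsilon$. If $m$ is even and $\mathcal S$ contains exactly one of $\chi_r,\chi_r'$, assume (as may be arranged by the choice of labelling of these two characters) that it contains $\chi_r'$. Define integers $0=d_0<1=d_1<\dots<d_N<m/2$ by $\{\chi_i\in\mathcal S\mid i<m/2\}=\{\chi_{d_0},\dots,\chi_{d_N}\}$. For a Springer correspondence whose set of Springer representations is $\mathcal S$, let $\mathcal C_k$ denote the unipotent class with Springer representation $\chi_{d_k}$, and let $\mathcal C_{\chi_r},\mathcal C_{\chi_r'},\mathcal C_\epsilon$ denote the classes with Springer representations $\chi_r,\chi_r',\epsilon$ respectively (when these belong to $\mathcal S$). (a) $W$ admits a Springer correspondence whose set of Springer representations is precisely $\mathcal S$. Every such Springer correspondence has the form $$\mathcal C_0=\{\chi_0\},$$ $$\mathcal C_k=\{\chi_{d_k},\chi_{d_k+1},\dots,\chi_{d_{k+1}-1}\}\cup\{\chi_{f_{k+1}+1},\chi_{f_{k+1}+2},\dots,\chi_{f_k}\}\quad\text{for }1\le k\le N-1,$$ $$\mathcal C_N=\begin{cases}\{\chi_{d_N},\chi_{d_N+1},\dots,\chi_{\lfloor (m-1)/2\rfloor}\}&\text{if } m \text{ is odd, or } m \text{ is even and }\chi_r,\chi_r'\in\mathcal S,\\ \{\chi_{d_N},\chi_{d_N+1},\dots,\chi_{f_N}\}&\text{if }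 m\text{ is even, }\chi_r\notin\mathcal S\text{ and }\chi_r'\in\mathcal S,\\ \{\chi_{d_N},\chi_{d_N+1},\dots,\chi_{r-1},\chi_r,\chi_r'\}&\text{if } m\text{ is even and }\chi_r,\chi_r'\notin\mathcal S,\end{cases}$$ $$\mathcal C_{\chi_r}=\{\chi_r\}\ \text{if }\chi_r\in\mathcal S,\qquad \mathcal C_{\chi_r'}=\{\chi_r'\}\ \text{if }\chi_r'\in\mathcal S,\qquad \mathcal C_\epsilon=\{\epsilon\},$$ for a suitable sequence of integers $f_1\ge f_2\ge\dots\ge f_N$ (it is possible that $f_k=f_{k+1}$, in which case the second part of $\mathcal C_k$ is empty). (b) Except in the case where $m$ is even and $\mathcal S$ contains exactly one of $\chi_r$ and $\chi_r'$, one has $f_k=\lfloor\frac{m-1}{2}\rfloor$ for all $k$, so that $W$ admits a unique Springer correspondence whose set of Springer representations is $\mathcal S$ (where two Springer correspondences are identified if they have the same underlying partition of $\mathrm{Irr}(W)$). (c) If $m$ is even and $\mathcal S$ contains $\chi_r'$ but not $\chi_r$, then for any integers $r=f_1\ge f_2\ge\dots\ge f_N\ge d_N$ such that $f_k-f_{k+1}\le d_{k+1}-d_k$ for each $k$ with $1\le k\le N-1$, there is a Springer correspondence with set of Springer representations $\mathcal S$ of the form described in (a).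
   Context: **Characters.** $W=I_2(m)$ acts on $V=\mathbb C^2$ by its (complexified) reflection representation. Its irreducible characters are: the trivial character $\chi_0$; the sign character $\epsilon=\det_V$; for $1\le i\le\lfloor (m-1)/2\rfloor$ the $2$-dimensional character $\chi_i$ in which the rotation by $2\pi/m$ has eigenvalues $e^{\pm 2\pi \sqrt{-1}\, i/m}$; and, if $m=2r$ is even, the two remaining $1$-dimensional characters $\chi_r,\chi_r'$ (those taking opposite signs on the two classes of reflections). **Fake degrees.** Let $q$ be an indeterminate. For a class function $f$ on $W$ set $$R(f)(q)=\frac{(q^2-1)(q^m-1)}{2m}\sum_{w\in W}\frac{\det_V(w)f(w)}{\det_V(q\cdot \mathrm{id}_V-w)}.$$ For $\chi\in\mathrm{Irr}(W)$, $R(\chi)$ is a polynomial (the fake degree), and $b_\chi$ is the exponent of the largest power of $q$ dividing it. One has $b_{\chi_i}=i$, $b_{\chi_r'}=r$, $b_\epsilon=m$. Let $\Omega=(\omega_{\chi,\chi'})_{\chi,\chi'\in\mathrm{Irr}(W)}$ with $\omega_{\chi,\chi'}=q^{m}R(\chi\otimes\chi'\otimes\epsilon)$. **Special characters and families** (with respect to the usual one-parameter Iwahori–Hecke algebra of $W$). The special characters are $\chi_0,\chi_1,\epsilon$. The families are $\{\chi_0\}$, $\{\epsilon\}$ and $\mathrm{Irr}(W)\setminus\{\chi_0,\epsilon\}$ (the last one containing $\chi_1$). **Lusztig–Shoji datum.** A triple $(X,<,a)$ where $X$ is a partition of $\mathrm{Irr}(W)$ into disjoint nonempty subsets $\mathcal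 C$, $<$ is a total order on $X$, and $a:X\to\mathbb N$, $\mathcal C\mapsto a_{\mathcal C}$, is a (weakly) order-reversing function. For $\chi\in\mathrm{Irr}(W)$, $\mathrm{supp}\,\chi$ denotes the member of $X$ containing $\chi$. **System of Green functions** with respect to $(X,<,a)$: a solution of the matrix equation $P\Lambda P^t=\Omega$, where $P,\Lambda$ are square matrices indexed by $\mathrm{Irr}(W)$ with entries in $\mathbb Q(q)$ such that $P_{\chi,\chi'}=0$ if $\mathrm{supp}\,\chi<\mathrm{supp}\,\chi'$; $P_{\chi,\chi'}=\delta_{\chi,\chi'}q^{a_{\mathcal C}}$ if $\mathrm{supp}\,\chi=\mathrm{supp}\,\chi'=\mathcal C$; and $\Lambda_{\chi,\chi'}=0$ if $\mathrm{supp}\,\chi\ne\mathrm{supp}\,\chi'$. It is a known fact that every Lusztig–Shoji datum admits a unique system of Green functions. **Springer correspondence.** A Lusztig–Shoji datum $(X,<,a)$ is a Springer correspondence if, with $P,\Lambda$ its system of Green functions: (1) for each $\mathcal C\in X$, $a_{\mathcal C}=\min\{b_\chi\mid\chi\in\mathcal C\}$, and there is a unique member of $\mathcal C$ (called the Springer representation of $\mathcal C$) on which $b$ attains its minimum value; (2) every special character is the Springer representation of some $\mathcal C\in X$; (3) if $\chi'$ is a nonspecial character in the same family as the special character $\chi$, then $\mathrm{supp}\,\chi'\le\mathrm{supp}\,\chi$; (4) the entries of $\Lambda$ are polynomials in $q$ with integer coefficients, and the entries of $P$ are polynomials in $q$ with nonnegative integer coefficients; (5) if $\chi\in\mathcal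 C$, then $P_{\chi,\chi'}$ is divisible by $q^{a_{\mathcal C}}$ for all $\chi'$. The sets $\mathcal C\in X$ are then called unipotent classes. *)

theory Defs
  imports
    Complex_Main
    "HOL-Library.Disjoint_Sets"
    "HOL-Computational_Algebra.Polynomial_Factorial"
    "Jordan_Normal_Form.Char_Poly"
    "Jordan_Normal_Form.VS_Connect"
begin

definition representation ::
    "('a, 'b) monoid_scheme \<Rightarrow> nat \<Rightarrow> ('a \<Rightarrow> complex mat) \<Rightarrow> bool" where
  "representation G n \<rho> \<longleftrightarrow> \<rho> \<in> hom G (units_of (ring_mat TYPE(complex) n ()))"

definition irreducible_representation ::
    "('a, 'b) monoid_scheme \<Rightarrow> nat \<Rightarrow> ('a \<Rightarrow> complex mat) \<Rightarrow> bool" where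
  "irreducible_representation G n \<rho> \<longleftrightarrow>
     representation G n \<rho> \<and> 0 < n \<and>
     (\<forall>U. subspace class_ring U (module_vec TYPE(complex) n) \<and>
          (\<forall>g \<in> carrier G. \<forall>v \<in> U. \<rho> g *\<^sub>v v \<in> U) \<longrightarrow>
          U = {0\<^sub>v n} \<or> U = carrier_vec n)"

text \<open>Characters are restricted to the carrier, so that equality of characters is equality of
  functions on the group.\<close>

definition character ::
    "('a, 'b) monoid_scheme \<Rightarrow> ('a \<Rightarrow> complex mat) \<Rightarrow> 'a \<Rightarrow> complex" where
  "character G \<rho> = restrict (\<lambda>g. \<Sum>j < dim_row (\<rho> g). \<rho> g $$ (j, j)) (carrier G)"

definition Irr :: "('a, 'b) monoid_scheme \<Rightarrow> ('a \<Rightarrow> complex) set" where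
  "Irr G = {character G \<rho> | n \<rho>. irreducible_representation G n \<rho>}"

definition rotation :: "real \<Rightarrow> complex mat" where
  "rotation t = mat_of_rows_list 2
     [[of_real (cos t), - of_real (sin t)],
      [of_real (sin t),   of_real (cos t)]]"

definition reflection :: "real \<Rightarrow> complex mat" where
  "reflection t = mat_of_rows_list 2
     [[of_real (cos t),   of_real (sin t)],
      [of_real (sin t), - of_real (cos t)]]"

text \<open>The group is realised inside the general linear group of the complexified reflection
  representation, so an element \<open>w\<close> is its own action on \<open>V\<close>.\<close>

definition I2 :: "nat \<Rightarrow> complex mat monoid" where
  "I2 m = \<lparr>carrier = (\<lambda>k. rotation (2 * pi * real k / real m)) ` {..<m} \<union>
                     (\<lambda>k. reflection (2 * pi * real k / real m)) ` {..<m},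
           monoid.mult = (*), one = 1\<^sub>m 2\<rparr>"

type_synonym class_fun = "complex mat \<Rightarrow> complex"

definition trivial_char :: "nat \<Rightarrow> class_fun" where
  "trivial_char m = restrict (\<lambda>w. 1) (carrier (I2 m))"

definition sign_char :: "nat \<Rightarrow> class_fun" where
  "sign_char m = restrict det (carrier (I2 m))"

definition two_dim_char :: "nat \<Rightarrow> nat \<Rightarrow> class_fun" where
  "two_dim_char m i = (THE \<chi>. \<exists>\<rho>. irreducible_representation (I2 m) 2 \<rho> \<and>
     \<chi> = character (I2 m) \<rho> \<and>
     {z. eigenvalue (\<rho> (rotation (2 * pi / real m))) z} =
       {cis (2 * pi * real i / real m), cis (- (2 * pi * real i / real m))})"

definition remaining_linear_chars :: "nat \<Rightarrow> class_fun set" where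
  "remaining_linear_chars m =
     {\<chi> \<in> Irr (I2 m). \<chi> (1\<^sub>m 2) = 1} - {trivial_char m, sign_char m}"

text \<open>The uniform indexing \<open>\<chi>\<^sub>i\<close> for \<open>0 \<le> i \<le> m / 2\<close>. The labelling of the two remaining
  one-dimensional characters is not canonical, so the one called \<open>\<chi>\<^sub>r\<close>, \<open>r = m / 2\<close>, is a
  parameter.\<close>

definition chi :: "nat \<Rightarrow> class_fun \<Rightarrow> nat \<Rightarrow> class_fun" where
  "chi m \<chi>r i =
     (if i = 0 then trivial_char m else if 2 * i = m then \<chi>r else two_dim_char m i)"

text \<open>\<open>\<rat>(q)\<close> is regarded as a subfield of \<open>\<complex>(q)\<close>. Note that \<open>char_poly w\<close> is \<open>det (q \<cdot> id - w)\<close>.\<close>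

type_synonym ratfun = "complex poly fract"

definition fake_degree :: "nat \<Rightarrow> class_fun \<Rightarrow> ratfun" where
  "fake_degree m f =
     to_fract ((monom 1 2 - 1) * (monom 1 m - 1)) / of_nat (2 * m) *
     (\<Sum>w \<in> carrier (I2 m). to_fract [:det w * f w:] / to_fract (char_poly w))"

definition b_invariant :: "nat \<Rightarrow> class_fun \<Rightarrow> nat" where
  "b_invariant m \<chi> = Polynomial.order 0 (THE p. to_fract p = fake_degree m \<chi>)"

definition Omega :: "nat \<Rightarrow> class_fun \<Rightarrow> class_fun \<Rightarrow> ratfun" where
  "Omega m \<chi> \<chi>' =
     to_fract (monom 1 m) * fake_degree m (\<lambda>w. \<chi> w * \<chi>' w * sign_char m w)"

definition special_chars :: "nat \<Rightarrow> class_fun set" where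
  "special_chars m = {trivial_char m, two_dim_char m 1, sign_char m}"

definition families :: "nat \<Rightarrow> class_fun set set" where
  "families m = {{trivial_char m}, {sign_char m},
                 Irr (I2 m) - {trivial_char m, sign_char m}}"

text \<open>The strict total order on \<open>X\<close> is given by its set of pairs \<open>L\<close>: \<open>C < C'\<close> means \<open>(C, C') \<in> L\<close>.\<close>

definition lusztig_shoji_datum ::
    "nat \<Rightarrow> class_fun set set \<Rightarrow> class_fun set rel \<Rightarrow> (class_fun set \<Rightarrow> nat) \<Rightarrow> bool" where
  "lusztig_shoji_datum m X L a \<longleftrightarrow>
     partition_on (Irr (I2 m)) X \<and>
     L \<subseteq> X \<times> X \<and> strict_linear_order_on X L \<and>
     (\<forall>(C, C') \<in> L. a C' \<le> a C)"

definition supp :: "class_fun set set \<Rightarrow> class_fun \<Rightarrow> class_fun set" where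
  "supp X \<chi> = (THE C. C \<in> X \<and> \<chi> \<in> C)"

definition rational_ratfuns :: "ratfun set" where
  "rational_ratfuns = {to_fract u / to_fract v | u v.
     (\<forall>i. coeff u i \<in> \<rat>) \<and> (\<forall>i. coeff v i \<in> \<rat>) \<and> v \<noteq> 0}"

definition integer_polys :: "ratfun set" where
  "integer_polys = {to_fract p | p. \<forall>i. coeff p i \<in> \<int>}"

definition nonneg_integer_polys :: "ratfun set" where
  "nonneg_integer_polys = {to_fract p | p. \<forall>i. coeff p i \<in> \<nat>}"

definition green_functions ::
    "nat \<Rightarrow> class_fun set set \<Rightarrow> class_fun set rel \<Rightarrow> (class_fun set \<Rightarrow> nat) \<Rightarrow>
     (class_fun \<Rightarrow> class_fun \<Rightarrow> ratfun) \<Rightarrow> (class_fun \<Rightarrow> class_fun \<Rightarrow> ratfun) \<Rightarrow> bool" where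
  "green_functions m X L a P \<Lambda> \<longleftrightarrow>
     (\<forall>\<chi> \<in> Irr (I2 m). \<forall>\<chi>' \<in> Irr (I2 m).
        P \<chi> \<chi>' \<in> rational_ratfuns \<and>
        \<Lambda> \<chi> \<chi>' \<in> rational_ratfuns \<and>
        (\<Sum>\<phi> \<in> Irr (I2 m). \<Sum>\<phi>' \<in> Irr (I2 m). P \<chi> \<phi> * \<Lambda> \<phi> \<phi>' * P \<chi>' \<phi>') = Omega m \<chi> \<chi>' \<and>
        ((supp X \<chi>, supp X \<chi>') \<in> L \<longrightarrow> P \<chi> \<chi>' = 0) \<and>
        (supp X \<chi> = supp X \<chi>' \<longrightarrow>
           P \<chi> \<chi>' = (if \<chi> = \<chi>' then to_fract (monom 1 (a (supp X \<chi>))) else 0)) \<and>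
        (supp X \<chi> \<noteq> supp X \<chi>' \<longrightarrow> \<Lambda> \<chi> \<chi>' = 0))"

text \<open>\<open>\<chi>\<close> is the unique member of \<open>C\<close> on which \<open>b\<close> attains its minimum.\<close>

definition springer_rep :: "nat \<Rightarrow> class_fun set \<Rightarrow> class_fun \<Rightarrow> bool" where
  "springer_rep m C \<chi> \<longleftrightarrow>
     \<chi> \<in> C \<and> (\<forall>\<chi>' \<in> C - {\<chi>}. b_invariant m \<chi> < b_invariant m \<chi>')"

text \<open>A datum has exactly one system of Green functions, so the existential quantifier over
  \<open>P\<close> and \<open>\<Lambda>\<close> below picks out that system.\<close>

definition springer_correspondence ::
    "nat \<Rightarrow> class_fun set set \<Rightarrow> class_fun set rel \<Rightarrow> (class_fun set \<Rightarrow> nat) \<Rightarrow> bool" where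
  "springer_correspondence m X L a \<longleftrightarrow>
     lusztig_shoji_datum m X L a \<and>
     (\<forall>C \<in> X. a C = Min (b_invariant m ` C) \<and> (\<exists>\<chi>. springer_rep m C \<chi>)) \<and>
     (\<forall>\<chi> \<in> special_chars m. \<exists>C \<in> X. springer_rep m C \<chi>) \<and>
     (\<forall>F \<in> families m. \<forall>\<chi> \<in> F \<inter> special_chars m. \<forall>\<chi>' \<in> F - special_chars m.
        supp X \<chi>' = supp X \<chi> \<or> (supp X \<chi>', supp X \<chi>) \<in> L) \<and>
     (\<exists>P \<Lambda>. green_functions m X L a P \<Lambda> \<and>
        (\<forall>\<chi> \<in> Irr (I2 m). \<forall>\<chi>' \<in> Irr (I2 m).
           \<Lambda> \<chi> \<chi>' \<in> integer_polys \<and> P \<chi> \<chi>' \<in> nonneg_integer_polys) \<and>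
        (\<forall>C \<in> X. \<forall>\<chi> \<in> C. \<forall>\<chi>' \<in> Irr (I2 m).
           \<exists>p. P \<chi> \<chi>' = to_fract (monom 1 (a C) * p)))"

definition springer_reps :: "nat \<Rightarrow> class_fun set set \<Rightarrow> class_fun set" where
  "springer_reps m X = {\<chi>. \<exists>C \<in> X. springer_rep m C \<chi>}"

definition unipotent_class :: "nat \<Rightarrow> class_fun set set \<Rightarrow> class_fun \<Rightarrow> class_fun set \<Rightarrow> bool" where
  "unipotent_class m X \<chi> C \<longleftrightarrow> C \<in> X \<and> springer_rep m C \<chi>"

text \<open>For odd \<open>m\<close> the arguments \<open>\<chi>r\<close> and \<open>\<chi>r'\<close> play no role.\<close>

definition has_shape ::
    "nat \<Rightarrow> class_fun \<Rightarrow> class_fun \<Rightarrow> class_fun set \<Rightarrow> nat \<Rightarrow> (nat \<Rightarrow> nat) \<Rightarrow> (nat \<Rightarrow> nat) \<Rightarrow>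
     class_fun set set \<Rightarrow> bool" where
  "has_shape m \<chi>r \<chi>r' S N d f X \<longleftrightarrow>
     unipotent_class m X (chi m \<chi>r (d 0)) {trivial_char m} \<and>
     (\<forall>k. 1 \<le> k \<and> k < N \<longrightarrow>
        unipotent_class m X (chi m \<chi>r (d k))
          (chi m \<chi>r ` {d k..<d (Suc k)} \<union> chi m \<chi>r ` {f (Suc k)<..f k})) \<and>
     (odd m \<or> (\<chi>r \<in> S \<and> \<chi>r' \<in> S) \<longrightarrow>
        unipotent_class m X (chi m \<chi>r (d N)) (chi m \<chi>r ` {d N..(m - 1) div 2})) \<and>
     (even m \<and> \<chi>r \<notin> S \<and> \<chi>r' \<in> S \<longrightarrow>
        unipotent_class m X (chi m \<chi>r (d N)) (chi m \<chi>r ` {d N..f N})) \<and>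
     (even m \<and> \<chi>r \<notin> S \<and> \<chi>r' \<notin> S \<longrightarrow>
        unipotent_class m X (chi m \<chi>r (d N))
          (chi m \<chi>r ` {d N..<m div 2} \<union> {\<chi>r, \<chi>r'})) \<and>
     (even m \<and> \<chi>r \<in> S \<longrightarrow> unipotent_class m X \<chi>r {\<chi>r}) \<and>
     (even m \<and> \<chi>r' \<in> S \<longrightarrow> unipotent_class m X \<chi>r' {\<chi>r'}) \<and>
     unipotent_class m X (sign_char m) {sign_char m}"

end

theory Submission
  imports Defs
begin

text \<open>After elimination of the sign character, \<open>\<Omega>\<close> becomes \<open>(q\<^sup>m - 1) M\<close>, where
  \<open>M\<^sub>i\<^sub>j = q\<^sup>i (q\<^sup>j + q\<^bsup>m-j\<^esup>)\<close> for \<open>i \<le> j < m / 2\<close>, with a similar formula for the remaining two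
  linear characters: the index set is essentially a path and \<open>M\<close> is a Green kernel on it.

  Rigidity: let \<open>E\<close> be a set of indices closed downwards for the order of the classes. By block
  triangularity of \<open>P\<close>, a combination of columns of \<open>M\<close> indexed by \<open>E\<close> which vanishes at \<open>q = z \<noteq> 0\<close>
  on all rows in \<open>E\<close> vanishes there on every row. If \<open>z\<^sup>c\<^sup>'\<^sup>-\<^sup>c = -1\<close>, the sum of the columns \<open>c\<close> and
  \<open>c'\<close> vanishes at \<open>z\<close> on all rows outside the open interval from \<open>c\<close> to \<open>c'\<close>, but, for a primitive
  choice of \<open>z\<close>, on no row inside it. So \<open>E\<close> has no gaps, and the
  set of indices below the \<open>k\<close>-th class meets the path in an interval starting at \<open>d\<^sub>k\<close>; the classes are
  the successive differences of these intervals. Nonnegativity of \<open>P\<close> is needed only to see that \<open>\<chi>\<^sub>r\<close>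
  and \<open>\<chi>\<^sub>r'\<close> are not separated when neither is a Springer representation.

  Existence: after the elimination of an interval the two sides of the path decouple into Green
  kernels of the same kind, on which the projection to a class is supported at the endpoint nearest
  to the given index. Hence \<open>P\<close> has monomial entries and \<open>\<Lambda>\<close> is explicit, and \<open>P \<Lambda> P\<^sup>t = \<Omega>\<close>
  telescopes.\<close>

section \<open>The dihedral group and its irreducible characters\<close>

text \<open>The sign is removed by a Schur complement: its column in \<Omega> is
  \<open>q^m * fdeg i\<close>, its diagonal entry \<open>q^(2m)\<close>, so it carries the rank one
  part \<open>fdeg i * fdeg j\<close>. On the planar characters \<open>M\<close> is
  \<open>q^(m-|i-j|) + q^(i+j)\<close>. The first term depends on a distance and factors through
  every point between i and j. The second is cancelled once by each of the two remaining linear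
  characters that lies in \<open>S\<close>. If exactly one does, only the distance term is left; it
  does not distinguish the two ends of the path, so intervals may shrink on the right as well, and
  this is the freedom in (c). Otherwise the right end is rigid. Eliminating an interval with end e
  replaces K(i,j) by K(i,j) - K(i,e) K(e,j) / K(e,e), that is, it subtracts the same kernel measured
  along the route through e. Entries of \<open>P\<close> on the path are
  \<open>q^(d - distance to e)\<close>; the bound on \<open>f_k - f_(k+1)\<close> makes these
  exponents nonnegative and large enough for condition (5). In the rigidity part z may be a zero of
  \<open>q^m - 1\<close> itself, so evaluation at z is replaced by divisibility by
  \<open>(q^m - 1) (q - z)\<close>.\<close>

definition mat2 :: "'a \<Rightarrow> 'a \<Rightarrow> 'a \<Rightarrow> 'a \<Rightarrow> 'a mat" where
  "mat2 a b c d = mat_of_rows_list 2 [[a, b], [c, d]]"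

lemma mat2_index [simp]:
  "mat2 a b c d $$ (0, 0) = a" "mat2 a b c d $$ (0, Suc 0) = b"
  "mat2 a b c d $$ (Suc 0, 0) = c" "mat2 a b c d $$ (Suc 0, Suc 0) = d"
  by (auto simp: mat2_def mat_of_rows_list_def)

lemma mat2_dim [simp]: "dim_row (mat2 a b c d) = 2" "dim_col (mat2 a b c d) = 2"
  by (auto simp: mat2_def mat_of_rows_list_def)

lemma mat2_carrier [simp]: "mat2 a b c d \<in> carrier_mat 2 2"
  by (rule carrier_matI) simp_all

lemma mat2_eq_iff [simp]:
  "mat2 a b c d = mat2 a' b' c' d' \<longleftrightarrow> a = a' \<and> b = b' \<and> c = c' \<and> d = d'"
  by (metis mat2_index)

lemma mat2_eqI:
  assumes "M \<in> carrier_mat 2 2"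
    and "M $$ (0, 0) = a" "M $$ (0, Suc 0) = b" "M $$ (Suc 0, 0) = c" "M $$ (Suc 0, Suc 0) = d"
  shows "M = mat2 a b c d"
  using assms by (intro eq_matI) (auto simp: less_2_cases_iff)

lemma mat2_mult:
  "mat2 a b c d * mat2 a' b' c' d' =
    mat2 (a * a' + b * c') (a * b' + b * d') (c * a' + d * c') (c * b' + d * d' :: 'a :: comm_ring_1)"
  by (intro mat2_eqI mult_carrier_mat[of _ 2 2]) (auto simp: scalar_prod_def numeral_2_eq_2)

lemma one_mat2: "1\<^sub>m 2 = mat2 1 0 0 (1 :: 'a :: comm_ring_1)"
  by (intro mat2_eqI) auto

lemma det_mat2 [simp]: "det (mat2 a b c d) = a * d - b * (c :: 'a :: comm_ring_1)"
proof -
  have "det (mat2 a b c d) = (\<Sum>i<2. mat2 a b c d $$ (i, 0) * cofactor (mat2 a b c d) i 0)"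
    by (rule laplace_expansion_column[of _ 2]) auto
  then show ?thesis
    by (simp add: numeral_2_eq_2 cofactor_def mat_delete_def det_single)
qed

lemma char_poly_mat2:
  "char_poly (mat2 a b c d) = [:a * d - b * c, - a - d, 1 :: 'a :: comm_ring_1:]"
proof -
  have "char_poly_matrix (mat2 a b c d) = mat2 [:-a, 1:] [:-b:] [:-c:] [:-d, 1:]"
    by (intro mat2_eqI) (auto simp: char_poly_matrix_def)
  then show ?thesis
    by (simp add: char_poly_def algebra_simps)
qed

section \<open>Roots of unity and the elements of the dihedral group\<close>

definition unity_root :: "nat \<Rightarrow> int \<Rightarrow> complex" where
  "unity_root m x = cis (2 * pi * of_int x / real m)"

text \<open>The index ranges over all integers although the carrier lists only
  \<open>0..m-1\<close>: products and inverses become sums and negatives of indices, with no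
  reduction mod m.\<close>

definition rot :: "nat \<Rightarrow> int \<Rightarrow> complex mat" where
  "rot m k = rotation (2 * pi * of_int k / real m)"

definition rfl :: "nat \<Rightarrow> int \<Rightarrow> complex mat" where
  "rfl m k = reflection (2 * pi * of_int k / real m)"

lemma unity_root_add: "unity_root m (x + y) = unity_root m x * unity_root m y"
  by (simp add: unity_root_def cis_mult add_divide_distrib distrib_left)

lemma unity_root_0 [simp]: "unity_root m 0 = 1"
  by (simp add: unity_root_def)

lemma unity_root_nonzero [simp]: "unity_root m x \<noteq> 0"
  by (simp add: unity_root_def)

lemma unity_root_minus: "unity_root m (- x) = inverse (unity_root m x)"
  by (simp add: unity_root_def)

lemma unity_root_diff: "unity_root m (x - y) = unity_root m x / unity_root m y"
  by (metis unity_root_add unity_root_minus divide_inverse diff_conv_add_uminus)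

lemma unity_root_power: "unity_root m x ^ n = unity_root m (int n * x)"
  by (simp add: unity_root_def DeMoivre) (simp add: field_simps)

lemma unity_root_eq_1_iff: "m > 0 \<Longrightarrow> unity_root m x = 1 \<longleftrightarrow> int m dvd x"
proof -
  assume m: "m > 0"
  have "cis t = 1 \<longleftrightarrow> cos t = 1" for t
    using sin_cos_squared_add[of t] by (auto simp: complex_eq_iff power2_eq_square)
  then have "unity_root m x = 1 \<longleftrightarrow> (\<exists>n::int. 2 * pi * of_int x / real m = of_int n * 2 * pi)"
    unfolding unity_root_def cos_one_2pi_int by simp
  also have "\<dots> \<longleftrightarrow> (\<exists>n::int. of_int x = real m * of_int n)"
    using m by (simp add: field_simps)
  also have "\<dots> \<longleftrightarrow> (\<exists>n::int. x = int m * n)"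
    by (metis (mono_tags) of_int_eq_iff of_int_mult of_int_of_nat_eq)
  finally show ?thesis by (auto simp: dvd_def)
qed

lemma unity_root_eq_iff: "m > 0 \<Longrightarrow> unity_root m x = unity_root m y \<longleftrightarrow> int m dvd x - y"
  by (metis unity_root_diff unity_root_eq_1_iff unity_root_nonzero divide_self_if eq_divide_eq_1 right_inverse_eq)

lemma unity_root_periodic [simp]: "m > 0 \<Longrightarrow> unity_root m (x mod int m) = unity_root m x"
  by (simp add: unity_root_eq_iff mod_eq_dvd_iff flip: mod_eq_dvd_iff)

lemma rot_eq: "rot m k = mat2 (of_real (Re (unity_root m k))) (- of_real (Im (unity_root m k)))
    (of_real (Im (unity_root m k))) (of_real (Re (unity_root m k)))"
  by (simp add: rot_def rotation_def unity_root_def mat2_def)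

lemma rfl_eq: "rfl m k = mat2 (of_real (Re (unity_root m k))) (of_real (Im (unity_root m k)))
    (of_real (Im (unity_root m k))) (- of_real (Re (unity_root m k)))"
  by (simp add: rfl_def reflection_def unity_root_def mat2_def)

lemma rot_rot: "rot m j * rot m k = rot m (j + k)"
  and rot_rfl: "rot m j * rfl m k = rfl m (j + k)"
  and rfl_rot: "rfl m j * rot m k = rfl m (j - k)"
  and rfl_rfl: "rfl m j * rfl m k = rot m (j - k)"
proof -
  have cnj: "unity_root m (- k) = cnj (unity_root m k)"
    by (simp add: unity_root_def cis_cnj)
  show "rot m j * rot m k = rot m (j + k)" "rot m j * rfl m k = rfl m (j + k)"
    by (simp_all add: rot_eq rfl_eq mat2_mult unity_root_add)
  show "rfl m j * rot m k = rfl m (j - k)" "rfl m j * rfl m k = rot m (j - k)"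
    unfolding diff_conv_add_uminus unity_root_add cnj rot_eq rfl_eq mat2_mult by simp_all
qed

lemmas dihedral_mult = rot_rot rot_rfl rfl_rot rfl_rfl

lemma rot_0: "rot m 0 = 1\<^sub>m 2"
  by (simp add: rot_eq one_mat2)

lemma unity_root_norm_sq: "(Re (unity_root m k))\<^sup>2 + (Im (unity_root m k))\<^sup>2 = 1"
  by (simp add: unity_root_def)

lemma det_rot [simp]: "det (rot m k) = 1" and det_rfl [simp]: "det (rfl m k) = -1"
proof -
  have "of_real ((Re (unity_root m k))\<^sup>2 + (Im (unity_root m k))\<^sup>2) = (1::complex)"
    by (simp only: unity_root_norm_sq of_real_1)
  then show "det (rot m k) = 1" "det (rfl m k) = -1"
    unfolding rot_eq rfl_eq det_mat2 by (simp_all add: power2_eq_square add.commute) 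
      (metis minus_add_distrib uminus_add_conv_diff)
qed

text \<open>Recovers \<open>e^(it)\<close> from the first column of a rotation or reflection, so
  that class functions can be defined on matrices without choosing an index k.\<close>

definition phase :: "complex mat \<Rightarrow> complex" where
  "phase w = w $$ (0, 0) + \<i> * w $$ (1, 0)"

lemma phase_rot [simp]: "phase (rot m k) = unity_root m k" and phase_rfl [simp]: "phase (rfl m k) = unity_root m k"
  by (simp_all add: phase_def rot_eq rfl_eq complex_eq_iff)

lemma carrier_I2:
  "carrier (I2 m) = (\<lambda>k. rot m (int k)) ` {..<m} \<union> (\<lambda>k. rfl m (int k)) ` {..<m}"
  by (simp add: I2_def rot_def rfl_def)

lemma I2_mult: "(\<otimes>\<^bsub>I2 m\<^esub>) = (*)"
  by (simp add: I2_def)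

lemma I2_induct [consumes 2, case_names rot rfl]:
  assumes "w \<in> carrier (I2 m)" "m > 0" "\<And>k. P (rot m k)" "\<And>k. P (rfl m k)"
  shows "P w"
  using assms by (auto simp: carrier_I2)

lemma rot_in_carrier [simp]: "m > 0 \<Longrightarrow> rot m k \<in> carrier (I2 m)"
  and rfl_in_carrier [simp]: "m > 0 \<Longrightarrow> rfl m k \<in> carrier (I2 m)"
proof -
  assume m: "m > 0"
  then have "rot m k = rot m (int (nat (k mod int m)))" "rfl m k = rfl m (int (nat (k mod int m)))"
    and "nat (k mod int m) < m"
    by (simp_all add: rot_eq rfl_eq nat_less_iff)
  then show "rot m k \<in> carrier (I2 m)" "rfl m k \<in> carrier (I2 m)"
    unfolding carrier_I2 by blast+
qed

text \<open>The 2m listed matrices are distinct: \<open>phase\<close> separates two of the same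
  kind, the determinant separates rotations from reflections.\<close>

lemma sum_carrier_I2:
  assumes m: "m > 0"
  shows "sum f (carrier (I2 m)) = (\<Sum>k<m. f (rot m (int k))) + (\<Sum>k<m. f (rfl m (int k)))"
proof -
  have inj: "x = y" if "unity_root m (int x) = unity_root m (int y)" "x < m" "y < m" for x y
  proof -
    have "int x mod int m = int y mod int m"
      using that m by (metis unity_root_eq_iff mod_eq_dvd_iff)
    then show ?thesis using that by (metis mod_less of_nat_eq_iff of_nat_mod)
  qed
  have "inj_on (\<lambda>k. rot m (int k)) {..<m}" "inj_on (\<lambda>k. rfl m (int k)) {..<m}"
    by (rule inj_onI, metis inj phase_rot phase_rfl lessThan_iff)+
  moreover have "(\<lambda>k. rot m (int k)) ` {..<m} \<inter> (\<lambda>k. rfl m (int k)) ` {..<m} = {}"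
  proof -
    have "rot m k \<noteq> rfl m l" for k l
      using det_rot[of m k] det_rfl[of m l] by fastforce
    then show ?thesis by blast
  qed
  ultimately show ?thesis
    unfolding carrier_I2 by (subst sum.union_disjoint) (auto simp: sum.reindex)
qed

lemma finite_carrier_I2 [simp]: "finite (carrier (I2 m))"
  by (simp add: carrier_I2)

definition linear_char :: "nat \<Rightarrow> nat \<Rightarrow> complex \<Rightarrow> class_fun" where
  "linear_char m i \<beta> =
     restrict (\<lambda>w. (if det w = 1 then 1 else \<beta>) * phase w ^ i) (carrier (I2 m))"

definition planar_char :: "nat \<Rightarrow> nat \<Rightarrow> class_fun" where
  "planar_char m i =
     restrict (\<lambda>w. if det w = 1 then phase w ^ i + inverse (phase w ^ i) else 0) (carrier (I2 m))"

lemma linear_char_simps [simp]: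
  assumes "m > 0"
  shows "linear_char m i \<beta> (rot m k) = unity_root m (int i * k)"
    and "linear_char m i \<beta> (rfl m k) = \<beta> * unity_root m (int i * k)"
  using assms by (simp_all add: linear_char_def unity_root_power)

lemma planar_char_simps [simp]:
  assumes "m > 0"
  shows "planar_char m i (rot m k) = unity_root m (int i * k) + unity_root m (- (int i * k))"
    and "planar_char m i (rfl m k) = 0"
  using assms by (simp_all add: planar_char_def unity_root_power unity_root_minus)

lemma class_fun_eqI:
  assumes "m > 0" "f \<in> extensional (carrier (I2 m))" "g \<in> extensional (carrier (I2 m))"
    and "\<And>k. f (rot m k) = g (rot m k)" "\<And>k. f (rfl m k) = g (rfl m k)"
  shows "f = g"
  using assms(2,3)
proof (rule extensionalityI)
  fix w assume "w \<in> carrier (I2 m)"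
  then show "f w = g w" using assms by (induction w rule: I2_induct) auto
qed

lemma extensional_chars [simp]:
  "linear_char m i \<beta> \<in> extensional (carrier (I2 m))"
  "planar_char m i \<in> extensional (carrier (I2 m))"
  "character (I2 m) \<rho> \<in> extensional (carrier (I2 m))"
  by (auto simp: linear_char_def planar_char_def character_def)

lemma trivial_char_eq: "m > 0 \<Longrightarrow> trivial_char m = linear_char m 0 1"
  and sign_char_eq: "m > 0 \<Longrightarrow> sign_char m = linear_char m 0 (-1)"
  by (rule class_fun_eqI[of m]; simp add: trivial_char_def sign_char_def)+

section \<open>Classification of the irreducible representations\<close>

lemma subspace_vec_iff:
  "subspace class_ring U (module_vec TYPE(complex) n) \<longleftrightarrow>
     U \<subseteq> carrier_vec n \<and> 0\<^sub>v n \<in> U \<and> (\<forall>u\<in>U. \<forall>v\<in>U. u + v \<in> U) \<and> (\<forall>c. \<forall>u\<in>U. c \<cdot>\<^sub>v u \<in> U)"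
  using vec_vs[where 'a = complex, of n] vec_module[where 'a = complex, of n]
  by (auto simp: VectorSpace.subspace_def submodule_def module_vec_simps class_ring_simps)

text \<open>\<open>hom\<close> demands multiplicativity only. The image of the identity is
  idempotent and invertible, hence the identity matrix.\<close>

lemma representationD:
  assumes "representation (I2 m) n \<rho>" "m > 0"
  shows "\<And>w. w \<in> carrier (I2 m) \<Longrightarrow> \<rho> w \<in> carrier_mat n n"
    and "\<And>v w. v \<in> carrier (I2 m) \<Longrightarrow> w \<in> carrier (I2 m) \<Longrightarrow> \<rho> (v * w) = \<rho> v * \<rho> w"
    and "\<rho> (rot m 0) = 1\<^sub>m n"
proof -
  have U: "\<rho> w \<in> Units (ring_mat TYPE(complex) n ())" if "w \<in> carrier (I2 m)" for w
    using assms that by (auto simp: representation_def hom_def units_of_def)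
  show c: "\<rho> w \<in> carrier_mat n n" if "w \<in> carrier (I2 m)" for w
    using U[OF that] by (auto simp: Units_def ring_mat_simps)
  show h: "\<rho> (v * w) = \<rho> v * \<rho> w" if "v \<in> carrier (I2 m)" "w \<in> carrier (I2 m)" for v w
    using assms that by (auto simp: representation_def hom_def units_of_def I2_mult ring_mat_simps)
  let ?A = "\<rho> (rot m 0)"
  have A: "?A \<in> carrier_mat n n" and AA: "?A * ?A = ?A"
    using c h[of "rot m 0" "rot m 0"] assms(2) by (auto simp: dihedral_mult)
  obtain B where B: "B \<in> carrier_mat n n" "B * ?A = 1\<^sub>m n"
    using U[of "rot m 0"] assms(2) by (auto simp: Units_def ring_mat_simps)
  have "?A = (B * ?A) * ?A" using A B by simp
  also have "\<dots> = B * (?A * ?A)" by (rule assoc_mult_mat) (use A B in auto)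
  finally show "?A = 1\<^sub>m n" using AA B by simp
qed

lemma representationI:
  assumes m: "m > 0"
    and c: "\<And>w. w \<in> carrier (I2 m) \<Longrightarrow> \<rho> w \<in> carrier_mat n n"
    and h: "\<And>v w. v \<in> carrier (I2 m) \<Longrightarrow> w \<in> carrier (I2 m) \<Longrightarrow> \<rho> (v * w) = \<rho> v * \<rho> w"
    and one: "\<rho> (rot m 0) = 1\<^sub>m n"
  shows "representation (I2 m) n \<rho>"
proof -
  have "\<exists>w'\<in>carrier (I2 m). w' * w = rot m 0 \<and> w * w' = rot m 0" if "w \<in> carrier (I2 m)" for w
    using that m
  proof (induction w rule: I2_induct)
    case (rot k)
    then show ?case using m by (intro bexI[of _ "rot m (- k)"]) (auto simp: dihedral_mult)
  next
    case (rfl k)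
    then show ?case using m by (intro bexI[of _ "rfl m k"]) (auto simp: dihedral_mult)
  qed
  note inv = this
  have "\<rho> w \<in> Units (ring_mat TYPE(complex) n ())" if w: "w \<in> carrier (I2 m)" for w
  proof -
    obtain w' where w': "w' \<in> carrier (I2 m)" "w' * w = rot m 0" "w * w' = rot m 0"
      using inv[OF w] by blast
    then have "\<rho> w' * \<rho> w = 1\<^sub>m n" "\<rho> w * \<rho> w' = 1\<^sub>m n"
      using h[OF w' (1) w] h[OF w w'(1)] one by simp_all
    then show ?thesis using c[OF w] c[OF w'(1)] by (auto simp: Units_def ring_mat_simps)
  qed
  then show ?thesis
    using h by (auto simp: representation_def hom_def units_of_def I2_mult ring_mat_simps)
qed

text \<open>The trace is the infinitesimal action on the area form D:
  \<open>tr M * D(v,w) = D(M v, w) + D(v, M w)\<close>. It gives the character in the basis v, w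
  without a change of basis.\<close>

lemma trace_mat2:
  fixes M :: "complex mat"
  assumes "M \<in> carrier_mat 2 2" "v \<in> carrier_vec 2" "w \<in> carrier_vec 2"
  shows "(M $$ (0,0) + M $$ (1,1)) * (v $ 0 * w $ 1 - v $ 1 * w $ 0) =
    (M *\<^sub>v v) $ 0 * w $ 1 - (M *\<^sub>v v) $ 1 * w $ 0 + (v $ 0 * (M *\<^sub>v w) $ 1 - v $ 1 * (M *\<^sub>v w) $ 0)"
  using assms by (auto simp: scalar_prod_def numeral_2_eq_2 row_def algebra_simps)

lemma exists_eigenvector:
  fixes A :: "complex mat"
  assumes A: "A \<in> carrier_mat n n" and n: "n > 0"
  obtains e v where "v \<in> carrier_vec n" "v \<noteq> 0\<^sub>v n" "A *\<^sub>v v = e \<cdot>\<^sub>v v"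
proof -
  have "degree (char_poly A) = n"
    using degree_monic_char_poly[OF A] by simp
  then have "\<not> constant (poly (char_poly A))"
    using n by (simp add: constant_degree)
  then obtain e where "poly (char_poly A) e = 0"
    using fundamental_theorem_of_algebra by blast
  then have "eigenvalue A e" using eigenvalue_root_char_poly[OF A] by simp
  then show ?thesis using that A unfolding eigenvalue_def eigenvector_def by auto
qed

text \<open>If \<open>v\<close> is an eigenvector of the generating rotation and \<open>w\<close> its image under a reflection,
  then \<open>v\<close> and \<open>w\<close> span an invariant subspace.\<close>

lemma rotation_eigenvector:
  assumes rep: "representation (I2 m) n \<rho>" and n: "n > 0" and m: "m > 0"
  obtains i v w where "i < m" "v \<in> carrier_vec n" "w \<in> carrier_vec n" "v \<noteq> 0\<^sub>v n"
    and "\<And>k. \<rho> (rot m k) *\<^sub>v v = unity_root m (int i * k) \<cdot>\<^sub>v v"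
    and "\<And>k. \<rho> (rot m k) *\<^sub>v w = unity_root m (- (int i * k)) \<cdot>\<^sub>v w"
    and "\<And>k. \<rho> (rfl m k) *\<^sub>v v = unity_root m (- (int i * k)) \<cdot>\<^sub>v w"
    and "\<And>k. \<rho> (rfl m k) *\<^sub>v w = unity_root m (int i * k) \<cdot>\<^sub>v v"
proof -
  note R = representationD[OF rep m]
  have c: "\<rho> (rot m k) \<in> carrier_mat n n" "\<rho> (rfl m k) \<in> carrier_mat n n" for k
    using R(1) m by auto
  obtain e v where v: "v \<in> carrier_vec n" "v \<noteq> 0\<^sub>v n" and ev: "\<rho> (rot m 1) *\<^sub>v v = e \<cdot>\<^sub>v v"
    using exists_eigenvector[OF c(1) n] by blast
  have pow: "\<rho> (rot m (int k)) *\<^sub>v v = e ^ k \<cdot>\<^sub>v v" for k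
  proof (induction k)
    case (Suc k)
    have "\<rho> (rot m (int (Suc k))) = \<rho> (rot m 1) * \<rho> (rot m (int k))"
      using R(2)[of "rot m 1" "rot m (int k)"] m by (simp add: dihedral_mult add.commute)
    then have "\<rho> (rot m (int (Suc k))) *\<^sub>v v = \<rho> (rot m 1) *\<^sub>v (\<rho> (rot m (int k)) *\<^sub>v v)"
      using v c assoc_mult_mat_vec[of "\<rho> (rot m 1)" n n "\<rho> (rot m (int k))" n v] by simp
    also have "\<dots> = e ^ k \<cdot>\<^sub>v (e \<cdot>\<^sub>v v)"
      using v c(1)[of 1] ev by (simp add: Suc.IH mult_mat_vec)
    finally show ?case by (simp add: smult_smult_assoc mult.commute)
  qed (use R(3) v in simp)
  obtain j where j: "j < n" "v $ j \<noteq> 0"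
    using v by (metis carrier_vecD eq_vecI index_zero_vec(1) index_zero_vec(2))
  have per: "rot m (k mod int m) = rot m k" for k
    using m by (simp add: rot_eq)
  have "rot m (int m) = rot m 0" using per[of "int m"] by simp
  then have "e ^ m \<cdot>\<^sub>v v = v" using pow[of m] R(3) v by simp
  then have "(e ^ m \<cdot>\<^sub>v v) $ j = v $ j" by simp
  then have "e ^ m = 1" using j v by simp
  then obtain i where i: "i < m" "e = unity_root m (int i)"
    using bij_betw_roots_unity[OF m] by (auto simp: bij_betw_def unity_root_def)
  have rv: "\<rho> (rot m k) *\<^sub>v v = unity_root m (int i * k) \<cdot>\<^sub>v v" for k
  proof -
    have "\<rho> (rot m k) = \<rho> (rot m (int (nat (k mod int m))))" using m per by simp
    then have "\<rho> (rot m k) *\<^sub>v v = e ^ nat (k mod int m) \<cdot>\<^sub>v v" by (simp only: pow)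
    also have "e ^ nat (k mod int m) = unity_root m ((k mod int m) * int i)"
      using m by (simp add: i unity_root_power)
    also have "\<dots> = unity_root m (int i * k)"
      using m by (simp add: unity_root_eq_iff mod_eq_dvd_iff[symmetric] mod_mult_left_eq mult.commute[of k])
    finally show ?thesis .
  qed
  define w where "w = \<rho> (rfl m 0) *\<^sub>v v"
  have w: "w \<in> carrier_vec n" unfolding w_def by (rule mult_mat_vec_carrier[OF c(2) v(1)])
  have rw: "\<rho> (rot m k) *\<^sub>v w = unity_root m (- (int i * k)) \<cdot>\<^sub>v w" for k
  proof -
    have "\<rho> (rot m k) * \<rho> (rfl m 0) = \<rho> (rfl m 0) * \<rho> (rot m (- k))"
      using R(2)[of "rot m k" "rfl m 0"] R(2)[of "rfl m 0" "rot m (- k)"] m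
      by (simp add: dihedral_mult)
    then have "\<rho> (rot m k) *\<^sub>v w = \<rho> (rfl m 0) *\<^sub>v (\<rho> (rot m (- k)) *\<^sub>v v)"
      unfolding w_def using v c by (metis assoc_mult_mat_vec)
    then show ?thesis unfolding w_def by (simp add: rv mult_mat_vec[OF c(2) v(1)])
  qed
  have "\<rho> (rfl m k) *\<^sub>v v = unity_root m (- (int i * k)) \<cdot>\<^sub>v w" for k
  proof -
    have "\<rho> (rfl m k) = \<rho> (rot m k) * \<rho> (rfl m 0)"
      using R(2)[of "rot m k" "rfl m 0"] m by (simp add: dihedral_mult)
    then have "\<rho> (rfl m k) *\<^sub>v v = \<rho> (rot m k) *\<^sub>v w"
      unfolding w_def using v c by (metis assoc_mult_mat_vec)
    then show ?thesis by (simp add: rw)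
  qed
  moreover have "\<rho> (rfl m k) *\<^sub>v w = unity_root m (int i * k) \<cdot>\<^sub>v v" for k
  proof -
    have "\<rho> (rot m k) = \<rho> (rfl m k) * \<rho> (rfl m 0)"
      using R(2)[of "rfl m k" "rfl m 0"] m by (simp add: dihedral_mult)
    then have "\<rho> (rfl m k) *\<^sub>v w = \<rho> (rot m k) *\<^sub>v v"
      unfolding w_def using v c by (metis assoc_mult_mat_vec)
    then show ?thesis by (simp add: rv)
  qed
  ultimately show ?thesis using that i v w rv rw by blast
qed

text \<open>The span of v and w is invariant, hence everything, so n <= 2. For n = 1 the vector w is
  a multiple of v, which forces the rotation eigenvalue to equal its inverse; for n = 2 this
  equality is excluded, since v + w would span an invariant line.\<close>

lemma irreducible_representation_cases:
  assumes irr: "irreducible_representation (I2 m) n \<rho>" and m: "m > 0"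
  obtains (linear) i \<beta> where "n = 1" "i < m" "m dvd 2 * i" "\<beta> = 1 \<or> \<beta> = -1"
      "character (I2 m) \<rho> = linear_char m i \<beta>"
  | (planar) i where "n = 2" "i < m" "\<not> m dvd 2 * i" "eigenvalue (\<rho> (rot m 1)) (unity_root m (int i))"
      "character (I2 m) \<rho> = planar_char m i"
proof -
  have rep: "representation (I2 m) n \<rho>" and n: "n > 0" using irr by (auto simp: irreducible_representation_def)
  note R = representationD[OF rep m]
  have full: "U = carrier_vec n" if U: "U \<subseteq> carrier_vec n" "u \<in> U" "u \<noteq> 0\<^sub>v n"
      and add: "\<And>u v. u \<in> U \<Longrightarrow> v \<in> U \<Longrightarrow> u + v \<in> U"
      and smult: "\<And>c u. u \<in> U \<Longrightarrow> c \<cdot>\<^sub>v u \<in> U"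
      and rotU: "\<And>k u. u \<in> U \<Longrightarrow> \<rho> (rot m k) *\<^sub>v u \<in> U"
      and rflU: "\<And>k u. u \<in> U \<Longrightarrow> \<rho> (rfl m k) *\<^sub>v u \<in> U" for U u
  proof -
    have u: "u \<in> carrier_vec n" using U by auto
    have "0 \<cdot>\<^sub>v u = 0\<^sub>v n" using u by (intro eq_vecI) auto
    then have "0\<^sub>v n \<in> U" using smult[OF U(2), of 0] by simp
    moreover have "\<rho> g *\<^sub>v x \<in> U" if g: "g \<in> carrier (I2 m)" and x: "x \<in> U" for g x
      using g m
    proof (induction g rule: I2_induct)
      case (rot k)
      show ?case by (rule rotU[OF x])
    next
      case (rfl k)
      show ?case by (rule rflU[OF x])
    qed
    moreover have "subspace class_ring U (module_vec TYPE(complex) n)"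
      unfolding subspace_vec_iff by (intro conjI ballI allI U(1) add smult calculation(1))
    moreover have "\<forall>U. subspace class_ring U (module_vec TYPE(complex) n) \<and>
        (\<forall>g\<in>carrier (I2 m). \<forall>v\<in>U. \<rho> g *\<^sub>v v \<in> U) \<longrightarrow> U = {0\<^sub>v n} \<or> U = carrier_vec n"
      using irr unfolding irreducible_representation_def by (elim conjE)
    ultimately have "U = {0\<^sub>v n} \<or> U = carrier_vec n" by (metis (no_types, lifting))
    then show ?thesis using U(2,3) by blast
  qed
  obtain i v w where i: "i < m" and v: "v \<in> carrier_vec n" "v \<noteq> 0\<^sub>v n" and w: "w \<in> carrier_vec n"
    and act: "\<And>k. \<rho> (rot m k) *\<^sub>v v = unity_root m (int i * k) \<cdot>\<^sub>v v"
      "\<And>k. \<rho> (rot m k) *\<^sub>v w = unity_root m (- (int i * k)) \<cdot>\<^sub>v w"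
      "\<And>k. \<rho> (rfl m k) *\<^sub>v v = unity_root m (- (int i * k)) \<cdot>\<^sub>v w"
      "\<And>k. \<rho> (rfl m k) *\<^sub>v w = unity_root m (int i * k) \<cdot>\<^sub>v v"
    using rotation_eigenvector[OF rep n m] by metis
  have c: "\<rho> (rot m k) \<in> carrier_mat n n" "\<rho> (rfl m k) \<in> carrier_mat n n" for k
    using R(1) m by auto
  have lin: "A *\<^sub>v (a \<cdot>\<^sub>v v + b \<cdot>\<^sub>v w) = a \<cdot>\<^sub>v (A *\<^sub>v v) + b \<cdot>\<^sub>v (A *\<^sub>v w)" if "A \<in> carrier_mat n n" for A a b
    using that v w by (simp add: mult_add_distrib_mat_vec mult_mat_vec)
  have span: "\<exists>a b. u = a \<cdot>\<^sub>v v + b \<cdot>\<^sub>v w" if "u \<in> carrier_vec n" for u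
  proof -
    let ?U = "{a \<cdot>\<^sub>v v + b \<cdot>\<^sub>v w | a b. True}"
    have "?U = carrier_vec n"
    proof (rule full[of _ v])
      show "?U \<subseteq> carrier_vec n" "v \<noteq> 0\<^sub>v n" using v w by auto
      have "v = 1 \<cdot>\<^sub>v v + 0 \<cdot>\<^sub>v w" using v w by auto
      then show "v \<in> ?U" by blast
      show "x + y \<in> ?U" if xy: "x \<in> ?U" "y \<in> ?U" for x y
      proof -
        obtain a b a' b' where "x = a \<cdot>\<^sub>v v + b \<cdot>\<^sub>v w" "y = a' \<cdot>\<^sub>v v + b' \<cdot>\<^sub>v w" using xy by blast
        then have "x + y = (a + a') \<cdot>\<^sub>v v + (b + b') \<cdot>\<^sub>v w"
          using v w by (intro eq_vecI) (auto simp: algebra_simps)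
        then show ?thesis by blast
      qed
      have lc: "x \<cdot>\<^sub>v (a \<cdot>\<^sub>v v) + y \<cdot>\<^sub>v (b \<cdot>\<^sub>v w) \<in> ?U" "x \<cdot>\<^sub>v (a \<cdot>\<^sub>v w) + y \<cdot>\<^sub>v (b \<cdot>\<^sub>v v) \<in> ?U" for x y a b
      proof -
        have "x \<cdot>\<^sub>v (a \<cdot>\<^sub>v v) + y \<cdot>\<^sub>v (b \<cdot>\<^sub>v w) = (x * a) \<cdot>\<^sub>v v + (y * b) \<cdot>\<^sub>v w"
          "x \<cdot>\<^sub>v (a \<cdot>\<^sub>v w) + y \<cdot>\<^sub>v (b \<cdot>\<^sub>v v) = (y * b) \<cdot>\<^sub>v v + (x * a) \<cdot>\<^sub>v w"
          using v w by (auto simp: smult_smult_assoc intro: comm_add_vec)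
        then show "x \<cdot>\<^sub>v (a \<cdot>\<^sub>v v) + y \<cdot>\<^sub>v (b \<cdot>\<^sub>v w) \<in> ?U" "x \<cdot>\<^sub>v (a \<cdot>\<^sub>v w) + y \<cdot>\<^sub>v (b \<cdot>\<^sub>v v) \<in> ?U" by blast+
      qed
      show "x \<cdot>\<^sub>v u \<in> ?U" if u: "u \<in> ?U" for x u
      proof -
        obtain a b where ab: "u = a \<cdot>\<^sub>v v + b \<cdot>\<^sub>v w" using u by blast
        from ab have "x \<cdot>\<^sub>v u = x \<cdot>\<^sub>v (a \<cdot>\<^sub>v v) + x \<cdot>\<^sub>v (b \<cdot>\<^sub>v w)"
          using v w by (simp add: smult_add_distrib_vec)
        then show ?thesis using lc by metis
      qed
      show "\<rho> (rot m k) *\<^sub>v u \<in> ?U" "\<rho> (rfl m k) *\<^sub>v u \<in> ?U" if u: "u \<in> ?U" for k u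
      proof -
        obtain a b where ab: "u = a \<cdot>\<^sub>v v + b \<cdot>\<^sub>v w" using u by blast
        show "\<rho> (rot m k) *\<^sub>v u \<in> ?U" "\<rho> (rfl m k) *\<^sub>v u \<in> ?U"
          unfolding ab lin[OF c(1)] lin[OF c(2)] act
          using lc(1)[of a _ b] lc(2)[of a _ b] by (simp_all add: mult.commute)
      qed
    qed
    then show ?thesis using that by blast
  qed
  \<comment> \<open>Unit vectors written through v and w give scalar equations; the independence of
    v and w for n = 2 and the contradiction for n >= 3 are read off from them by 2 by 2
    determinants.\<close>
  have unit: "\<exists>a b. \<forall>l<n. a * v $ l + b * w $ l = (if l = j then 1 else 0)" if "j < n" for j
  proof -
    obtain a b where ab: "unit_vec n j = a \<cdot>\<^sub>v v + b \<cdot>\<^sub>v w" using span[of "unit_vec n j"] by auto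
    have "a * v $ l + b * w $ l = (if l = j then 1 else 0)" if "l < n" for l
      using arg_cong[OF ab, of "\<lambda>x. x $ l"] that v w \<open>j < n\<close> by (auto simp: unit_vec_def)
    then show ?thesis by blast
  qed
  have ch: "character (I2 m) \<rho> (rot m k) = (\<Sum>j<n. \<rho> (rot m k) $$ (j, j))"
    "character (I2 m) \<rho> (rfl m k) = (\<Sum>j<n. \<rho> (rfl m k) $$ (j, j))" for k
    using m c[of k] by (auto simp: character_def)
  consider "n = 1" | "n = 2" | "n \<ge> 3" using n by linarith
  then show ?thesis
  proof cases
    case 1
    define \<beta> where "\<beta> = \<rho> (rfl m 0) $$ (0, 0)"
    obtain v0: "v $ 0 \<noteq> 0" using v 1 by (metis carrier_vecD eq_vecI index_zero_vec less_one)
    have idx: "(A *\<^sub>v x) $ 0 = A $$ (0, 0) * x $ 0" if "A \<in> carrier_mat n n" "x \<in> carrier_vec n" for A x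
      using that 1 by (auto simp: scalar_prod_def row_def)
    have rot0: "\<rho> (rot m k) $$ (0, 0) = unity_root m (int i * k)" for k
      using idx[OF c(1)[of k] v(1)] act(1)[of k] v0 v 1 by simp
    have w0: "w $ 0 = \<beta> * v $ 0"
      using idx[OF c(2)[of 0] v(1)] act(3)[of 0] w 1 by (simp add: \<beta>_def)
    have "v $ 0 = \<beta> * w $ 0"
      using idx[OF c(2)[of 0] w] act(4)[of 0] v 1 by (simp add: \<beta>_def)
    then have "\<beta>\<^sup>2 = 1" using w0 v0 by (simp add: power2_eq_square)
    then have \<beta>: "\<beta> = 1 \<or> \<beta> = -1" by (simp add: power2_eq_1_iff)
    have "unity_root m (int i) * w $ 0 = unity_root m (- int i) * w $ 0"
      using idx[OF c(1)[of 1] w] act(2)[of 1] w 1 by (auto simp: rot0)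
    then have "unity_root m (int i) = unity_root m (- int i)" using w0 v0 \<beta> by auto
    then have "int m dvd 2 * int i" using m by (simp add: unity_root_eq_iff)
    then have d: "m dvd 2 * i" by presburger
    have "\<rho> (rfl m k) $$ (0, 0) = \<beta> * unity_root m (- (int i * k))" for k
      using idx[OF c(2)[of k] v(1)] act(3)[of k] w0 v0 v w 1 by simp (metis mult.commute)
    moreover have "unity_root m (- (int i * k)) = unity_root m (int i * k)" for k
    proof -
      have "int m dvd (2 * int i) * k" using \<open>int m dvd 2 * int i\<close> by (rule dvd_mult2)
      then show ?thesis using m by (simp add: unity_root_eq_iff[of m "int i * k", symmetric] unity_root_eq_iff algebra_simps)
    qed
    ultimately have "character (I2 m) \<rho> = linear_char m i \<beta>"
      using m 1 rot0 ch by (intro class_fun_eqI[of m]) auto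
    then show ?thesis using linear 1 i d \<beta> by blast
  next
    case 2
    define D where "D = v $ 0 * w $ 1 - v $ 1 * w $ 0"
    obtain a b where "\<forall>l<n. a * v $ l + b * w $ l = (if l = 0 then 1 else 0)"
      using unit[of 0] 2 by auto
    then have "a * v $ 0 + b * w $ 0 = 1" "a * v $ 1 + b * w $ 1 = 0" using 2 by auto
    moreover obtain a' b' where "\<forall>l<n. a' * v $ l + b' * w $ l = (if l = 1 then 1 else 0)"
      using unit[of 1] 2 by auto
    then have "a' * v $ 0 + b' * w $ 0 = 0" "a' * v $ 1 + b' * w $ 1 = 1" using 2 by auto
    moreover have "(a * b' - b * a') * D = (a * v $ 0 + b * w $ 0) * (a' * v $ 1 + b' * w $ 1)
        - (a * v $ 1 + b * w $ 1) * (a' * v $ 0 + b' * w $ 0)"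
      unfolding D_def by (simp only: algebra_simps)
    ultimately have "(a * b' - b * a') * D = 1" by simp
    then have D: "D \<noteq> 0" by auto
    have tr: "(A $$ (0,0) + A $$ (1,1)) * D = 
        (A *\<^sub>v v) $ 0 * w $ 1 - (A *\<^sub>v v) $ 1 * w $ 0 + (v $ 0 * (A *\<^sub>v w) $ 1 - v $ 1 * (A *\<^sub>v w) $ 0)"
      if "A \<in> carrier_mat n n" for A
      using trace_mat2[of A v w] that v w 2 unfolding D_def by simp
    have "(\<rho> (rot m k) $$ (0,0) + \<rho> (rot m k) $$ (1,1)) * D = (unity_root m (int i * k) + unity_root m (- (int i * k))) * D" for k
      using tr[OF c(1)[of k]] v w 2 by (simp add: act D_def algebra_simps)
    moreover have "(\<rho> (rfl m k) $$ (0,0) + \<rho> (rfl m k) $$ (1,1)) * D = 0" for k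
      using tr[OF c(2)[of k]] v w 2 by (simp add: act D_def algebra_simps)
    ultimately have char: "character (I2 m) \<rho> = planar_char m i"
      using m 2 ch D by (intro class_fun_eqI[of m]) (auto simp: numeral_2_eq_2)
    have "\<not> m dvd 2 * i"
    proof
      assume "m dvd 2 * i"
      then have "int m dvd 2 * int i" by presburger
      then have "int m dvd (2 * int i) * k" for k by (rule dvd_mult2)
      then have eq: "unity_root m (- (int i * k)) = unity_root m (int i * k)" for k
        using m by (metis (no_types, opaque_lifting) unity_root_eq_iff mult_2 distrib_right diff_minus_eq_add)
      let ?u = "v + w"
      have lin': "A *\<^sub>v (a \<cdot>\<^sub>v ?u) = a \<cdot>\<^sub>v (A *\<^sub>v v + A *\<^sub>v w)" if "A \<in> carrier_mat n n" for A a
        using that v w by (simp add: mult_add_distrib_mat_vec mult_mat_vec)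
      have "{a \<cdot>\<^sub>v ?u | a. True} = carrier_vec n"
      proof (rule full[of _ ?u])
        show "{a \<cdot>\<^sub>v ?u | a. True} \<subseteq> carrier_vec n" using v w by auto
        have "?u = 1 \<cdot>\<^sub>v ?u" by simp
        then show "?u \<in> {a \<cdot>\<^sub>v ?u | a. True}" by blast
        show "?u \<noteq> 0\<^sub>v n"
        proof
          assume "?u = 0\<^sub>v n"
          then have "?u $ 0 = 0" "?u $ 1 = 0" using 2 by auto
          then have "v $ 0 + w $ 0 = 0" "v $ 1 + w $ 1 = 0" using 2 v w by auto
          then have "w $ 0 = - v $ 0" "w $ 1 = - v $ 1" by (simp_all add: eq_neg_iff_add_eq_0 add.commute)
          then show False using D unfolding D_def by simp
        qed
        show "x + y \<in> {a \<cdot>\<^sub>v ?u | a. True}" if xy: "x \<in> {a \<cdot>\<^sub>v ?u | a. True}" "y \<in> {a \<cdot>\<^sub>v ?u | a. True}" for x y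
        proof -
          obtain a b where "x = a \<cdot>\<^sub>v ?u" "y = b \<cdot>\<^sub>v ?u" using xy by blast
          then have "x + y = (a + b) \<cdot>\<^sub>v ?u" by (simp add: add_smult_distrib_vec)
          then show ?thesis by blast
        qed
        show "x \<cdot>\<^sub>v y \<in> {a \<cdot>\<^sub>v ?u | a. True}" if y: "y \<in> {a \<cdot>\<^sub>v ?u | a. True}" for x y
        proof -
          obtain b where "y = b \<cdot>\<^sub>v ?u" using y by blast
          then have "x \<cdot>\<^sub>v y = (x * b) \<cdot>\<^sub>v ?u" by (simp add: smult_smult_assoc)
          then show ?thesis by blast
        qed
        show "\<rho> (rot m k) *\<^sub>v y \<in> {a \<cdot>\<^sub>v ?u | a. True}" "\<rho> (rfl m k) *\<^sub>v y \<in> {a \<cdot>\<^sub>v ?u | a. True}"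
          if y: "y \<in> {a \<cdot>\<^sub>v ?u | a. True}" for k y
        proof -
          obtain b where b: "y = b \<cdot>\<^sub>v ?u" using y by blast
          have "\<rho> (rot m k) *\<^sub>v y = (b * unity_root m (int i * k)) \<cdot>\<^sub>v ?u" "\<rho> (rfl m k) *\<^sub>v y = (b * unity_root m (int i * k)) \<cdot>\<^sub>v ?u"
            using v w c(1)[of k] c(2)[of k] comm_add_vec[OF w v(1)]
            unfolding b lin'[OF c(1)] lin'[OF c(2)] act eq
            by (simp_all add: smult_smult_assoc smult_add_distrib_vec[symmetric])
          then show "\<rho> (rot m k) *\<^sub>v y \<in> {a \<cdot>\<^sub>v ?u | a. True}" "\<rho> (rfl m k) *\<^sub>v y \<in> {a \<cdot>\<^sub>v ?u | a. True}"
            by blast+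
        qed
      qed
      then obtain a where "v = a \<cdot>\<^sub>v ?u" using v by blast
      then have "v $ 0 = (a \<cdot>\<^sub>v ?u) $ 0" "v $ 1 = (a \<cdot>\<^sub>v ?u) $ 1" by metis+
      then have "v $ 0 = a * (v $ 0 + w $ 0)" "v $ 1 = a * (v $ 1 + w $ 1)"
        using v w 2 by auto
      moreover obtain a' where "w = a' \<cdot>\<^sub>v ?u" using w \<open>_ = carrier_vec n\<close> by blast
      then have "w $ 0 = (a' \<cdot>\<^sub>v ?u) $ 0" "w $ 1 = (a' \<cdot>\<^sub>v ?u) $ 1" by metis+
      then have "w $ 0 = a' * (v $ 0 + w $ 0)" "w $ 1 = a' * (v $ 1 + w $ 1)"
        using v w 2 by auto
      moreover have "D = 0" if "v $ 0 = a * s" "v $ 1 = a * t" "w $ 0 = a' * s" "w $ 1 = a' * t" for s t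
        unfolding D_def that by simp
      ultimately have "D = 0" by blast
      then show False using D by simp
    qed
    moreover have "eigenvalue (\<rho> (rot m 1)) (unity_root m (int i))"
      using act(1)[of 1] v c(1)[of 1] unfolding eigenvalue_def eigenvector_def by auto
    ultimately show ?thesis using planar 2 i char by blast
  next
    case 3
    \<comment> \<open>The coefficient determinant for the unit vectors 0 and 1 is nonzero, which
      forces the third coordinates of v and w to vanish; then no combination reaches the unit vector
      2.\<close>
    obtain a0 b0 where "\<forall>l<n. a0 * v $ l + b0 * w $ l = (if l = 0 then 1 else 0)"
      using unit[of 0] 3 by auto
    then have e0: "a0 * v $ 0 + b0 * w $ 0 = 1" "a0 * v $ 1 + b0 * w $ 1 = 0" "a0 * v $ 2 + b0 * w $ 2 = 0"
      using 3 by auto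
    obtain a1 b1 where "\<forall>l<n. a1 * v $ l + b1 * w $ l = (if l = 1 then 1 else 0)"
      using unit[of 1] 3 by auto
    then have e1: "a1 * v $ 0 + b1 * w $ 0 = 0" "a1 * v $ 1 + b1 * w $ 1 = 1" "a1 * v $ 2 + b1 * w $ 2 = 0"
      using 3 by auto
    obtain a2 b2 where "\<forall>l<n. a2 * v $ l + b2 * w $ l = (if l = 2 then 1 else 0)"
      using unit[of 2] 3 by auto
    then have e2: "a2 * v $ 0 + b2 * w $ 0 = 0" "a2 * v $ 1 + b2 * w $ 1 = 0" "a2 * v $ 2 + b2 * w $ 2 = 1"
      using 3 by auto
    have "(a0 * b1 - b0 * a1) * (v $ 0 * w $ 1 - v $ 1 * w $ 0) =
        (a0 * v $ 0 + b0 * w $ 0) * (a1 * v $ 1 + b1 * w $ 1) - (a0 * v $ 1 + b0 * w $ 1) * (a1 * v $ 0 + b1 * w $ 0)"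
      by (simp only: algebra_simps)
    then have "a0 * b1 - b0 * a1 \<noteq> 0" using e0 e1 by auto
    moreover have "(a0 * b1 - b0 * a1) * v $ 2 = b1 * (a0 * v $ 2 + b0 * w $ 2) - b0 * (a1 * v $ 2 + b1 * w $ 2)"
      "(a0 * b1 - b0 * a1) * w $ 2 = a0 * (a1 * v $ 2 + b1 * w $ 2) - a1 * (a0 * v $ 2 + b0 * w $ 2)"
      by (simp_all only: algebra_simps)
    ultimately have "v $ 2 = 0" "w $ 2 = 0" using e0(3) e1(3) by auto
    then show ?thesis using e2 by simp
  qed
qed

section \<open>Models of the irreducible representations and the list of characters\<close>

definition planar_rep :: "nat \<Rightarrow> complex mat \<Rightarrow> complex mat" where
  "planar_rep i w = (let z = phase w ^ i in
     if det w = 1 then mat2 z 0 0 (inverse z) else mat2 0 z (inverse z) 0)"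

lemma planar_rep_simps:
  "planar_rep i (rot m k) = mat2 (unity_root m (int i * k)) 0 0 (unity_root m (- (int i * k)))"
  "planar_rep i (rfl m k) = mat2 0 (unity_root m (int i * k)) (unity_root m (- (int i * k))) 0"
  by (simp_all add: planar_rep_def Let_def unity_root_power unity_root_minus)

lemma mat2_mult_vec:
  fixes u :: "complex vec"
  assumes "u \<in> carrier_vec 2"
  shows "mat2 a b c d *\<^sub>v u = vec 2 (\<lambda>j. if j = 0 then a * u $ 0 + b * u $ 1 else c * u $ 0 + d * u $ 1)"
  using assms by (intro eq_vecI) (auto simp: scalar_prod_def row_def numeral_2_eq_2 less_Suc_eq)

text \<open>The model is written in an eigenbasis of the rotations. The two eigenvalues of
  \<open>rot m 1\<close> differ, so \<open>rot m 1\<close> minus one of them is a multiple of the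
  projection to a coordinate axis, and a reflection swaps the axes; a nonzero invariant subspace
  therefore contains both.\<close>

lemma planar_rep:
  assumes m: "m > 0" and i: "\<not> m dvd 2 * i"
  shows "irreducible_representation (I2 m) 2 (planar_rep i)"
    and "character (I2 m) (planar_rep i) = planar_char m i"
    and "{z. eigenvalue (planar_rep i (rot m 1)) z} = {unity_root m (int i), unity_root m (- int i)}"
proof -
  have rep: "representation (I2 m) 2 (planar_rep i)"
  proof (rule representationI[OF m])
    fix w assume "w \<in> carrier (I2 m)"
    then show "planar_rep i w \<in> carrier_mat 2 2" by (simp add: planar_rep_def Let_def)
  next
    fix v w assume v: "v \<in> carrier (I2 m)" and w: "w \<in> carrier (I2 m)"
    have r: "planar_rep i (rot m j * rot m k) = planar_rep i (rot m j) * planar_rep i (rot m k)"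
      "planar_rep i (rot m j * rfl m k) = planar_rep i (rot m j) * planar_rep i (rfl m k)"
      "planar_rep i (rfl m j * rot m k) = planar_rep i (rfl m j) * planar_rep i (rot m k)"
      "planar_rep i (rfl m j * rfl m k) = planar_rep i (rfl m j) * planar_rep i (rfl m k)" for j k
      by (simp_all add: dihedral_mult planar_rep_simps mat2_mult distrib_left right_diff_distrib
          unity_root_add unity_root_diff unity_root_minus field_simps)
    show "planar_rep i (v * w) = planar_rep i v * planar_rep i w"
      using v m
    proof (induction v rule: I2_induct)
      case (rot j)
      show ?case using w m by (induction w rule: I2_induct) (rule r)+
    next
      case (rfl j)
      show ?case using w m by (induction w rule: I2_induct) (rule r)+
    qed
  next
    show "planar_rep i (rot m 0) = 1\<^sub>m 2" by (simp add: planar_rep_simps one_mat2)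
  qed
  let ?z = "unity_root m (int i)"
  have "\<not> int m dvd 2 * int i" using i by presburger
  then have ne: "?z \<noteq> unity_root m (- int i)" using m by (simp add: unity_root_eq_iff)
  have "U = {0\<^sub>v 2} \<or> U = carrier_vec 2"
    if sub: "subspace class_ring U (module_vec TYPE(complex) 2)"
      and inv: "\<forall>g\<in>carrier (I2 m). \<forall>v\<in>U. planar_rep i g *\<^sub>v v \<in> U" for U
  proof (cases "U \<subseteq> {0\<^sub>v 2}")
    case True
    then show ?thesis using sub by (auto simp: subspace_vec_iff)
  next
    case False
    have U: "U \<subseteq> carrier_vec 2" "\<And>u v. u \<in> U \<Longrightarrow> v \<in> U \<Longrightarrow> u + v \<in> U" "\<And>c u. u \<in> U \<Longrightarrow> c \<cdot>\<^sub>v u \<in> U"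
      using sub by (auto simp: subspace_vec_iff)
    let ?V = "\<lambda>a b. vec 2 (\<lambda>j. if j = 0 then a else b) :: complex vec"
    have V: "u = ?V (u $ 0) (u $ 1)" if "u \<in> carrier_vec 2" for u
      using that by (intro eq_vecI) (auto simp: less_2_cases_iff)
    have swap: "?V b a \<in> U" if "?V a b \<in> U" for a b
    proof -
      have "planar_rep i (rfl m 0) *\<^sub>v ?V a b \<in> U" using that inv m by simp
      then show ?thesis by (simp add: planar_rep_simps mat2_mult_vec cong: if_cong)
    qed
    have proj: "?V a 0 \<in> U" if "?V a b \<in> U" for a b
    proof -
      have "planar_rep i (rot m 1) *\<^sub>v ?V a b + (- unity_root m (- int i)) \<cdot>\<^sub>v ?V a b \<in> U"
        using that inv m U by simp
      moreover have "planar_rep i (rot m 1) *\<^sub>v ?V a b + (- unity_root m (- int i)) \<cdot>\<^sub>v ?V a b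
          = ?V ((?z - unity_root m (- int i)) * a) 0"
        by (intro eq_vecI) (auto simp: planar_rep_simps mat2_mult_vec algebra_simps)
      ultimately have "inverse (?z - unity_root m (- int i)) \<cdot>\<^sub>v ?V ((?z - unity_root m (- int i)) * a) 0 \<in> U"
        using U(3) by simp
      moreover have "inverse (?z - unity_root m (- int i)) \<cdot>\<^sub>v ?V ((?z - unity_root m (- int i)) * a) 0 = ?V a 0"
        using ne by (intro eq_vecI) auto
      ultimately show ?thesis by simp
    qed
    obtain u where u: "u \<in> U" "u \<noteq> 0\<^sub>v 2" using False by blast
    have "?V (u $ 0) (u $ 1) \<in> U" using V[OF subsetD[OF U(1) u(1)]] u(1) by simp
    then have "?V (u $ 0) 0 \<in> U" "?V (u $ 1) 0 \<in> U" using proj[of "u $ 0" "u $ 1"] proj[OF swap] by simp_all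
    moreover have "u $ 0 \<noteq> 0 \<or> u $ 1 \<noteq> 0"
    proof (rule ccontr)
      assume "\<not> ?thesis"
      then have "u = 0\<^sub>v 2" using subsetD[OF U(1) u(1)]
        by (intro eq_vecI) (auto simp: less_2_cases_iff)
      then show False using u by simp
    qed
    ultimately obtain c where c: "c \<noteq> 0" "?V c 0 \<in> U" by blast
    have one: "?V a 0 \<in> U" for a
    proof -
      have "(a / c) \<cdot>\<^sub>v ?V c 0 = ?V a 0" using c by (intro eq_vecI) auto
      then show ?thesis using U(3)[OF c(2)] by metis
    qed
    have "x \<in> U" if "x \<in> carrier_vec 2" for x
    proof -
      have "?V (x $ 0) 0 + ?V 0 (x $ 1) \<in> U" using one swap U(2) by blast
      moreover have "?V (x $ 0) 0 + ?V 0 (x $ 1) = x"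
        using that by (intro eq_vecI) (auto simp: less_2_cases_iff)
      ultimately show ?thesis by simp
    qed
    then show ?thesis using U(1) by blast
  qed
  then show "irreducible_representation (I2 m) 2 (planar_rep i)"
    using rep unfolding irreducible_representation_def by simp
  show "character (I2 m) (planar_rep i) = planar_char m i"
    using m by (intro class_fun_eqI[of m]) (auto simp: character_def planar_rep_simps numeral_2_eq_2)
  have "eigenvalue (planar_rep i (rot m 1)) z \<longleftrightarrow> (z - ?z) * (z - unity_root m (- int i)) = 0" for z
  proof -
    have "poly (char_poly (planar_rep i (rot m 1))) z = (z - ?z) * (z - unity_root m (- int i))"
      unfolding planar_rep_simps char_poly_mat2 by (simp add: algebra_simps)
    then show ?thesis using eigenvalue_root_char_poly[of "planar_rep i (rot m 1)" 2 z]
      by (simp add: planar_rep_simps)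
  qed
  then show "{z. eigenvalue (planar_rep i (rot m 1)) z} = {?z, unity_root m (- int i)}"
    by auto
qed

text \<open>The hypothesis \<open>m dvd 2 * i\<close> makes \<open>unity_root m (i * k)\<close>
  equal to its inverse, which multiplicativity requires because a reflection reverses the sign of
  k.\<close>

lemma linear_rep:
  assumes m: "m > 0" and i: "m dvd 2 * i" and \<beta>: "\<beta> = 1 \<or> \<beta> = -1"
  shows "\<exists>\<rho>. irreducible_representation (I2 m) 1 \<rho> \<and> character (I2 m) \<rho> = linear_char m i \<beta>"
proof -
  let ?\<rho> = "\<lambda>w. mat 1 1 (\<lambda>_. linear_char m i \<beta> w)"
  have "int m dvd 2 * int i" using i by presburger
  then have "int m dvd (2 * int i) * k" for k by (rule dvd_mult2)
  then have "int m dvd int i * k - (- (int i * k))" for k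
    by (metis (no_types) diff_minus_eq_add distrib_right mult_2)
  then have neg: "unity_root m (- (int i * k)) = unity_root m (int i * k)" for k
    using m by (metis unity_root_eq_iff)
  have sub: "unity_root m (int i * (j - k)) = unity_root m (int i * j) * unity_root m (int i * k)" for j k
  proof -
    have "int i * (j - k) = int i * j + - (int i * k)" by (simp add: right_diff_distrib)
    then show ?thesis by (simp only: unity_root_add neg)
  qed
  have rep: "representation (I2 m) 1 ?\<rho>"
  proof (rule representationI[OF m])
    fix v w assume v: "v \<in> carrier (I2 m)" and w: "w \<in> carrier (I2 m)"
    have r: "linear_char m i \<beta> (rot m j * rot m k) = linear_char m i \<beta> (rot m j) * linear_char m i \<beta> (rot m k)"
      "linear_char m i \<beta> (rot m j * rfl m k) = linear_char m i \<beta> (rot m j) * linear_char m i \<beta> (rfl m k)"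
      "linear_char m i \<beta> (rfl m j * rot m k) = linear_char m i \<beta> (rfl m j) * linear_char m i \<beta> (rot m k)"
      "linear_char m i \<beta> (rfl m j * rfl m k) = linear_char m i \<beta> (rfl m j) * linear_char m i \<beta> (rfl m k)" for j k
      using m \<beta> by (auto simp: dihedral_mult distrib_left unity_root_add sub)
    have "linear_char m i \<beta> (v * w) = linear_char m i \<beta> v * linear_char m i \<beta> w"
      using v m
    proof (induction v rule: I2_induct)
      case (rot j)
      show ?case using w m by (induction w rule: I2_induct) (rule r)+
    next
      case (rfl j)
      show ?case using w m by (induction w rule: I2_induct) (rule r)+
    qed
    then show "?\<rho> (v * w) = ?\<rho> v * ?\<rho> w"
      by (intro eq_matI) (auto simp: scalar_prod_def)
  next
    show "?\<rho> (rot m 0) = 1\<^sub>m 1" using m by (intro eq_matI) auto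
  qed simp
  have "U = {0\<^sub>v 1} \<or> U = carrier_vec 1"
    if sub: "subspace class_ring U (module_vec TYPE(complex) 1)" for U
  proof (cases "U \<subseteq> {0\<^sub>v 1}")
    case True
    then show ?thesis using sub by (auto simp: subspace_vec_iff)
  next
    case False
    then obtain u where u: "u \<in> U" "u \<noteq> 0\<^sub>v 1" by blast
    then have "dim_vec u = 1" using sub by (auto simp: subspace_vec_iff)
    then have u0: "u $ 0 \<noteq> 0" using u by (metis eq_vecI index_zero_vec less_one)
    have "x \<in> U" if "x \<in> carrier_vec 1" for x
    proof -
      have "x = (x $ 0 / u $ 0) \<cdot>\<^sub>v u" using that u0 \<open>dim_vec u = 1\<close> by (intro eq_vecI) auto
      then show ?thesis using sub u unfolding subspace_vec_iff by metis
    qed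
    then show ?thesis using sub by (auto simp: subspace_vec_iff)
  qed
  then have "irreducible_representation (I2 m) 1 ?\<rho>"
    using rep unfolding irreducible_representation_def by simp
  moreover have "character (I2 m) ?\<rho> = linear_char m i \<beta>"
    by (intro class_fun_eqI[of m]) (auto simp: character_def m)
  ultimately show ?thesis by blast
qed

lemma planar_char_reflect:
  assumes "m > 0" "i \<le> m"
  shows "planar_char m (m - i) = planar_char m i"
proof (rule class_fun_eqI[of m])
  fix k
  have "unity_root m (int (m - i) * k) = unity_root m (- (int i * k))"
    "unity_root m (- (int (m - i) * k)) = unity_root m (int i * k)"
    using assms by (simp_all add: unity_root_eq_iff of_nat_diff algebra_simps)
  then show "planar_char m (m - i) (rot m k) = planar_char m i (rot m k)"
    using assms by simp
qed (use assms in auto)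

text \<open>A planar index above m / 2 folds back to m - i, because a planar character sees a root
  of unity only together with its inverse.\<close>

lemma Irr_I2:
  assumes m: "m > 0"
  shows "Irr (I2 m) = {linear_char m i \<beta> | i \<beta>. i < m \<and> m dvd 2 * i \<and> (\<beta> = 1 \<or> \<beta> = -1)} \<union>
    {planar_char m i | i. 0 < i \<and> 2 * i < m}"
proof (intro equalityI subsetI)
  fix \<chi> assume "\<chi> \<in> Irr (I2 m)"
  then obtain n \<rho> where irr: "irreducible_representation (I2 m) n \<rho>" and \<chi>: "\<chi> = character (I2 m) \<rho>"
    by (auto simp: Irr_def)
  from irr m show "\<chi> \<in> {linear_char m i \<beta> | i \<beta>. i < m \<and> m dvd 2 * i \<and> (\<beta> = 1 \<or> \<beta> = -1)} \<union>
    {planar_char m i | i. 0 < i \<and> 2 * i < m}"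
  proof (cases rule: irreducible_representation_cases)
    case (linear i \<beta>)
    then show ?thesis using \<chi> by blast
  next
    case (planar i)
    have "i \<noteq> 0" "2 * i \<noteq> m" using planar(3) by (metis dvd_0_right mult_0_right, metis dvd_refl)
    then consider "0 < i" "2 * i < m" | "0 < m - i" "2 * (m - i) < m" using planar by linarith
    then show ?thesis
    proof cases
      case 1
      then show ?thesis using planar \<chi> by blast
    next
      case 2
      moreover have "\<chi> = planar_char m (m - i)"
        using planar planar_char_reflect[OF m, of i] \<chi> by simp
      ultimately show ?thesis by blast
    qed
  qed
next
  fix \<chi> assume "\<chi> \<in> {linear_char m i \<beta> | i \<beta>. i < m \<and> m dvd 2 * i \<and> (\<beta> = 1 \<or> \<beta> = -1)} \<union>
    {planar_char m i | i. 0 < i \<and> 2 * i < m}"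
  then consider i \<beta> where "\<chi> = linear_char m i \<beta>" "m dvd 2 * i" "\<beta> = 1 \<or> \<beta> = -1"
    | i where "\<chi> = planar_char m i" "0 < i" "2 * i < m" by blast
  then show "\<chi> \<in> Irr (I2 m)"
  proof cases
    case (1 i \<beta>)
    then obtain \<rho> where "irreducible_representation (I2 m) 1 \<rho>" "character (I2 m) \<rho> = \<chi>"
      using linear_rep[OF m, of i \<beta>] by auto
    then show ?thesis unfolding Irr_def by (intro CollectI exI[of _ 1] exI[of _ \<rho>]) simp
  next
    case (2 i)
    then have "\<not> m dvd 2 * i" using nat_dvd_not_less by simp
    then show ?thesis using planar_rep(1,2)[OF m, of i] 2
      unfolding Irr_def by (intro CollectI exI[of _ 2] exI[of _ "planar_rep i"]) simp
  qed
qed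

text \<open>The eigenvalue set fixes the planar index up to exchanging j and m - j, and these have
  the same character; so the definite description denotes.\<close>

lemma two_dim_char_eq:
  assumes "0 < i" "2 * i < m"
  shows "two_dim_char m i = planar_char m i"
proof -
  have m: "m > 0" using assms by simp
  have ndvd: "\<not> m dvd 2 * i" using assms nat_dvd_not_less by simp
  have rot1: "rotation (2 * pi / real m) = rot m 1" by (simp add: rot_def)
  have ev: "{cis (2 * pi * real i / real m), cis (- (2 * pi * real i / real m))} =
      {unity_root m (int i), unity_root m (- int i)}"
    by (simp add: unity_root_def)
  show ?thesis
    unfolding two_dim_char_def rot1 ev
  proof (rule the_equality)
    show "\<exists>\<rho>. irreducible_representation (I2 m) 2 \<rho> \<and> planar_char m i = character (I2 m) \<rho> \<and>
        {z. eigenvalue (\<rho> (rot m 1)) z} = {unity_root m (int i), unity_root m (- int i)}"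
      using planar_rep[OF m ndvd] by metis
  next
    fix \<chi>
    assume "\<exists>\<rho>. irreducible_representation (I2 m) 2 \<rho> \<and> \<chi> = character (I2 m) \<rho> \<and>
        {z. eigenvalue (\<rho> (rot m 1)) z} = {unity_root m (int i), unity_root m (- int i)}"
    then obtain \<rho> where irr: "irreducible_representation (I2 m) 2 \<rho>" and \<chi>: "\<chi> = character (I2 m) \<rho>"
      and eig: "{z. eigenvalue (\<rho> (rot m 1)) z} = {unity_root m (int i), unity_root m (- int i)}"
      by blast
    from irr m show "\<chi> = planar_char m i"
    proof (cases rule: irreducible_representation_cases)
      case (planar j)
      then have "unity_root m (int j) = unity_root m (int i) \<or> unity_root m (int j) = unity_root m (- int i)"
        using eig by blast
      then have "int m dvd int j - int i \<or> int m dvd int j + int i"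
        using m by (auto simp: unity_root_eq_iff)
      then have "j = i \<or> j = m - i"
      proof
        assume "int m dvd int j - int i"
        then have "int j mod int m = int i mod int m" by (simp add: mod_eq_dvd_iff)
        then have "j mod m = i mod m" by (metis of_nat_eq_iff of_nat_mod)
        then show ?thesis using planar assms by simp
      next
        assume "int m dvd int j + int i"
        then have "m dvd j + i" by presburger
        then obtain c where "j + i = m * c" by (auto simp: dvd_def)
        moreover have "0 < j + i" "j + i < 2 * m" using planar assms by auto
        ultimately have "c = 1" using m
          by (metis One_nat_def Suc_1 less_2_cases less_numeral_extra(3) mult.commute mult_0_right mult_less_cancel2)
        then have "j + i = m" using \<open>j + i = m * c\<close> by simp
        then show ?thesis by linarith
      qed
      then show ?thesis using planar_char_reflect[OF m, of i] assms \<chi> planar by auto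
    qed simp
  qed
qed

lemma dvd_double_iff:
  fixes i m :: nat
  assumes m: "m > 0"
  shows "i < m \<and> m dvd 2 * i \<longleftrightarrow> i = 0 \<or> even m \<and> i = m div 2"
proof
  assume i: "i < m \<and> m dvd 2 * i"
  then obtain c where c: "2 * i = m * c" by (auto simp: dvd_def)
  then have "c < 2" using i by (metis mult.commute mult_less_cancel2 mult_less_mono2 zero_less_numeral)
  then have "c = 0 \<or> c = 1" by linarith
  then show "i = 0 \<or> even m \<and> i = m div 2" using c m by auto
qed (use m in auto)

lemma remaining_linear_chars_eq:
  assumes m: "m > 0"
  shows "remaining_linear_chars m =
    (if even m then {linear_char m (m div 2) 1, linear_char m (m div 2) (-1)} else {})"
proof -
  have one: "1\<^sub>m 2 = rot m 0" by (simp add: rot_0)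
  have "{\<chi> \<in> Irr (I2 m). \<chi> (1\<^sub>m 2) = 1} = {linear_char m i \<beta> | i \<beta>. i < m \<and> m dvd 2 * i \<and> (\<beta> = 1 \<or> \<beta> = -1)}"
    unfolding Irr_I2[OF m] one using m by auto
  also have "\<dots> = {linear_char m 0 1, linear_char m 0 (-1)} \<union>
      (if even m then {linear_char m (m div 2) 1, linear_char m (m div 2) (-1)} else {})"
    unfolding conj_assoc[symmetric] dvd_double_iff[OF m] by auto
  finally have A: "{\<chi> \<in> Irr (I2 m). \<chi> (1\<^sub>m 2) = 1} = \<dots>" .
  have "linear_char m (m div 2) \<beta> \<noteq> linear_char m 0 \<beta>'" if "even m" for \<beta> \<beta>'
  proof
    assume eq: "linear_char m (m div 2) \<beta> = linear_char m 0 \<beta>'"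
    have "linear_char m (m div 2) \<beta> (rot m 1) = linear_char m 0 \<beta>' (rot m 1)" by (simp only: eq)
    then have "int m dvd int (m div 2)" using m by (simp add: unity_root_eq_1_iff)
    then have "m dvd m div 2" by (simp only: int_dvd_int_iff)
    moreover have "0 < m div 2" "m div 2 < m" using that m by auto
    ultimately show False using nat_dvd_not_less by blast
  qed
  then show ?thesis
    unfolding remaining_linear_chars_def A trivial_char_eq[OF m] sign_char_eq[OF m] by auto
qed

section \<open>Fake degrees\<close>

lemma sum_unity_root:
  assumes m: "m > 0"
  shows "(\<Sum>k<m. unity_root m (l * int k)) = (if int m dvd l then of_nat m else 0)"
proof (cases "int m dvd l")
  case True
  then have "unity_root m (l * int k) = 1" for k
    using m by (simp add: unity_root_eq_1_iff)
  then show ?thesis using True by simp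
next
  case False
  have "unity_root m (l * int k) = unity_root m l ^ k" for k
    by (simp add: unity_root_power mult.commute)
  then have "(unity_root m l - 1) * (\<Sum>k<m. unity_root m (l * int k)) = unity_root m l ^ m - 1"
    by (simp add: power_diff_1_eq)
  also have "\<dots> = 0"
    using m by (simp add: unity_root_power unity_root_eq_1_iff)
  finally show ?thesis
    using False m by (simp add: unity_root_eq_1_iff)
qed

text \<open>The cofactor of \<open>char_poly (rot m k)\<close> in
  \<open>(q^2 - 1) (q^m - 1)\<close>, written as a Fourier sum in k so that summation against a
  character over k isolates a single j.\<close>

definition rotation_quotient :: "nat \<Rightarrow> int \<Rightarrow> complex poly" where
  "rotation_quotient m k =
     (\<Sum>j<m. Polynomial.smult (unity_root m (- (int j * k))) (monom 1 j + monom 1 (m - j)))"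

lemma char_poly_rot: "char_poly (rot m k) = [:1, - (unity_root m k + unity_root m (- k)), 1:]"
proof -
  have "unity_root m k + unity_root m (- k) = 2 * of_real (Re (unity_root m k))"
    by (simp add: unity_root_def complex_eq_iff)
  moreover have "of_real ((Re (unity_root m k))\<^sup>2 + (Im (unity_root m k))\<^sup>2) = (1::complex)"
    by (simp only: unity_root_norm_sq of_real_1)
  ultimately show ?thesis
    unfolding rot_eq char_poly_mat2 by (simp add: power2_eq_square)
qed

lemma char_poly_rfl: "char_poly (rfl m k) = monom 1 2 - 1"
proof -
  have "det (rfl m k) = -1" by simp
  then have "- (complex_of_real (Re (unity_root m k)) * of_real (Re (unity_root m k))) -
    of_real (Im (unity_root m k)) * of_real (Im (unity_root m k)) = -1"
    unfolding rfl_eq det_mat2 by simp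
  then show ?thesis
    unfolding rfl_eq char_poly_mat2 by (simp add: monom_altdef power2_eq_square one_pCons)
qed

text \<open>With x the inverse root of unity, \<open>char_poly\<close> is
  \<open>(q/x - 1) (x q - 1)\<close> and the quotient is a sum of two geometric series, each
  collapsing against one of these factors.\<close>

lemma char_poly_rot_dvd:
  assumes m: "m > 0"
  shows "(monom 1 2 - 1) * (monom 1 m - 1) = char_poly (rot m k) * rotation_quotient m k"
proof -
  have "poly ((monom 1 2 - 1) * (monom 1 m - 1)) q = poly (char_poly (rot m k) * rotation_quotient m k) q" for q
  proof -
    define x where "x = unity_root m (- k)"
    define S T where "S = (\<Sum>j<m. (x * q) ^ j)" and "T = (\<Sum>j<m. (q / x) ^ j)"
    have x: "x \<noteq> 0" "x ^ m = 1" using m by (simp_all add: x_def unity_root_power unity_root_eq_1_iff)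
    have inv: "unity_root m k = 1 / x" by (simp add: x_def unity_root_minus divide_inverse)
    have pw: "unity_root m (- (int j * k)) = x ^ j" for j by (simp add: x_def unity_root_power)
    \<comment> \<open>Reversing the summation order and using \<open>x^m = 1\<close> turns the
      descending powers of q into a geometric series in q / x that starts at exponent 1.\<close>
    have "(\<Sum>j<m. x ^ j * q ^ (m - j)) = (\<Sum>j<m. (q / x) ^ Suc j)"
    proof (subst sum.nat_diff_reindex[symmetric], rule sum.cong)
      fix j assume "j \<in> {..<m}"
      then have j: "m - Suc j + Suc j = m" by simp
      then have "x ^ (m - Suc j) * x ^ Suc j = 1" using x by (metis power_add)
      then have "x ^ (m - Suc j) = 1 / x ^ Suc j" using x by (simp add: field_simps)
      moreover have "m - (m - Suc j) = Suc j" using j by simp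
      ultimately show "x ^ (m - Suc j) * q ^ (m - (m - Suc j)) = (q / x) ^ Suc j"
        by (simp add: power_divide)
    qed simp
    also have "\<dots> = q / x * T" by (simp add: T_def sum_distrib_left)
    finally have "poly (rotation_quotient m k) q = S + q / x * T"
      unfolding rotation_quotient_def S_def
      by (simp add: poly_sum poly_monom pw distrib_left sum.distrib power_mult_distrib)
    moreover have "(x * q - 1) * S = q ^ m - 1" "(q / x - 1) * T = q ^ m - 1"
      unfolding S_def T_def power_diff_1_eq[symmetric]
      using x by (simp_all add: power_mult_distrib power_divide)
    moreover have "poly (char_poly (rot m k)) q = (q / x - 1) * (x * q - 1)"
      unfolding char_poly_rot inv x_def[symmetric] using x by (simp add: field_simps)
    moreover have distr: "(a * b) * (S + c * T) = a * (b * S) + b * c * (a * T)" for a b c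
      by (simp add: algebra_simps)
    ultimately have "poly (char_poly (rot m k) * rotation_quotient m k) q =
        (q / x - 1) * (q ^ m - 1) + (x * q - 1) * (q / x) * (q ^ m - 1)"
      by (simp only: poly_mult distr)
    also have "\<dots> = (q\<^sup>2 - 1) * (q ^ m - 1)"
      using x by (simp add: field_simps power2_eq_square)
    finally show ?thesis by (simp add: poly_monom)
  qed
  then show ?thesis by (simp add: poly_eq_poly_eq_iff[symmetric] fun_eq_iff)
qed

text \<open>The minus sign is the determinant of a reflection, whose cofactor in
  \<open>(q^2 - 1) (q^m - 1)\<close> is \<open>q^m - 1\<close> for every k.\<close>

definition fake_degree_poly :: "nat \<Rightarrow> class_fun \<Rightarrow> complex poly" where
  "fake_degree_poly m f = Polynomial.smult (1 / of_nat (2 * m))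
     ((\<Sum>k<m. Polynomial.smult (f (rot m (int k))) (rotation_quotient m (int k)))
      - Polynomial.smult (\<Sum>k<m. f (rfl m (int k))) (monom 1 m - 1))"

lemma to_fract_of_nat: "to_fract (of_nat n) = of_nat n"
  by (induction n) (simp_all add: to_fract_add)

lemma to_fract_sum: "to_fract (sum f A) = (\<Sum>x\<in>A. to_fract (f x))"
  by (induction A rule: infinite_finite_induct) (simp_all add: to_fract_add)

lemma fake_degree_eq:
  assumes m: "m > 0"
  shows "fake_degree m f = to_fract (fake_degree_poly m f)"
proof -
  let ?D = "(monom 1 2 - 1) * (monom 1 m - 1) :: complex poly"
  have D: "to_fract ?D * (to_fract [:c:] / to_fract (char_poly w)) = to_fract (Polynomial.smult c Q)"
    if "?D = char_poly w * Q" "char_poly w \<noteq> 0" for c w Q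
    using that by (simp add: to_fract_mult[symmetric] field_simps del: to_fract_mult)
  have nz: "char_poly (rot m k) \<noteq> 0" "char_poly (rfl m k) \<noteq> 0" for k
    using degree_monic_char_poly[of "rot m k" 2] degree_monic_char_poly[of "rfl m k" 2]
    by (auto simp: rot_eq rfl_eq)
  have rfl: "?D = char_poly (rfl m k) * (monom 1 m - 1)" for k
    by (simp only: char_poly_rfl)
  have "to_fract ?D * (\<Sum>w\<in>carrier (I2 m). to_fract [:det w * f w:] / to_fract (char_poly w)) =
      to_fract ((\<Sum>k<m. Polynomial.smult (f (rot m (int k))) (rotation_quotient m (int k)))
      + (\<Sum>k<m. Polynomial.smult (- f (rfl m (int k))) (monom 1 m - 1)))"
    by (simp only: sum_carrier_I2[OF m] distrib_left sum_distrib_left to_fract_add to_fract_sum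
        det_rot det_rfl mult_1 mult_minus1 D[OF char_poly_rot_dvd[OF m] nz(1)] D[OF rfl nz(2)])
  also have "(\<Sum>k<m. Polynomial.smult (- f (rfl m (int k))) (monom 1 m - 1)) =
      - Polynomial.smult (\<Sum>k<m. f (rfl m (int k))) (monom 1 m - 1 :: complex poly)"
    by (simp add: smult_sum sum_negf)
  finally have "to_fract ?D * (\<Sum>w\<in>carrier (I2 m). to_fract [:det w * f w:] / to_fract (char_poly w)) =
      to_fract (of_nat (2 * m) * fake_degree_poly m f)"
    using m by (simp add: fake_degree_poly_def of_nat_poly)
  then have "fake_degree m f = of_nat (2 * m) * to_fract (fake_degree_poly m f) / of_nat (2 * m)"
    unfolding fake_degree_def times_divide_eq_left to_fract_mult[of "of_nat (2 * m)"] to_fract_of_nat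
    by (rule arg_cong)
  moreover have n: "of_nat (2 * m) \<noteq> (0 :: ratfun)"
    using m unfolding to_fract_of_nat[symmetric] by simp
  ultimately show ?thesis
    by (simp only: nonzero_mult_div_cancel_left[OF n])
qed

text \<open>Orthogonality leaves only j congruent to l mod m; since \<open>q^j + q^(m-j)\<close> is
  unchanged under j -> m - j, the result can be written with the absolute value of l.\<close>

lemma sum_rotation_quotient:
  assumes m: "m > 0" and l: "\<bar>l\<bar> \<le> int m"
  shows "(\<Sum>k<m. unity_root m (l * int k) * poly (rotation_quotient m (int k)) q) =
    of_nat m * (q ^ nat \<bar>l\<bar> + q ^ (m - nat \<bar>l\<bar>))"
proof -
  have "(\<Sum>k<m. unity_root m (l * int k) * poly (rotation_quotient m (int k)) q) =
      (\<Sum>k<m. \<Sum>j<m. unity_root m ((l - int j) * int k) * (q ^ j + q ^ (m - j)))"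
    unfolding rotation_quotient_def
    by (simp add: poly_sum poly_monom sum_distrib_left mult.assoc[symmetric] unity_root_add[symmetric]
        left_diff_distrib)
  also have "\<dots> = (\<Sum>j<m. (\<Sum>k<m. unity_root m ((l - int j) * int k)) * (q ^ j + q ^ (m - j)))"
    by (subst sum.swap) (simp add: sum_distrib_right)
  also have "\<dots> = (\<Sum>j<m. if j = nat (l mod int m) then of_nat m * (q ^ j + q ^ (m - j)) else 0)"
  proof (rule sum.cong)
    fix j assume "j \<in> {..<m}"
    then have "int m dvd l - int j \<longleftrightarrow> j = nat (l mod int m)"
      by (auto simp: mod_eq_dvd_iff[symmetric] simp flip: mod_eq_dvd_iff)
    then show "(\<Sum>k<m. unity_root m ((l - int j) * int k)) * (q ^ j + q ^ (m - j)) =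
        (if j = nat (l mod int m) then of_nat m * (q ^ j + q ^ (m - j)) else 0)"
      by (simp add: sum_unity_root[OF m])
  qed simp
  also have "\<dots> = of_nat m * (q ^ nat (l mod int m) + q ^ (m - nat (l mod int m)))"
    using m by (simp add: nat_less_iff)
  also have "\<dots> = of_nat m * (q ^ nat \<bar>l\<bar> + q ^ (m - nat \<bar>l\<bar>))"
  proof -
    consider "l = int m" | "l = - int m" | "0 \<le> l" "l < int m" | "- int m < l" "l < 0" using l by linarith
    then show ?thesis
    proof cases
      case 4
      have "l mod int m = (l + int m) mod int m" by simp
      also have "\<dots> = l + int m" using 4 by (intro mod_pos_pos_trivial) auto
      finally have "l mod int m = l + int m" .
      then have "nat (l mod int m) = m - nat \<bar>l\<bar>" "m - nat (l mod int m) = nat \<bar>l\<bar>" using 4 by auto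
      then show ?thesis by simp
    qed (use m in \<open>auto simp: add.commute\<close>)
  qed
  finally show ?thesis .
qed

lemma poly_fake_degree:
  "poly (fake_degree_poly m f) q = (1 / (2 * of_nat m)) *
     ((\<Sum>k<m. f (rot m (int k)) * poly (rotation_quotient m (int k)) q)
      - (\<Sum>k<m. f (rfl m (int k))) * (q ^ m - 1))"
  by (simp add: fake_degree_poly_def poly_sum poly_monom)

section \<open>The matrix \<open>\<Omega>\<close>\<close>

locale dihedral =
  fixes m :: nat and \<chi>r \<chi>r' :: class_fun
  assumes m3: "m \<ge> 3"
    and labels: "even m \<Longrightarrow> \<chi>r \<noteq> \<chi>r' \<and> {\<chi>r, \<chi>r'} = remaining_linear_chars m"
begin

abbreviation r :: nat where "r \<equiv> m div 2"

lemma m_pos [simp]: "m > 0"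
  using m3 by simp

text \<open>Indices for the irreducible characters: \<open>i \<le> m / 2\<close> stands for \<open>\<chi>\<^sub>i\<close>, and, for even \<open>m\<close>,
  \<open>m / 2 + 1\<close> stands for the second remaining linear character; \<open>m\<close> stands for the sign.\<close>

definition J :: "nat set" where
  "J = {i. 2 * i < m} \<union> (if even m then {r, Suc r} else {}) \<union> {m}"

definition lab :: "nat \<Rightarrow> class_fun" where
  "lab i = (if i = m then sign_char m else if 2 * i = m + 2 then \<chi>r' else chi m \<chi>r i)"

text \<open>This is the b-invariant (\<open>b_invariant_lab\<close>); the two remaining linear
  characters share the value \<open>r\<close>.\<close>

definition height :: "nat \<Rightarrow> nat" where
  "height i = (if 2 * i = m + 2 then r else i)"

definition fdeg :: "nat \<Rightarrow> complex poly" where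
  "fdeg i = (if i = 0 then 1 else if i = m then monom 1 m else
     if 2 * i = m \<or> 2 * i = m + 2 then monom 1 r else monom 1 i + monom 1 (m - i))"

text \<open>Agrees with \<open>fdeg\<close> on the planar and the remaining linear characters. At
  index 0 it is \<open>1 + q^m\<close> instead of 1, which lets the trivial character enter
  \<open>M\<close> by the common formula.\<close>

definition tail :: "nat \<Rightarrow> complex poly" where
  "tail i = (if 2 * i = m \<or> 2 * i = m + 2 then monom 1 r else monom 1 i + monom 1 (m - i))"

text \<open>\<open>(q\<^sup>m - 1) M\<close> is what remains of \<open>\<Omega>\<close> after the elimination of the sign character.\<close>

definition M :: "nat \<Rightarrow> nat \<Rightarrow> complex poly" where
  "M i j = (if i = m \<or> j = m \<or> even m \<and> {i, j} = {r, Suc r} then 0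
     else monom 1 (height (min i j)) * tail (max i j))"

lemma J_cases [consumes 1, case_names zero planar r r' sign]:
  assumes "i \<in> J"
  obtains "i = 0" | "0 < i" "2 * i < m" | "even m" "i = r" | "even m" "i = Suc r" | "i = m"
  using assms by (auto simp: J_def split: if_splits)

lemma finite_J [simp]: "finite J"
  by (rule finite_subset[of _ "{..Suc m}"]) (auto simp: J_def)

section \<open>Character values, fake degrees and the entries of the matrix\<close>

definition freq :: "nat \<Rightarrow> int" where
  "freq i = (if i = m then 0 else int (height i))"

text \<open>On rotations every irreducible character has the form \<open>mult2 * (u + 1/u)\<close>
  with u a root of unity; for the linear ones u = 1/u and the factor 1/2 compensates. One
  product-to-sum formula then covers all pairs.\<close>

definition mult2 :: "nat \<Rightarrow> complex" where
  "mult2 i = (if i = 0 \<or> i = m \<or> 2 * i = m \<or> 2 * i = m + 2 then 1 / 2 else 1)"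

text \<open>The value of \<open>\<chi>r\<close> at \<open>rfl m 0\<close> depends on the labelling
  and stays a parameter; what enters later is that its square is 1 and that \<open>\<chi>r'\<close>
  has the opposite sign.\<close>

definition refl_value :: "nat \<Rightarrow> complex" where
  "refl_value i = (if i = 0 then 1 else if i = m then - 1 else if 2 * i = m then \<chi>r (rfl m 0)
     else if 2 * i = m + 2 then - \<chi>r (rfl m 0) else 0)"

lemma lab_simps:
  "lab 0 = linear_char m 0 1" "lab m = linear_char m 0 (-1)"
  "0 < i \<Longrightarrow> 2 * i < m \<Longrightarrow> lab i = planar_char m i"
  "even m \<Longrightarrow> lab r = \<chi>r" "even m \<Longrightarrow> lab (Suc r) = \<chi>r'"
proof -
  have "2 * r = m \<Longrightarrow> r \<noteq> 0 \<and> r \<noteq> m \<and> 2 * r \<noteq> m + 2" "2 * r = m \<Longrightarrow> 2 * Suc r = m + 2 \<and> Suc r \<noteq> m"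
    using m3 by auto
  then show "even m \<Longrightarrow> lab r = \<chi>r" "even m \<Longrightarrow> lab (Suc r) = \<chi>r'"
    using m3 by (auto simp: lab_def chi_def)
qed (use m3 in \<open>auto simp: lab_def chi_def trivial_char_eq sign_char_eq two_dim_char_eq\<close>)

lemma remaining_values:
  assumes "even m"
  obtains \<beta> where "\<beta> = 1 \<or> \<beta> = -1" "\<chi>r = linear_char m r \<beta>" "\<chi>r' = linear_char m r (- \<beta>)"
proof -
  have "\<chi>r \<noteq> \<chi>r'" "{\<chi>r, \<chi>r'} = {linear_char m r 1, linear_char m r (-1)}"
    using labels assms remaining_linear_chars_eq[OF m_pos] by auto
  then have "\<chi>r = linear_char m r 1 \<and> \<chi>r' = linear_char m r (-1) \<or>
      \<chi>r = linear_char m r (-1) \<and> \<chi>r' = linear_char m r (- (-1))"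
    by (auto simp: doubleton_eq_iff)
  then show ?thesis using that by blast
qed

lemma refl_value_sq: "i \<in> {r, Suc r} \<Longrightarrow> even m \<Longrightarrow> (\<chi>r (rfl m 0))\<^sup>2 = 1"
  by (erule remaining_values) (auto simp: power2_eq_square)

lemma half_turn:
  assumes "even m"
  shows "unity_root m (- (int r * k)) = unity_root m (int r * k)"
proof -
  have "int m = 2 * int r" using assms by presburger
  then have "- (int r * k) - int r * k = int m * (- k)" by simp
  then have "int m dvd - (int r * k) - int r * k" by (simp only: dvd_triv_left)
  then show ?thesis by (simp only: unity_root_eq_iff[OF m_pos])
qed

lemma lab_rot:
  assumes "i \<in> J"
  shows "lab i (rot m k) = mult2 i * (unity_root m (freq i * k) + unity_root m (- (freq i * k)))"
  using assms
proof (cases rule: J_cases)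
  case r
  obtain \<beta> where "\<chi>r = linear_char m r \<beta>" "\<chi>r' = linear_char m r (- \<beta>)"
    using remaining_values[OF r(1)] by metis
  then have "lab i = linear_char m r \<beta>" using r lab_simps(4) by metis
  then have "lab i (rot m k) = unity_root m (int r * k)" by simp
  moreover have "mult2 i = 1 / 2" "freq i = int r" using r m3 by (auto simp: mult2_def freq_def height_def)
  ultimately show ?thesis using half_turn[OF r(1)] by simp
next
  case r'
  obtain \<beta> where "\<chi>r = linear_char m r \<beta>" "\<chi>r' = linear_char m r (- \<beta>)"
    using remaining_values[OF r'(1)] by metis
  then have "lab i = linear_char m r (- \<beta>)" using r' lab_simps(5) by metis
  then have "lab i (rot m k) = unity_root m (int r * k)" by simp
  moreover have "mult2 i = 1 / 2" "freq i = int r" using r' m3 by (auto simp: mult2_def freq_def height_def)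
  ultimately show ?thesis using half_turn[OF r'(1)] by simp
qed (use m3 in \<open>auto simp: lab_simps mult2_def freq_def height_def\<close>)

lemma lab_rfl:
  assumes "i \<in> J"
  shows "lab i (rfl m k) = refl_value i * unity_root m (freq i * k)"
  using assms
proof (cases rule: J_cases)
  case r
  obtain \<beta> where "\<chi>r = linear_char m r \<beta>" "\<chi>r' = linear_char m r (- \<beta>)"
    using remaining_values[OF r(1)] by metis
  then have "lab i = linear_char m r \<beta>" "\<chi>r (rfl m 0) = \<beta>"
    using r lab_simps(4) by (metis, simp)
  then show ?thesis using r m3 by (auto simp: refl_value_def freq_def height_def)
next
  case r'
  obtain \<beta> where "\<chi>r = linear_char m r \<beta>" "\<chi>r' = linear_char m r (- \<beta>)"
    using remaining_values[OF r'(1)] by metis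
  then have "lab i = linear_char m r (- \<beta>)" "\<chi>r (rfl m 0) = \<beta>"
    using r' lab_simps(5) by (metis, simp)
  then show ?thesis using r' m3 by (auto simp: refl_value_def freq_def height_def)
qed (use m3 in \<open>auto simp: lab_simps refl_value_def freq_def height_def\<close>)

lemma freq_bound: "i \<in> J \<Longrightarrow> 0 \<le> freq i \<and> 2 * freq i \<le> int m"
  by (erule J_cases) (auto simp: freq_def height_def)

lemma fake_degree_lab:
  assumes i: "i \<in> J"
  shows "fake_degree m (lab i) = to_fract (fdeg i)"
proof -
  have "poly (fake_degree_poly m (lab i)) q = poly (fdeg i) q" for q
  proof -
    let ?Q = "\<lambda>k. poly (rotation_quotient m (int k)) q"
    let ?e = "nat (freq i)"
    have e: "\<bar>freq i\<bar> = freq i" "\<bar>- freq i\<bar> = freq i" "\<bar>freq i\<bar> \<le> int m" "\<bar>- freq i\<bar> \<le> int m"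
      using freq_bound[OF i] by auto
    have R: "(\<Sum>k<m. lab i (rfl m (int k))) = refl_value i * (if int m dvd freq i then of_nat m else 0)"
      by (simp only: lab_rfl[OF i] sum_distrib_left[symmetric] sum_unity_root[OF m_pos])
    have "(\<Sum>k<m. lab i (rot m (int k)) * ?Q k) = mult2 i *
        ((\<Sum>k<m. unity_root m (freq i * int k) * ?Q k) + (\<Sum>k<m. unity_root m (- freq i * int k) * ?Q k))"
      by (simp add: lab_rot[OF i] distrib_left distrib_right sum.distrib sum_distrib_left mult.assoc)
    also have "\<dots> = 2 * of_nat m * (mult2 i * (q ^ ?e + q ^ (m - ?e)))"
      by (simp only: sum_rotation_quotient[OF m_pos e(3)] sum_rotation_quotient[OF m_pos e(4)] e(1,2))
        (simp add: algebra_simps)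
    finally have "poly (fake_degree_poly m (lab i)) q = mult2 i * (q ^ ?e + q ^ (m - ?e)) -
        (if int m dvd freq i then refl_value i * (q ^ m - 1) / 2 else 0)"
      by (simp add: poly_fake_degree R field_simps)
    also have "int m dvd freq i \<longleftrightarrow> freq i = 0"
    proof
      assume d: "int m dvd freq i"
      show "freq i = 0"
      proof (rule ccontr)
        assume "freq i \<noteq> 0"
        then have "freq i > 0" "freq i < int m" using freq_bound[OF i] m3 by auto
        then show False using d zdvd_not_zless by blast
      qed
    qed simp
    also have "mult2 i * (q ^ ?e + q ^ (m - ?e)) - (if freq i = 0 then refl_value i * (q ^ m - 1) / 2 else 0)
        = poly (fdeg i) q"
      using i m3
      by (cases rule: J_cases) (auto simp: mult2_def freq_def height_def refl_value_def fdeg_def poly_monom field_simps)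
    finally show ?thesis .
  qed
  then have "fake_degree_poly m (lab i) = fdeg i" by (simp add: poly_eq_poly_eq_iff[symmetric] fun_eq_iff)
  then show ?thesis by (simp add: fake_degree_eq)
qed

lemma lab_product_value:
  assumes i: "i \<in> J" and j: "j \<in> J"
  shows "poly (fake_degree_poly m (\<lambda>w. lab i w * lab j w * sign_char m w)) q =
    mult2 i * mult2 j *
      (q ^ nat (freq i + freq j) + q ^ (m - nat (freq i + freq j)) +
       q ^ nat \<bar>freq i - freq j\<bar> + q ^ (m - nat \<bar>freq i - freq j\<bar>)) +
    (if int m dvd freq i + freq j then refl_value i * refl_value j * (q ^ m - 1) / 2 else 0)"
proof -
  let ?Q = "\<lambda>k. poly (rotation_quotient m (int k)) q"
  let ?s = "freq i + freq j" and ?d = "freq i - freq j"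
  have b: "\<bar>?s\<bar> = ?s" "\<bar>- ?s\<bar> = ?s" "\<bar>- ?d\<bar> = \<bar>?d\<bar>"
    "\<bar>?s\<bar> \<le> int m" "\<bar>- ?s\<bar> \<le> int m" "\<bar>?d\<bar> \<le> int m" "\<bar>- ?d\<bar> \<le> int m"
    using freq_bound[OF i] freq_bound[OF j] by auto
  have "lab i (rot m k) * lab j (rot m k) * sign_char m (rot m k) = mult2 i * mult2 j *
      (unity_root m (?s * k) + unity_root m (- ?s * k) + unity_root m (?d * k) + unity_root m (- ?d * k))" for k
    by (simp add: lab_rot i j sign_char_eq left_diff_distrib distrib_right unity_root_diff unity_root_add
        unity_root_minus algebra_simps divide_inverse)
  then have "(\<Sum>k<m. lab i (rot m (int k)) * lab j (rot m (int k)) * sign_char m (rot m (int k)) * ?Q k) =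
      mult2 i * mult2 j * ((\<Sum>k<m. unity_root m (?s * int k) * ?Q k) + (\<Sum>k<m. unity_root m (- ?s * int k) * ?Q k)
        + (\<Sum>k<m. unity_root m (?d * int k) * ?Q k) + (\<Sum>k<m. unity_root m (- ?d * int k) * ?Q k))"
    by (simp add: distrib_left distrib_right sum.distrib sum_distrib_left mult.assoc)
  also have "\<dots> = 2 * of_nat m * (mult2 i * mult2 j *
      (q ^ nat ?s + q ^ (m - nat ?s) + q ^ nat \<bar>?d\<bar> + q ^ (m - nat \<bar>?d\<bar>)))"
    by (simp only: sum_rotation_quotient[OF m_pos b(4)] sum_rotation_quotient[OF m_pos b(5)]
        sum_rotation_quotient[OF m_pos b(6)] sum_rotation_quotient[OF m_pos b(7)] b(1,2,3))
      (simp add: algebra_simps)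
  finally have A: "(\<Sum>k<m. lab i (rot m (int k)) * lab j (rot m (int k)) * sign_char m (rot m (int k)) * ?Q k) = \<dots>" .
  have "lab i (rfl m k) * lab j (rfl m k) * sign_char m (rfl m k) =
      - (refl_value i * refl_value j) * unity_root m (?s * k)" for k
    by (simp add: lab_rfl i j sign_char_eq distrib_right unity_root_add)
  then have B: "(\<Sum>k<m. lab i (rfl m (int k)) * lab j (rfl m (int k)) * sign_char m (rfl m (int k))) =
      - (refl_value i * refl_value j) * (if int m dvd ?s then of_nat m else 0)"
    by (simp only: sum_distrib_left[symmetric] sum_unity_root[OF m_pos])
  show ?thesis
    unfolding poly_fake_degree A B by (simp add: field_simps)
qed

lemma M_commute: "M i j = M j i"
  by (simp add: M_def min.commute max.commute insert_commute disj_commute)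

lemma zero_values: "mult2 0 = 1 / 2" "freq 0 = 0" "refl_value 0 = 1" "fdeg 0 = 1"
  using m3 by (auto simp: mult2_def freq_def height_def refl_value_def fdeg_def)

lemma sign_values: "mult2 m = 1 / 2" "freq m = 0" "refl_value m = -1" "fdeg m = monom 1 m"
  using m3 by (auto simp: mult2_def freq_def height_def refl_value_def fdeg_def)

lemma planar_values:
  assumes "0 < i" "2 * i < m"
  shows "mult2 i = 1" "freq i = int i" "refl_value i = 0" "fdeg i = monom 1 i + monom 1 (m - i)"
    "height i = i" "tail i = fdeg i"
  using assms by (auto simp: mult2_def freq_def height_def refl_value_def fdeg_def tail_def)

lemma half_values:
  assumes "even m" "i = r \<or> i = Suc r"
  shows "mult2 i = 1 / 2" "freq i = int r" "fdeg i = monom 1 r" "height i = r" "tail i = fdeg i"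
    "i < m"
  using assms m3 by (auto simp: mult2_def freq_def height_def fdeg_def tail_def)

lemma half_refl_values:
  assumes "even m"
  shows "refl_value (Suc r) = - refl_value r" "refl_value r * refl_value r = 1"
  using assms m3 refl_value_sq[of r] by (auto simp: refl_value_def power2_eq_square)

text \<open>Both sides are sums of monomials in q. Writing the indices through nonnegative
  differences (\<open>r = i + t\<close>, or \<open>j = i + s\<close> and
  \<open>m = 2 * i + s + t\<close>) removes truncated subtraction and leaves a comparison of
  exponents.\<close>

lemma Omega_value:
  assumes i: "i \<in> J" and j: "j \<in> J" and le: "i \<le> j"
  shows "q ^ m * poly (fake_degree_poly m (\<lambda>w. lab i w * lab j w * sign_char m w)) q =
    poly (fdeg i) q * poly (fdeg j) q + (q ^ m - 1) * poly (M i j) q"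
proof -
  let ?W = "poly (fake_degree_poly m (\<lambda>w. lab i w * lab j w * sign_char m w)) q"
  note W = lab_product_value[OF i j]
  have ndvd: "\<not> int m dvd x" if "0 < x" "x < int m" for x
    using that zdvd_not_zless by blast
  have half: ?thesis if half: "even m" "j = r \<or> j = Suc r"
  proof -
    note vj = half_values[OF half]
    have p: "r + r = m" "r \<ge> 2" using half(1) m3 by presburger+
    have mr: "m - r = r" using p by linarith
    have ir: "int r + int r = int m" using p(1) by linarith
    have qm: "q ^ m = q ^ r * q ^ r" using p by (metis power_add)
    from i show ?thesis
    proof (cases rule: J_cases)
      case zero
      have "\<not> int m dvd int r" using p by (intro ndvd) auto
      then have "?W = q ^ r" unfolding W unfolding zero zero_values vj by (simp add: mr)
      moreover have "M i j = monom 1 r" using zero half m3 vj by (auto simp: M_def height_def)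
      ultimately show ?thesis by (simp add: zero zero_values vj poly_monom algebra_simps)
    next
      case planar
      then have "i \<le> r" by simp
      then obtain t where t: "r = i + t" by (auto simp: le_iff_add)
      have nd: "\<not> int m dvd int i + int r" using planar p by (intro ndvd) auto
      have n: "nat (int i + int r) = i + r" "nat \<bar>int i - int r\<bar> = t" "m - (i + r) = t" "m - t = i + r"
        "m - i = r + t"
        using t p by linarith+
      have "?W = q ^ (i + r) + q ^ t"
        unfolding W unfolding planar_values[OF planar] vj n using nd by simp
      moreover have "M i j = monom 1 (i + r)"
        using planar half vj le by (auto simp: M_def planar_values doubleton_eq_iff mult_monom max_def)
      moreover have "q ^ r = q ^ i * q ^ t" using t by (simp add: power_add)
      ultimately show ?thesis
        by (simp add: planar_values[OF planar] vj n poly_monom qm power_add algebra_simps)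
    next
      case r
      have n: "nat (int r + int r) = m" "nat \<bar>int r - int r\<bar> = 0" using p by auto
      have d: "int m dvd int r + int r" by (simp only: ir dvd_refl)
      show ?thesis
      proof (cases "j = r")
        case True
        have "?W = q ^ m"
          unfolding W unfolding half_values[OF r(1) disjI1[OF r(2)]] vj n using d
          by (simp add: r True half_refl_values[OF r(1)] field_simps)
        moreover have "M i j = monom 1 m" using r True vj p by (auto simp: M_def mult_monom)
        ultimately show ?thesis by (simp add: r True vj[unfolded True] poly_monom qm algebra_simps)
      next
        case False
        then have j': "j = Suc r" using half by simp
        have "?W = 1"
          unfolding W unfolding half_values[OF r(1) disjI1[OF r(2)]] vj n using d
          by (simp add: r j' half_refl_values[OF r(1)] field_simps)
        moreover have "M i j = 0" using r j' by (auto simp: M_def)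
        ultimately show ?thesis using half_values[OF r(1) disjI1[OF r(2)]] vj
          by (simp add: poly_monom qm)
      qed
    next
      case r'
      then have j': "j = Suc r" using half le by auto
      have n: "nat (int r + int r) = m" "nat \<bar>int r - int r\<bar> = 0" using p by auto
      have d: "int m dvd int r + int r" by (simp only: ir dvd_refl)
      have "?W = q ^ m"
        unfolding W unfolding half_values[OF r'(1) disjI2[OF r'(2)]] vj n using d
        by (simp add: r' j' half_refl_values[OF r'(1)] field_simps)
      moreover have "M i j = monom 1 m" using r' j' vj p by (auto simp: M_def mult_monom)
      ultimately show ?thesis using half_values[OF r'(1) disjI2[OF r'(2)]] vj
        by (simp add: poly_monom qm algebra_simps)
    qed (use le vj in auto)
  qed
  from j show ?thesis
  proof (cases rule: J_cases)
    case zero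
    then have "i = 0" "j = 0" using le by auto
    then have "?W = q ^ m" unfolding W by (simp add: zero_values field_simps)
    moreover have "M i j = 1 + monom 1 m"
      using m3 by (auto simp: \<open>i = 0\<close> \<open>j = 0\<close> M_def height_def tail_def)
    ultimately show ?thesis by (simp add: \<open>i = 0\<close> \<open>j = 0\<close> zero_values poly_monom algebra_simps)
  next
    case planar
    note vj = planar_values[OF planar] and pj = planar
    from i show ?thesis
    proof (cases rule: J_cases)
      case zero
      have nd: "\<not> int m dvd int j" using planar by (intro ndvd) auto
      have "?W = q ^ j + q ^ (m - j)" unfolding W unfolding zero zero_values vj using nd by simp
      moreover have "M i j = fdeg j" using zero planar by (auto simp: M_def vj height_def)
      ultimately show ?thesis by (simp add: zero zero_values vj poly_monom algebra_simps)
    next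
      case planar
      obtain s where s: "j = i + s" using le le_Suc_ex by blast
      have "2 * i + s \<le> m" using s pj planar by linarith
      then obtain t where t: "m = 2 * i + s + t" by (auto simp: le_iff_add)
      have nd: "\<not> int m dvd int i + int j" using planar pj by (intro ndvd) auto
      have n: "nat (int i + int j) = i + j" "nat \<bar>int i - int j\<bar> = s" using s by auto
      have e: "m - (i + j) = t" "m - s = i + i + t" "m - j = i + t" "m - i = i + s + t" using s t by auto
      have "?W = q ^ (i + j) + q ^ t + q ^ s + q ^ (i + i + t)"
        unfolding W unfolding planar_values[OF planar] vj n e using nd by simp
      moreover have "M i j = monom 1 i * (monom 1 j + monom 1 (m - j))"
        using planar pj le by (auto simp: M_def vj planar_values doubleton_eq_iff max_def)
      moreover have "q ^ m = q ^ i * q ^ i * q ^ s * q ^ t" by (simp add: t power_add mult_2)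
      ultimately show ?thesis
        unfolding planar_values[OF planar] vj e by (simp add: poly_monom s power_add algebra_simps)
    qed (use pj le in auto)
  next
    case sign
    from i show ?thesis
    proof (cases rule: J_cases)
      case zero
      have "?W = 1" unfolding W unfolding zero sign zero_values sign_values by (simp add: field_simps)
      then show ?thesis by (simp add: zero sign zero_values sign_values M_def poly_monom)
    next
      case planar
      have "\<not> int m dvd int i" using planar by (intro ndvd) auto
      then have "?W = q ^ i + q ^ (m - i)" unfolding W unfolding planar_values[OF planar] sign sign_values by simp
      then show ?thesis by (simp add: planar_values[OF planar] sign sign_values M_def poly_monom algebra_simps)
    next
      case r
      have "\<not> int m dvd int r" using r m3 by (intro ndvd) auto
      moreover have mr: "m - r = r" using r(1) by presburger
      ultimately have "?W = q ^ r" unfolding W unfolding half_values[OF r(1) disjI1[OF r(2)]] sign sign_values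
        by (simp add: mr)
      then show ?thesis
        by (simp add: half_values[OF r(1) disjI1[OF r(2)]] sign sign_values M_def poly_monom)
    next
      case r'
      have "\<not> int m dvd int r" using r' m3 by (intro ndvd) auto
      moreover have mr: "m - r = r" using r'(1) by presburger
      ultimately have "?W = q ^ r" unfolding W unfolding half_values[OF r'(1) disjI2[OF r'(2)]] sign sign_values
        by (simp add: mr)
      then show ?thesis
        by (simp add: half_values[OF r'(1) disjI2[OF r'(2)]] sign sign_values M_def poly_monom)
    next
      case sign': sign
      have "?W = q ^ m" unfolding W unfolding sign sign' sign_values by (simp add: field_simps)
      then show ?thesis by (simp add: sign sign' sign_values M_def poly_monom)
    qed
  qed (use half in auto)
qed

lemma Omega_lab:
  assumes i: "i \<in> J" and j: "j \<in> J"
  shows "Omega m (lab i) (lab j) = to_fract (fdeg i * fdeg j + (monom 1 m - 1) * M i j)"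
proof -
  have "q ^ m * poly (fake_degree_poly m (\<lambda>w. lab i w * lab j w * sign_char m w)) q =
      poly (fdeg i) q * poly (fdeg j) q + (q ^ m - 1) * poly (M i j) q" for q
  proof (cases "i \<le> j")
    case True
    then show ?thesis using Omega_value i j by simp
  next
    case False
    then show ?thesis using Omega_value[OF j i, of q] by (simp add: M_commute[of i j] mult.commute)
  qed
  then have "monom 1 m * fake_degree_poly m (\<lambda>w. lab i w * lab j w * sign_char m w) =
      fdeg i * fdeg j + (monom 1 m - 1) * M i j"
    by (simp add: poly_eq_poly_eq_iff[symmetric] fun_eq_iff poly_monom)
  then show ?thesis by (simp only: Omega_def fake_degree_eq[OF m_pos] to_fract_mult[symmetric])
qed

lemma order_fdeg:
  assumes "i \<in> J"
  shows "Polynomial.order 0 (fdeg i) = height i"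
  using assms
proof (cases rule: J_cases)
  case planar
  have e: "fdeg i = monom 1 i * (1 + monom 1 (m - 2 * i))"
    unfolding planar_values[OF planar] using planar by (simp add: distrib_left mult_monom)
  have "Polynomial.order 0 (1 + monom 1 (m - 2 * i) :: complex poly) = 0"
    using planar by (intro order_0I) (simp add: poly_monom zero_power)
  moreover have "fdeg i \<noteq> 0"
  proof
    assume "fdeg i = 0"
    moreover have "coeff (fdeg i) i = 1" unfolding planar_values[OF planar] using planar by auto
    ultimately show False by simp
  qed
  ultimately show ?thesis
    using order_mult[of "monom 1 i :: complex poly" "1 + monom 1 (m - 2 * i)" 0]
    by (simp add: e planar_values(5)[OF planar])
qed (use m3 half_values sign_values zero_values in \<open>auto simp: order_0_monom height_def fdeg_def\<close>)

lemma b_invariant_lab: "i \<in> J \<Longrightarrow> b_invariant m (lab i) = height i"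
  unfolding b_invariant_def by (simp add: fake_degree_lab order_fdeg)

text \<open>The b-invariant separates all indices except \<open>r\<close> and \<open>Suc r\<close>;
  those two are separated by \<open>labels\<close>.\<close>

lemma inj_on_lab: "inj_on lab J"
proof (rule inj_onI)
  fix i j assume ij: "i \<in> J" "j \<in> J" "lab i = lab j"
  then have h: "height i = height j" using b_invariant_lab by metis
  show "i = j"
  proof (cases "even m \<and> {i, j} = {r, Suc r}")
    case True
    then have "lab i \<noteq> lab j" if "i \<noteq> j"
      using that labels lab_simps(4,5) by (metis doubleton_eq_iff)
    then show ?thesis using ij(3) by blast
  next
    case False
    have hr: "2 * k = m + 2 \<Longrightarrow> even m \<and> k = Suc r" "height k = (if 2 * k = m + 2 then r else k)" for k
      by (presburger, simp add: height_def)
    have "\<not> (2 * i = m + 2 \<and> 2 * j \<noteq> m + 2)" "\<not> (2 * j = m + 2 \<and> 2 * i \<noteq> m + 2)"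
      using h hr(1)[of i] hr(1)[of j] hr(2)[of i] hr(2)[of j] False by auto
    then show ?thesis using h hr(2)[of i] hr(2)[of j] by (auto split: if_splits)
  qed
qed

lemma Irr_eq: "Irr (I2 m) = lab ` J"
proof -
  have "{linear_char m i \<beta> | i \<beta>. i < m \<and> m dvd 2 * i \<and> (\<beta> = 1 \<or> \<beta> = -1)} = {linear_char m 0 1, linear_char m 0 (-1)} \<union>
      (if even m then {linear_char m r 1, linear_char m r (-1)} else {})"
    unfolding conj_assoc[symmetric] dvd_double_iff[OF m_pos] by auto
  also have "\<dots> = {lab 0, lab m} \<union> (if even m then {lab r, lab (Suc r)} else {})"
    using labels remaining_linear_chars_eq[OF m_pos] by (auto simp: lab_simps)
  finally have A: "{linear_char m i \<beta> | i \<beta>. i < m \<and> m dvd 2 * i \<and> (\<beta> = 1 \<or> \<beta> = -1)} = \<dots>" .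
  have "{planar_char m i | i. 0 < i \<and> 2 * i < m} = lab ` {i. 0 < i \<and> 2 * i < m}"
    by (auto simp: lab_simps image_iff) 
  moreover have "J = {0, m} \<union> (if even m then {r, Suc r} else {}) \<union> {i. 0 < i \<and> 2 * i < m}"
    using m3 by (auto simp: J_def)
  ultimately show ?thesis
    unfolding Irr_I2[OF m_pos] A by auto
qed

lemma chi_eq_lab: "2 * i \<le> m \<Longrightarrow> chi m \<chi>r i = lab i"
  using m3 by (auto simp: lab_def)

lemma bij_lab: "bij_betw lab J (Irr (I2 m))"
  by (simp add: bij_betw_def inj_on_lab Irr_eq)

lemma sum_Irr: "(\<Sum>\<chi>\<in>Irr (I2 m). f \<chi>) = (\<Sum>i\<in>J. f (lab i))"
  by (rule sum.reindex_bij_betw[OF bij_lab, symmetric])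

end

section \<open>Rigidity of Springer correspondences\<close>

text \<open>The prime q does not divide G, so powers of q cancel. The diagonal of \<open>P\<close>
  consists of such powers.\<close>

lemma dvd_monom_multD:
  fixes G p :: "'a :: idom poly"
  assumes G: "poly G 0 \<noteq> 0" and "G dvd monom 1 n * p"
  shows "G dvd p"
  using assms(2)
proof (induction n arbitrary: p)
  case (Suc n)
  have "monom 1 (Suc n) * p = [:0, 1:] * (monom 1 n * p)" by (simp add: monom_Suc)
  with Suc.prems obtain h where h: "[:0, 1:] * (monom 1 n * p) = G * h" by (auto simp: dvd_def)
  then have "poly G 0 * poly h 0 = 0" by (metis poly_mult poly_pCons mult_zero_left add_0)
  then have "[:0, 1:] dvd h" using G poly_eq_0_iff_dvd[of h 0] by simp
  then obtain h' where "h = [:0, 1:] * h'" by (auto simp: dvd_def)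
  then have "[:0, 1:] * (monom 1 n * p) = [:0, 1:] * (G * h')" using h by (simp only: mult_ac)
  then have "monom 1 n * p = G * h'" by (subst (asm) mult_cancel_left) simp
  then show ?case using Suc.IH by simp
qed simp

text \<open>A block triangular system determines the coefficient vector of a combination of rows of
  \<open>\<Omega>\<close> one block at a time, so divisibility on a lower set propagates.\<close>

lemma block_triangular_dvd:
  fixes P \<Lambda> :: "'i \<Rightarrow> 'i \<Rightarrow> 'a :: idom poly" and cl :: "'i \<Rightarrow> 'c"
  assumes J: "finite J" and E: "E \<subseteq> J"
    and L: "strict_linear_order_on X L" "L \<subseteq> X \<times> X" "finite X" "cl ` J \<subseteq> X"
    and lower: "\<And>i j. i \<in> E \<Longrightarrow> j \<in> J \<Longrightarrow> (cl j, cl i) \<in> L \<or> cl j = cl i \<Longrightarrow> j \<in> E"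
    and P0: "\<And>i j. i \<in> J \<Longrightarrow> j \<in> J \<Longrightarrow> (cl i, cl j) \<in> L \<Longrightarrow> P i j = 0"
    and P1: "\<And>i j. i \<in> J \<Longrightarrow> j \<in> J \<Longrightarrow> cl i = cl j \<Longrightarrow> P i j = (if i = j then monom 1 (a (cl i)) else 0)"
    and \<Lambda>0: "\<And>i j. i \<in> J \<Longrightarrow> j \<in> J \<Longrightarrow> cl i \<noteq> cl j \<Longrightarrow> \<Lambda> i j = 0"
    and \<Omega>: "\<And>i j. i \<in> J \<Longrightarrow> j \<in> J \<Longrightarrow> \<Omega> i j = (\<Sum>k\<in>J. \<Sum>l\<in>J. P i k * \<Lambda> k l * P j l)"
    and G: "poly G 0 \<noteq> 0"
    and dvd: "\<And>x. x \<in> E \<Longrightarrow> G dvd (\<Sum>c\<in>E. t c * \<Omega> x c)"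
    and i: "i \<in> J"
  shows "G dvd (\<Sum>c\<in>E. t c * \<Omega> i c)"
    and "\<exists>w. (\<forall>k. k \<notin> E \<longrightarrow> w k = 0) \<and> (\<forall>x\<in>J. (\<Sum>c\<in>E. t c * \<Omega> x c) = (\<Sum>k\<in>J. P x k * w k))"
proof -
  \<comment> \<open>This is \<Lambda> times the transpose of \<open>P\<close> applied to t, so the
    combination of the columns of \<Omega> is \<open>P\<close> applied to w.\<close>
  define w where "w k = (\<Sum>l\<in>J. \<Sum>c\<in>E. t c * \<Lambda> k l * P c l)" for k
  have T: "(\<Sum>c\<in>E. t c * \<Omega> x c) = (\<Sum>k\<in>J. P x k * w k)" if "x \<in> J" for x
  proof -
    have "(\<Sum>c\<in>E. t c * \<Omega> x c) = (\<Sum>c\<in>E. \<Sum>k\<in>J. \<Sum>l\<in>J. P x k * (t c * \<Lambda> k l * P c l))"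
      using \<Omega>[OF that] E by (intro sum.cong refl) (auto simp: sum_distrib_left mult_ac)
    also have "\<dots> = (\<Sum>k\<in>J. \<Sum>c\<in>E. \<Sum>l\<in>J. P x k * (t c * \<Lambda> k l * P c l))"
      by (rule sum.swap)
    also have "\<dots> = (\<Sum>k\<in>J. \<Sum>l\<in>J. \<Sum>c\<in>E. P x k * (t c * \<Lambda> k l * P c l))"
      by (intro sum.cong refl sum.swap)
    finally show ?thesis unfolding w_def by (simp add: sum_distrib_left)
  qed
  have trichotomy: "(A, B) \<in> L \<or> A = B \<or> (B, A) \<in> L" if "A \<in> X" "B \<in> X" for A B
    using L(1) that by (auto simp: strict_linear_order_on_def total_on_def)
  have cX: "cl x \<in> X" if "x \<in> J" for x
    using that L(4) by (simp add: image_subset_iff)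
  \<comment> \<open>If k is outside the lower set E, so is its whole class; that class lies above
    the class of each c in E, where \<open>P c l\<close> vanishes.\<close>
  have w0: "w k = 0" if "k \<in> J" "k \<notin> E" for k
  proof -
    have "t c * \<Lambda> k l * P c l = 0" if l: "l \<in> J" and c: "c \<in> E" for l c
    proof (cases "cl k = cl l")
      case True
      then have "\<not> ((cl l, cl c) \<in> L \<or> cl l = cl c)"
        using lower[OF c \<open>k \<in> J\<close>] \<open>k \<notin> E\<close> by auto
      then have "(cl c, cl l) \<in> L" using trichotomy[OF cX cX] E l c by blast
      then show ?thesis using P0[of c l] E c l by auto
    next
      case False
      then show ?thesis using \<Lambda>0[OF \<open>k \<in> J\<close> l] by simp
    qed
    then show ?thesis unfolding w_def by (simp add: sum.neutral)
  qed
  have wf: "wf L"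
  proof (rule finite_acyclic_wf)
    show "finite L" using L finite_subset by blast
    show "acyclic L" using L(1) by (auto simp: strict_linear_order_on_def acyclic_irrefl trancl_id irrefl_def)
  qed
  \<comment> \<open>Induction upwards from the lowest class: in row k the terms from lower classes
    are already divisible, those from higher classes vanish, and the own class leaves only the
    diagonal term \<open>q^a * w k\<close>.\<close>
  have wdvd: "\<forall>k\<in>E. cl k = C \<longrightarrow> G dvd w k" for C
    using wf
  proof (induction C rule: wf_induct_rule)
    case (less C)
    show ?case
    proof (intro ballI impI)
      fix k assume k: "k \<in> E" "cl k = C"
      then have kJ: "k \<in> J" using E by auto
      have s: "(\<Sum>l\<in>J. P k l * w l) = P k k * w k + (\<Sum>l\<in>J - {k}. P k l * w l)"
        using J kJ by (simp add: sum.remove)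
      have d: "G dvd (\<Sum>l\<in>J - {k}. P k l * w l)"
      proof (rule dvd_sum)
        fix l assume l: "l \<in> J - {k}"
        consider "(cl k, cl l) \<in> L" | "cl k = cl l" | "(cl l, cl k) \<in> L"
          using trichotomy[OF cX[OF kJ] cX] l by blast
        then show "G dvd P k l * w l"
        proof cases
          case 1
          then show ?thesis using P0[OF kJ] l by simp
        next
          case 2
          then show ?thesis using P1[OF kJ] l by auto
        next
          case 3
          then have "l \<in> E" using lower[OF k(1)] l by auto
          then show ?thesis using less.IH[of "cl l"] 3 k(2) by (simp add: dvd_mult)
        qed
      qed
      have "G dvd (\<Sum>l\<in>J. P k l * w l)" using dvd[OF k(1)] T[OF kJ] by simp
      then have "G dvd P k k * w k" unfolding s by (simp only: dvd_add_left_iff[OF d])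
      then have "G dvd monom 1 (a C) * w k" using P1[OF kJ kJ] k by simp
      then show "G dvd w k" by (rule dvd_monom_multD[OF G])
    qed
  qed
  show "G dvd (\<Sum>c\<in>E. t c * \<Omega> i c)"
    unfolding T[OF i]
  proof (rule dvd_sum)
    fix k assume "k \<in> J"
    then show "G dvd P i k * w k" using wdvd w0 by (cases "k \<in> E") (auto intro: dvd_mult)
  qed
  show "\<exists>w. (\<forall>k. k \<notin> E \<longrightarrow> w k = 0) \<and> (\<forall>x\<in>J. (\<Sum>c\<in>E. t c * \<Omega> x c) = (\<Sum>k\<in>J. P x k * w k))"
  proof (intro exI[of _ "\<lambda>k. if k \<in> E then w k else 0"] conjI allI impI ballI)
    show "(if k \<in> E then w k else 0) = 0" if "k \<notin> E" for k using that by simp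
    show "(\<Sum>c\<in>E. t c * \<Omega> x c) = (\<Sum>k\<in>J. P x k * (if k \<in> E then w k else 0))" if "x \<in> J" for x
      unfolding T[OF that] by (intro sum.cong refl) (auto simp: w0)
  qed
qed

section \<open>A set of Springer representations and a correspondence realising it\<close>

locale springer_datum = dihedral m \<chi>r \<chi>r' for m \<chi>r \<chi>r' +
  fixes S :: "class_fun set" and N :: nat and d :: "nat \<Rightarrow> nat"
  assumes S_Irr: "S \<subseteq> Irr (I2 m)"
    and S_special: "{trivial_char m, chi m \<chi>r 1, sign_char m} \<subseteq> S"
    and S_label: "even m \<Longrightarrow> (\<chi>r \<in> S) \<noteq> (\<chi>r' \<in> S) \<Longrightarrow> \<chi>r' \<in> S"
    and d_start: "d 0 = 0" "d 1 = 1"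
    and d_mono: "strict_mono_on {..N} d"
    and d_bound: "2 * d N < m"
    and d_S: "{chi m \<chi>r i | i. 2 * i < m \<and> chi m \<chi>r i \<in> S} = chi m \<chi>r ` d ` {..N}"
begin

lemma d_less: "k \<le> N \<Longrightarrow> 2 * d k < m"
  using d_mono d_bound by (metis atMost_iff le_eq_less_or_eq le_trans mult_le_mono2 not_le order_refl strict_mono_onD)

lemma d_J [simp]: "k \<le> N \<Longrightarrow> d k \<in> J"
  using d_less by (simp add: J_def)

lemma planar_in_J: "2 * i < m \<Longrightarrow> i \<in> J"
  by (simp add: J_def)

lemma lab_in_S_iff:
  assumes "2 * i < m"
  shows "lab i \<in> S \<longleftrightarrow> i \<in> d ` {..N}"
proof -
  have "lab i \<in> S \<longleftrightarrow> lab i \<in> {chi m \<chi>r i | i. 2 * i < m \<and> chi m \<chi>r i \<in> S}"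
    using assms chi_eq_lab[of i] by (auto intro!: exI[of _ i])
  also have "\<dots> \<longleftrightarrow> lab i \<in> lab ` d ` {..N}"
  proof -
    have "chi m \<chi>r x = lab x" if "x \<in> d ` {..N}" for x
      using that d_less by (intro chi_eq_lab) (auto intro: less_imp_le)
    then have "chi m \<chi>r ` d ` {..N} = lab ` d ` {..N}" by (rule image_cong[OF refl])
    then show ?thesis unfolding d_S by simp
  qed
  also have "\<dots> \<longleftrightarrow> i \<in> d ` {..N}"
    by (rule inj_on_image_mem_iff[OF inj_on_lab planar_in_J[OF assms]]) auto
  finally show ?thesis .
qed

text \<open>\<open>d 1 = 1\<close> says nothing about the range of d; that 1 is within it follows
  from the membership of the character of index 1 in \<open>S\<close>.\<close>

lemma N_pos: "1 \<le> N"
proof -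
  have "chi m \<chi>r 1 = lab 1" using m3 by (intro chi_eq_lab) auto
  then have "1 \<in> d ` {..N}" using S_special lab_in_S_iff[of 1] m3 by auto
  then show ?thesis using d_start by (cases N) auto
qed

lemma d_inj: "k \<le> N \<Longrightarrow> l \<le> N \<Longrightarrow> d k < d l \<longleftrightarrow> k < l"
  using d_mono by (metis atMost_iff linorder_neqE_nat order_less_asym' order_less_irrefl strict_mono_onD)

lemma zero_S: "lab 0 \<in> S" and sign_S: "lab m \<in> S"
  using S_special by (simp_all add: lab_simps trivial_char_eq sign_char_eq)

end

locale springer = springer_datum m \<chi>r \<chi>r' S N d for m \<chi>r \<chi>r' S N d +
  fixes X :: "class_fun set set" and L :: "class_fun set rel" and a :: "class_fun set \<Rightarrow> nat"
  assumes corr: "springer_correspondence m X L a"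
    and reps: "springer_reps m X = S"
begin

definition cls :: "nat \<Rightarrow> class_fun set" where
  "cls i = supp X (lab i)"

lemma partition: "partition_on (Irr (I2 m)) X"
  using corr by (simp add: springer_correspondence_def lusztig_shoji_datum_def)

lemma supp_eqI: "C \<in> X \<Longrightarrow> \<chi> \<in> C \<Longrightarrow> supp X \<chi> = C"
  unfolding supp_def using partition by (auto simp: partition_on_def disjoint_def intro!: the_equality)

lemma supp_in: "\<chi> \<in> Irr (I2 m) \<Longrightarrow> supp X \<chi> \<in> X \<and> \<chi> \<in> supp X \<chi>"
proof -
  assume "\<chi> \<in> Irr (I2 m)"
  then obtain C where "C \<in> X" "\<chi> \<in> C" using partition by (auto simp: partition_on_def)
  then show ?thesis using supp_eqI by blast
qed

lemma cls_in: "i \<in> J \<Longrightarrow> cls i \<in> X" and lab_in_cls: "i \<in> J \<Longrightarrow> lab i \<in> cls i"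
  using supp_in Irr_eq by (auto simp: cls_def)

lemma cls_eqI: "C \<in> X \<Longrightarrow> lab i \<in> C \<Longrightarrow> cls i = C"
  by (simp add: cls_def supp_eqI)

lemma class_eq: "C \<in> X \<Longrightarrow> C = lab ` {i \<in> J. cls i = C}"
proof (intro equalityI subsetI)
  fix \<chi> assume C: "C \<in> X" "\<chi> \<in> C"
  then have "\<chi> \<in> lab ` J" using partition Irr_eq by (auto simp: partition_on_def)
  then show "\<chi> \<in> lab ` {i \<in> J. cls i = C}" using C cls_eqI by auto
qed (use lab_in_cls in auto)

lemma finite_X: "finite X"
  by (rule finite_subset[of _ "Pow (Irr (I2 m))"]) (use partition Irr_eq in \<open>auto simp: partition_on_def\<close>)

lemma order_L: "strict_linear_order_on X L" "L \<subseteq> X \<times> X"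
  and a_L: "(C, D) \<in> L \<Longrightarrow> a D \<le> a C"
  using corr by (auto simp: springer_correspondence_def lusztig_shoji_datum_def)

text \<open>\<open>a\<close> is only weakly order-reversing, so a strict inequality of values
  decides the order, while equality leaves it open.\<close>

lemma a_less_L: "C \<in> X \<Longrightarrow> D \<in> X \<Longrightarrow> a D < a C \<Longrightarrow> (C, D) \<in> L"
  using order_L(1) a_L[of D C] by (force simp: strict_linear_order_on_def total_on_def)

lemma rep_values:
  assumes i: "i \<in> J" and S: "lab i \<in> S"
  shows "a (cls i) = height i" "\<And>j. j \<in> J \<Longrightarrow> cls j = cls i \<Longrightarrow> j \<noteq> i \<Longrightarrow> height i < height j"
proof -
  obtain C where C: "C \<in> X" "springer_rep m C (lab i)" using S reps by (auto simp: springer_reps_def)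
  then have Ci: "C = cls i" using cls_eqI by (simp add: springer_rep_def)
  show less: "height i < height j" if "j \<in> J" "cls j = cls i" "j \<noteq> i" for j
  proof -
    have "lab j \<in> C - {lab i}" using that lab_in_cls[of j] Ci inj_onD[OF inj_on_lab] i by auto
    then have "b_invariant m (lab i) < b_invariant m (lab j)" using C(2) unfolding springer_rep_def by blast
    then show ?thesis using that i by (simp add: b_invariant_lab)
  qed
  have "a C = Min (b_invariant m ` C)" using corr C by (simp add: springer_correspondence_def)
  also have "b_invariant m ` C = height ` {j \<in> J. cls j = C}"
    unfolding class_eq[OF C(1), THEN arg_cong[of _ _ "(`) (b_invariant m)"]] image_image
    by (intro image_cong) (auto simp: b_invariant_lab)
  also have "Min \<dots> = height i"
    using less i Ci by (intro Min_eqI) (auto intro: less_imp_le)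
  finally show "a (cls i) = height i" by (simp add: Ci)
qed

lemma has_rep:
  assumes i: "i \<in> J"
  obtains s where "s \<in> J" "lab s \<in> S" "cls i = cls s" "height s \<le> height i"
proof -
  obtain \<chi> where \<chi>: "springer_rep m (cls i) \<chi>"
    using corr cls_in[OF i] by (auto simp: springer_correspondence_def)
  then have "\<chi> \<in> cls i" by (simp add: springer_rep_def)
  then have "\<chi> \<in> lab ` {j \<in> J. cls j = cls i}" by (simp only: class_eq[OF cls_in[OF i], symmetric])
  then obtain s where s: "s \<in> J" "\<chi> = lab s" "cls s = cls i" by blast
  have "lab s \<in> S" using \<chi> s reps cls_in[OF i] by (auto simp: springer_reps_def)
  have "height s \<le> height i"
  proof (cases "i = s")
    case False
    then show ?thesis using rep_values(2)[OF s(1) \<open>lab s \<in> S\<close> i s(3)[symmetric]] by simp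
  qed simp
  then show ?thesis using that[OF s(1) \<open>lab s \<in> S\<close> s(3)[symmetric]] by blast
qed

lemma a_le_height: "i \<in> J \<Longrightarrow> a (cls i) \<le> height i"
  by (erule has_rep) (auto simp: rep_values)

text \<open>Condition (4) allows the passage to polynomial matrices on the index set
  \<open>J\<close>, where divisibility and evaluation at complex numbers are available.\<close>

lemma polynomials:
  obtains P \<Lambda> :: "nat \<Rightarrow> nat \<Rightarrow> complex poly" where
    "\<And>i j. i \<in> J \<Longrightarrow> j \<in> J \<Longrightarrow> (cls i, cls j) \<in> L \<Longrightarrow> P i j = 0"
    "\<And>i j. i \<in> J \<Longrightarrow> j \<in> J \<Longrightarrow> cls i = cls j \<Longrightarrow> P i j = (if i = j then monom 1 (a (cls i)) else 0)"
    "\<And>i j. i \<in> J \<Longrightarrow> j \<in> J \<Longrightarrow> cls i \<noteq> cls j \<Longrightarrow> \<Lambda> i j = 0"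
    "\<And>i j. i \<in> J \<Longrightarrow> j \<in> J \<Longrightarrow> fdeg i * fdeg j + (monom 1 m - 1) * M i j =
        (\<Sum>k\<in>J. \<Sum>l\<in>J. P i k * \<Lambda> k l * P j l)"
    "\<And>i j n. i \<in> J \<Longrightarrow> j \<in> J \<Longrightarrow> coeff (P i j) n \<in> \<nat>"
proof -
  obtain P\<^sub>0 \<Lambda>\<^sub>0 where G: "green_functions m X L a P\<^sub>0 \<Lambda>\<^sub>0"
    and int: "\<forall>\<chi> \<in> Irr (I2 m). \<forall>\<chi>' \<in> Irr (I2 m). \<Lambda>\<^sub>0 \<chi> \<chi>' \<in> integer_polys \<and> P\<^sub>0 \<chi> \<chi>' \<in> nonneg_integer_polys"
    using corr unfolding springer_correspondence_def by (elim conjE exE) (rule that)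
  define P where "P i j = (SOME p. P\<^sub>0 (lab i) (lab j) = to_fract p \<and> (\<forall>n. coeff p n \<in> \<nat>))" for i j
  define \<Lambda> where "\<Lambda> i j = (SOME p. \<Lambda>\<^sub>0 (lab i) (lab j) = to_fract p)" for i j
  have lI: "lab i \<in> Irr (I2 m)" if "i \<in> J" for i using that Irr_eq by auto
  have P: "P\<^sub>0 (lab i) (lab j) = to_fract (P i j) \<and> (\<forall>n. coeff (P i j) n \<in> \<nat>)" if "i \<in> J" "j \<in> J" for i j
    unfolding P_def
    by (rule someI_ex, insert int[rule_format, OF lI[OF that(1)] lI[OF that(2)]]) (simp add: nonneg_integer_polys_def)
  have \<Lambda>: "\<Lambda>\<^sub>0 (lab i) (lab j) = to_fract (\<Lambda> i j)" if "i \<in> J" "j \<in> J" for i j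
    unfolding \<Lambda>_def
    by (rule someI_ex, insert int[rule_format, OF lI[OF that(1)] lI[OF that(2)]]) (auto simp: integer_polys_def)
  have G': "(\<Sum>\<phi>\<in>Irr (I2 m). \<Sum>\<phi>'\<in>Irr (I2 m). P\<^sub>0 (lab i) \<phi> * \<Lambda>\<^sub>0 \<phi> \<phi>' * P\<^sub>0 (lab j) \<phi>') = Omega m (lab i) (lab j)"
    "(cls i, cls j) \<in> L \<Longrightarrow> P\<^sub>0 (lab i) (lab j) = 0"
    "cls i = cls j \<Longrightarrow> P\<^sub>0 (lab i) (lab j) = (if lab i = lab j then to_fract (monom 1 (a (cls i))) else 0)"
    "cls i \<noteq> cls j \<Longrightarrow> \<Lambda>\<^sub>0 (lab i) (lab j) = 0" if "i \<in> J" "j \<in> J" for i j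
    using bspec[OF bspec[OF G[unfolded green_functions_def] lI[OF that(1)]] lI[OF that(2)]]
    unfolding cls_def by blast+
  show ?thesis
  proof (rule that)
    fix i j assume ij: "i \<in> J" "j \<in> J"
    show "P i j = 0" if "(cls i, cls j) \<in> L"
      using G'(2)[OF ij that] P[OF ij] by simp
    show "P i j = (if i = j then monom 1 (a (cls i)) else 0)" if "cls i = cls j"
      using G'(3)[OF ij that] P[OF ij] inj_on_eq_iff[OF inj_on_lab ij] by (auto split: if_splits)
    show "\<Lambda> i j = 0" if "cls i \<noteq> cls j"
      using G'(4)[OF ij that] \<Lambda>[OF ij] by simp
    show "coeff (P i j) n \<in> \<nat>" for n using P[OF ij] by blast
    have "to_fract (fdeg i * fdeg j + (monom 1 m - 1) * M i j) =
        (\<Sum>k\<in>J. \<Sum>l\<in>J. P\<^sub>0 (lab i) (lab k) * \<Lambda>\<^sub>0 (lab k) (lab l) * P\<^sub>0 (lab j) (lab l))"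
      using G'(1)[OF ij] unfolding sum_Irr Omega_lab[OF ij] by (rule sym)
    also have "\<dots> = to_fract (\<Sum>k\<in>J. \<Sum>l\<in>J. P i k * \<Lambda> k l * P j l)"
      unfolding to_fract_sum using P \<Lambda> ij by (intro sum.cong refl) simp
    finally show "fdeg i * fdeg j + (monom 1 m - 1) * M i j = (\<Sum>k\<in>J. \<Sum>l\<in>J. P i k * \<Lambda> k l * P j l)"
      by (simp only: to_fract_eq_iff)
  qed
qed

text \<open>The k-th class together with everything below it, read off from a-values: as
  \<open>a\<close> is order-reversing, this is a lower set of \<open>L\<close> whatever the order
  among classes of equal value.\<close>

definition E :: "nat \<Rightarrow> nat set" where
  "E k = {j \<in> J. d k \<le> a (cls j)}"

lemma m_J [simp]: "m \<in> J"
  by (simp add: J_def)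

lemma height_m [simp]: "height m = m"
  using m3 by (auto simp: height_def)

lemma height_le: "i \<in> J \<Longrightarrow> i \<noteq> m \<Longrightarrow> 2 * height i \<le> m"
  by (erule J_cases) (auto simp: height_def)

lemma m_in_E: "k \<le> N \<Longrightarrow> m \<in> E k"
  using rep_values(1)[OF m_J sign_S] d_less[of k] by (auto simp: E_def)

text \<open>The weight of the sign column is chosen to cancel the rank one part
  \<open>fdeg x * fdeg c\<close>. As \<open>fdeg m\<close> is \<open>q^m\<close>, the other weights
  carry a factor \<open>q^m\<close> so that all weights are polynomials.\<close>

lemma Omega_combination:
  fixes t :: "nat \<Rightarrow> complex"
  assumes k: "k \<le> N" and x: "x \<in> J"
  defines "t' \<equiv> \<lambda>c. if c = m then - (\<Sum>c\<in>E k - {m}. [:t c:] * fdeg c) else [:t c:] * monom 1 m"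
  shows "(\<Sum>c\<in>E k. t' c * (fdeg x * fdeg c + (monom 1 m - 1) * M x c)) =
    monom 1 m * ((monom 1 m - 1) * (\<Sum>c\<in>E k - {m}. [:t c:] * M x c))"
proof -
  have fin: "finite (E k)" by (simp add: E_def)
  have "(\<Sum>c\<in>E k. t' c * (fdeg x * fdeg c + (monom 1 m - 1) * M x c)) =
      t' m * (fdeg x * monom 1 m) + (\<Sum>c\<in>E k - {m}. t' c * (fdeg x * fdeg c + (monom 1 m - 1) * M x c))"
    using fin m_in_E[OF k] by (simp add: sum.remove sign_values M_def)
  also have "(\<Sum>c\<in>E k - {m}. t' c * (fdeg x * fdeg c + (monom 1 m - 1) * M x c)) =
      (\<Sum>c\<in>E k - {m}. [:t c:] * monom 1 m * (fdeg x * fdeg c + (monom 1 m - 1) * M x c))"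
    by (intro sum.cong) (auto simp: t'_def)
  also have "\<dots> = fdeg x * monom 1 m * (\<Sum>c\<in>E k - {m}. [:t c:] * fdeg c) +
      monom 1 m * ((monom 1 m - 1) * (\<Sum>c\<in>E k - {m}. [:t c:] * M x c))"
    unfolding sum_distrib_left sum.distrib[symmetric] by (intro sum.cong refl) (simp only: ring_distribs mult_ac)
  finally show ?thesis by (simp add: t'_def)
qed

lemma E_lower:
  assumes "i \<in> E k" "j \<in> J" "(cls j, cls i) \<in> L \<or> cls j = cls i"
  shows "j \<in> E k"
  using assms a_L[of "cls j" "cls i"] by (auto simp: E_def)

lemma M_closed:
  assumes k: "k \<le> N" and z: "z \<noteq> 0"
    and zero: "\<And>x. x \<in> E k - {m} \<Longrightarrow> (\<Sum>c\<in>E k - {m}. t c * poly (M x c) z) = 0"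
    and i: "i \<in> J"
  shows "(\<Sum>c\<in>E k - {m}. t c * poly (M i c) z) = 0"
proof -
  obtain P \<Lambda> :: "nat \<Rightarrow> nat \<Rightarrow> complex poly" where P:
    "\<And>i j. i \<in> J \<Longrightarrow> j \<in> J \<Longrightarrow> (cls i, cls j) \<in> L \<Longrightarrow> P i j = 0"
    "\<And>i j. i \<in> J \<Longrightarrow> j \<in> J \<Longrightarrow> cls i = cls j \<Longrightarrow> P i j = (if i = j then monom 1 (a (cls i)) else 0)"
    "\<And>i j. i \<in> J \<Longrightarrow> j \<in> J \<Longrightarrow> cls i \<noteq> cls j \<Longrightarrow> \<Lambda> i j = 0"
    "\<And>i j. i \<in> J \<Longrightarrow> j \<in> J \<Longrightarrow> fdeg i * fdeg j + (monom 1 m - 1) * M i j =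
        (\<Sum>k\<in>J. \<Sum>l\<in>J. P i k * \<Lambda> k l * P j l)"
    by (rule polynomials, rule that)
  \<comment> \<open>Every row of the combination carries the factor \<open>q^m - 1\<close>. It is
    kept in the divisor because z may be an m-th root of unity, and then divisibility by
    \<open>q - z\<close> alone would say nothing about \<open>M\<close>.\<close>
  define G where "G = (monom 1 m - 1) * [:- z, 1:]"
  define t' where "t' = (\<lambda>c. if c = m then - (\<Sum>c\<in>E k - {m}. [:t c:] * fdeg c) else [:t c:] * monom 1 m)"
  have comb: "(\<Sum>c\<in>E k. t' c * (fdeg x * fdeg c + (monom 1 m - 1) * M x c)) =
      monom 1 m * ((monom 1 m - 1) * (\<Sum>c\<in>E k - {m}. [:t c:] * M x c))" if "x \<in> J" for x
    using Omega_combination[OF k that, of t] unfolding t'_def .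
  have val: "poly (\<Sum>c\<in>E k - {m}. [:t c:] * M x c) z = (\<Sum>c\<in>E k - {m}. t c * poly (M x c) z)" for x
    by (simp add: poly_sum)
  have ne: "monom 1 m - 1 \<noteq> (0 :: complex poly)"
  proof
    assume "monom 1 m - 1 = (0 :: complex poly)"
    then have "poly (monom 1 m - 1) 0 = (0::complex)" by simp
    then show False using m3 by (simp add: poly_monom zero_power)
  qed
  have "G dvd (\<Sum>c\<in>E k. t' c * (fdeg i * fdeg c + (monom 1 m - 1) * M i c))"
  proof (rule block_triangular_dvd(1)[where P = P and \<Lambda> = \<Lambda> and cl = cls and X = X and L = L and a = a])
    show "poly G 0 \<noteq> 0"
      using z m3 by (simp add: G_def poly_monom zero_power)
    show "G dvd (\<Sum>c\<in>E k. t' c * (fdeg x * fdeg c + (monom 1 m - 1) * M x c))" if x: "x \<in> E k" for x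
    proof -
      have xJ: "x \<in> J" using x by (simp add: E_def)
      have "poly (\<Sum>c\<in>E k - {m}. [:t c:] * M x c) z = 0"
        unfolding val using zero[of x] x by (cases "x = m") (auto simp: M_def)
      then have "[:- z, 1:] dvd (\<Sum>c\<in>E k - {m}. [:t c:] * M x c)" by (simp add: poly_eq_0_iff_dvd)
      then show ?thesis unfolding comb[OF xJ] G_def by (intro dvd_mult mult_dvd_mono dvd_refl)
    qed
    show "E k \<subseteq> J" "cls ` J \<subseteq> X" by (auto simp: E_def cls_in)
  qed (use P E_lower order_L finite_X i in auto)
  then have "(monom 1 m - 1) * [:- z, 1:] dvd (monom 1 m - 1) * (monom 1 m * (\<Sum>c\<in>E k - {m}. [:t c:] * M i c))"
    unfolding comb[OF i] G_def by (simp only: mult_ac)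
  then have "[:- z, 1:] dvd monom 1 m * (\<Sum>c\<in>E k - {m}. [:t c:] * M i c)"
    using ne by (simp only: dvd_mult_cancel_left) blast
  then have "poly (monom 1 m * (\<Sum>c\<in>E k - {m}. [:t c:] * M i c)) z = 0"
    by (simp only: poly_eq_0_iff_dvd)
  then have "z ^ m * poly (\<Sum>c\<in>E k - {m}. [:t c:] * M i c) z = 0"
    by (simp only: poly_mult poly_monom mult_1)
  then show ?thesis using z by (simp only: val power_eq_0_iff mult_eq_0_iff) blast
qed

end

section \<open>Gaps in lower sets and evaluation at roots of unity\<close>

lemma exists_half_root:
  assumes "n > 0"
  obtains z :: complex where "z \<noteq> 0" "z ^ n = -1" "\<And>s. 0 < s \<Longrightarrow> s < n \<Longrightarrow> z ^ (2 * s) \<noteq> 1"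
proof (rule that)
  \<comment> \<open>A primitive 2n-th root of unity: its n-th power is -1, and no even power with
    exponent strictly between 0 and 2n is 1.\<close>
  let ?z = "unity_root (2 * n) 1"
  show "?z \<noteq> 0" by simp
  have "?z ^ n = cis pi" using assms by (simp add: unity_root_power) (simp add: unity_root_def)
  then show "?z ^ n = -1" by simp
  fix s assume s: "0 < s" "s < n"
  have "\<not> 2 * n dvd 2 * s" using s nat_dvd_not_less by simp
  then have "\<not> int (2 * n) dvd int (2 * s)" by (simp only: int_dvd_int_iff) simp
  then show "?z ^ (2 * s) \<noteq> 1" using assms by (simp only: unity_root_power) (simp add: unity_root_eq_1_iff)
qed

context dihedral
begin

lemma poly_M_planar:
  assumes "2 * x < m" "2 * c < m" "x \<le> c"
  shows "poly (M x c) z = z ^ x * (z ^ c + z ^ (m - c))" "poly (M c x) z = z ^ x * (z ^ c + z ^ (m - c))"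
  using assms by (auto simp: M_def height_def tail_def poly_monom min_def max_def doubleton_eq_iff)

lemma poly_M_half:
  assumes "even m" "y = r \<or> y = Suc r" "2 * c < m"
  shows "poly (M y c) z = z ^ (c + r)" "poly (M c y) z = z ^ (c + r)"
  using assms m3 by (auto simp: M_def height_def tail_def poly_monom min_def max_def doubleton_eq_iff power_add)

lemma poly_M_half_half:
  assumes "even m"
  shows "poly (M r r) z = z ^ (r + r)" "poly (M (Suc r) (Suc r)) z = z ^ (r + r)"
    "M r (Suc r) = 0" "M (Suc r) r = 0"
  using assms m3 by (auto simp: M_def height_def tail_def poly_monom power_add insert_commute)

end

context springer
begin

lemma M_closed_sum:
  assumes k: "k \<le> N" and z: "z \<noteq> 0" and A: "A \<subseteq> E k - {m}"
    and zero: "\<And>x. x \<in> E k - {m} \<Longrightarrow> (\<Sum>c\<in>A. poly (M x c) z) = 0"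
    and i: "i \<in> J"
  shows "(\<Sum>c\<in>A. poly (M i c) z) = 0"
proof -
  have fin: "finite (E k - {m})" by (simp add: E_def)
  have eq: "(\<Sum>c\<in>E k - {m}. (if c \<in> A then 1 else 0) * poly (M x c) z) = (\<Sum>c\<in>A. poly (M x c) z)" for x
    by (rule sum.mono_neutral_cong_right[OF fin A]) auto
  show ?thesis
    using M_closed[OF k z, of "\<lambda>c. if c \<in> A then 1 else 0", unfolded eq, OF zero i] .
qed

lemma E_cases:
  assumes "x \<in> E k - {m}"
  obtains "2 * x < m" | "even m" "x = r \<or> x = Suc r"
  using assms by (auto simp: E_def J_def split: if_splits)

lemma E_no_gap:
  assumes k: "k \<le> N" and c: "c \<in> E k" "c' \<in> E k" "c < i" "i < c'" "2 * c' < m"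
  shows "i \<in> E k"
proof (rule ccontr)
  assume i: "i \<notin> E k"
  have fin: "finite (E k)" by (simp add: E_def)
  \<comment> \<open>The nearest members of \<open>E k\<close> on either side of i, so that no row of
    \<open>E k\<close> falls strictly between p and q.\<close>
  define p where "p = Max {c \<in> E k. c < i}"
  define q where "q = Min {c \<in> E k. i < c}"
  have "p \<in> {c \<in> E k. c < i}" unfolding p_def by (rule Max_in) (use fin c in auto)
  then have p: "p \<in> E k" "p < i" by auto
  have "q \<in> {c \<in> E k. i < c}" unfolding q_def by (rule Min_in) (use fin c in auto)
  then have q: "q \<in> E k" "i < q" by auto
  have pq: "x \<le> p \<or> q \<le> x" if "x \<in> E k" for x
    using that i fin unfolding p_def q_def by (cases x i rule: linorder_cases) (auto intro: Max_ge Min_le)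
  have "q \<le> c'" using pq[OF c(2)] c p by linarith
  then have m: "2 * q < m" "2 * p < m" "2 * i < m" using c p q by linarith+
  have "0 < q - p" using p q by linarith
  then obtain z :: complex where z: "z \<noteq> 0" "z ^ (q - p) = -1" "\<And>s. 0 < s \<Longrightarrow> s < q - p \<Longrightarrow> z ^ (2 * s) \<noteq> 1"
    by (rule exists_half_root) (rule that)
  have "z ^ q = z ^ p * z ^ (q - p)" "z ^ (m - p) = z ^ (m - q) * z ^ (q - p)"
    using p q m by (simp_all flip: power_add)
  then have zq: "z ^ q = - (z ^ p)" "z ^ (m - q) = - (z ^ (m - p))" using z by simp_all
  have sum: "(\<Sum>c\<in>{p, q}. poly (M x c) z) = poly (M x p) z + poly (M x q) z" for x
    using p q by simp
  have "(\<Sum>c\<in>{p, q}. poly (M i c) z) = 0"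
  proof (rule M_closed_sum[OF k z(1)])
    show "{p, q} \<subseteq> E k - {m}" using p q m by auto
    show "i \<in> J" using m by (simp add: J_def)
    fix x assume x: "x \<in> E k - {m}"
    then show "(\<Sum>c\<in>{p, q}. poly (M x c) z) = 0"
    proof (cases rule: E_cases)
      case 1
      consider "x \<le> p" | "q \<le> x" using pq x by blast
      then show ?thesis
      proof cases
        case 1
        then show ?thesis unfolding sum using \<open>2 * x < m\<close> m p q by (simp add: poly_M_planar zq algebra_simps)
      next
        case 2
        then show ?thesis unfolding sum using \<open>2 * x < m\<close> m p q by (simp add: poly_M_planar zq algebra_simps)
      qed
    next
      case 2
      then show ?thesis unfolding sum using m by (simp add: poly_M_half power_add zq)
    qed
  qed
  \<comment> \<open>Row i lies between the columns p and q, where their sum is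
    \<open>z^p z^(m-i) - z^i z^(m-p)\<close>. Its vanishing gives \<open>z^(2(i-p)) = 1\<close>,
    against the choice of z.\<close>
  then have "z ^ p * z ^ (m - i) = z ^ i * z ^ (m - p)"
    unfolding sum using m p q by (simp add: poly_M_planar zq algebra_simps)
  moreover have "z ^ i = z ^ p * z ^ (i - p)" "z ^ (m - p) = z ^ (m - i) * z ^ (i - p)"
    using p m by (simp_all flip: power_add)
  ultimately have "z ^ (2 * (i - p)) = 1" using z(1) by (simp add: mult_2 power_add)
  then show False using z(3)[of "i - p"] p q by simp
qed

text \<open>The columns \<open>r\<close> and \<open>Suc r\<close> together behave like a planar
  column of index r: on planar rows their sum is \<open>z^x (z^r + z^(m-r))\<close>. The pair thus
  serves as the right-hand partner of the column p.\<close>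

lemma E_no_gap_half:
  assumes k: "k \<le> N" and m: "even m" and E: "r \<in> E k" "Suc r \<in> E k" and c: "c \<in> E k" "c < i" "i < r"
  shows "i \<in> E k"
proof (rule ccontr)
  assume i: "i \<notin> E k"
  have fin: "finite (E k)" by (simp add: E_def)
  define p where "p = Max {c \<in> E k. c < i}"
  have "p \<in> {c \<in> E k. c < i}" unfolding p_def by (rule Max_in) (use fin c in auto)
  then have p: "p \<in> E k" "p < i" by auto
  have le: "x \<le> p" if "x \<in> E k" "2 * x < m" for x
  proof -
    have "\<not> i < x" using E_no_gap[OF k p(1) that(1) p(2) _ that(2)] i by blast
    then have "x < i" using that i by (metis linorder_neqE_nat)
    then show ?thesis using that fin unfolding p_def by (auto intro: Max_ge)
  qed
  have rm: "r + r = m" using m by presburger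
  have lt: "2 * p < m" "2 * i < m" using c p rm by linarith+
  have "0 < r - p" using p c by linarith
  then obtain z :: complex where z: "z \<noteq> 0" "z ^ (r - p) = -1" "\<And>s. 0 < s \<Longrightarrow> s < r - p \<Longrightarrow> z ^ (2 * s) \<noteq> 1"
    by (rule exists_half_root) (rule that)
  have "z ^ r = z ^ p * z ^ (r - p)" using p c by (simp flip: power_add)
  then have zr: "z ^ r = - (z ^ p)" using z by simp
  have "m - p = r + (r - p)" using rm p c by linarith
  then have zm: "z ^ (m - p) = z ^ p" using z zr by (simp add: power_add)
  have sum: "(\<Sum>c\<in>{p, r, Suc r}. poly (M x c) z) = poly (M x p) z + (poly (M x r) z + poly (M x (Suc r)) z)" for x
    using p c by simp
  have "(\<Sum>c\<in>{p, r, Suc r}. poly (M i c) z) = 0"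
  proof (rule M_closed_sum[OF k z(1)])
    show "{p, r, Suc r} \<subseteq> E k - {m}" using p E rm m3 lt by auto
    show "i \<in> J" using lt by (simp add: J_def)
    fix x assume x: "x \<in> E k - {m}"
    then show "(\<Sum>c\<in>{p, r, Suc r}. poly (M x c) z) = 0"
    proof (cases rule: E_cases)
      case 1
      then show ?thesis unfolding sum using le[of x] x lt m
        by (simp add: poly_M_planar poly_M_half power_add zr zm algebra_simps)
    next
      case 2
      then show ?thesis unfolding sum using lt m
        by (auto simp: poly_M_half poly_M_half_half power_add zr)
    qed
  qed
  then have "z ^ p * (z ^ i + z ^ (m - i)) + 2 * (z ^ i * z ^ r) = 0"
    unfolding sum using lt m p by (simp add: poly_M_planar poly_M_half power_add)
  then have "z ^ p * z ^ (m - i) = z ^ p * z ^ i" unfolding zr by (simp add: algebra_simps)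
  then have "z ^ (m - i) = z ^ i" using z by simp
  moreover have "m - i = i + 2 * (r - i)" using rm c by linarith
  then have "z ^ (m - i) = z ^ i * z ^ (2 * (r - i))" by (simp only: power_add)
  ultimately have "z ^ (2 * (r - i)) = 1" using z(1) by simp
  then show False using z(3)[of "r - i"] p c by simp
qed

text \<open>With p the largest planar index in \<open>E k\<close> and \<open>z^(m-2p) = -1\<close>,
  the column p vanishes by itself on all rows up to p, because \<open>z^p\<close> cancels its mirror
  image \<open>z^(m-p)\<close>. On rows above p, other than the sign, it does not vanish.\<close>

lemma E_upper:
  assumes k: "k \<le> N" and E: "even m \<Longrightarrow> r \<notin> E k \<and> Suc r \<notin> E k"
    and c: "c \<in> E k" "2 * c < m" and i: "c < i" "i \<in> J" "i \<noteq> m"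
  shows "i \<in> E k"
proof (rule ccontr)
  assume ni: "i \<notin> E k"
  have fin: "finite (E k)" by (simp add: E_def)
  define p where "p = Max {c \<in> E k. 2 * c < m}"
  have "p \<in> {c \<in> E k. 2 * c < m}" unfolding p_def by (rule Max_in) (use fin c in auto)
  then have p: "p \<in> E k" "2 * p < m" by auto
  have le: "x \<le> p \<and> 2 * x < m" if "x \<in> E k - {m}" for x
    using that
  proof (cases rule: E_cases)
    case 1
    then show ?thesis using that fin unfolding p_def by (auto intro: Max_ge)
  qed (use that E in auto)
  have "\<not> i < p" using E_no_gap[OF k c(1) p(1) i(1) _ p(2)] ni by blast
  then have ip: "p < i" using p ni by (metis linorder_neqE_nat)
  have "0 < m - 2 * p" using p by linarith
  then obtain z :: complex where z: "z \<noteq> 0" "z ^ (m - 2 * p) = -1" "\<And>s. 0 < s \<Longrightarrow> s < m - 2 * p \<Longrightarrow> z ^ (2 * s) \<noteq> 1"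
    by (rule exists_half_root) (rule that)
  have "m - p = p + (m - 2 * p)" using p by linarith
  then have zm: "z ^ (m - p) = - (z ^ p)" using z by (simp only: power_add) simp
  have "(\<Sum>c\<in>{p}. poly (M i c) z) = 0"
  proof (rule M_closed_sum[OF k z(1)])
    show "{p} \<subseteq> E k - {m}" using p by auto
    fix x assume "x \<in> E k - {m}"
    then show "(\<Sum>c\<in>{p}. poly (M x c) z) = 0" using le[of x] p by (simp add: poly_M_planar zm)
  qed (rule i)
  then have 0: "poly (M i p) z = 0" by simp
  from i(2) show False
  proof (cases rule: J_cases)
    case planar
    have "z ^ i + z ^ (m - i) = 0" using 0 planar p ip z by (simp add: poly_M_planar)
    moreover have "m - i = i + (m - 2 * i)" using planar by linarith
    then have "z ^ (m - i) = z ^ i * z ^ (m - 2 * i)" by (metis power_add)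
    ultimately have "z ^ i * (1 + z ^ (m - 2 * i)) = 0" by (simp add: distrib_left)
    then have "1 + z ^ (m - 2 * i) = 0" using z by simp
    then have "z ^ (m - 2 * i) = -1" by (rule minus_unique[symmetric])
    then have "z ^ (2 * (m - 2 * i)) = 1" by (simp add: mult_2 power_add)
    moreover have "0 < m - 2 * i" "m - 2 * i < m - 2 * p" using planar ip by linarith+
    ultimately show False using z(3) by blast
  qed (use 0 p ip i z in \<open>auto simp: poly_M_half\<close>)
qed

end

section \<open>Values of a on the classes, and the role of nonnegativity\<close>

lemma poly_2_Nats:
  fixes p :: "complex poly"
  assumes "\<And>n. coeff p n \<in> \<nat>"
  shows "poly p 2 \<in> \<nat>"
proof -
  have "\<forall>n. \<exists>k. coeff p n = of_nat k" using assms by (auto elim: Nats_cases)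
  from choice[OF this] obtain c where "\<And>n. coeff p n = of_nat (c n)" by blast
  then have "poly p 2 = of_nat (\<Sum>i\<le>degree p. c i * 2 ^ i)" by (simp add: poly_altdef)
  then show ?thesis by (simp only: of_nat_in_Nats)
qed

context springer
begin

lemma height_planar: "2 * i \<le> m \<Longrightarrow> height i = i"
  by (auto simp: height_def)

lemma d_rep: "k \<le> N \<Longrightarrow> a (cls (d k)) = d k"
  using rep_values(1)[OF d_J] lab_in_S_iff[OF d_less] height_planar d_less by (simp add: less_imp_le)

lemma half_in_J: "even m \<Longrightarrow> r \<in> J" "even m \<Longrightarrow> Suc r \<in> J"
  by (auto simp: J_def)

lemma half_rep:
  assumes "even m" "j = r \<or> j = Suc r" "lab j \<in> S"
  shows "a (cls j) = r"
proof -
  have "j \<in> J" using assms half_in_J by auto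
  then show ?thesis using rep_values(1)[of j] half_values(4)[of j] assms by simp
qed

lemma sign_rep: "a (cls m) = m"
  using rep_values(1)[OF m_J sign_S] by simp

text \<open>The representative of the class of j either is j or has smaller height, while
  \<open>height j\<close> is at most m / 2. In both cases its index is below m / 2, so it is some
  \<open>d l\<close>.\<close>

lemma a_eq_d:
  assumes j: "j \<in> J" "j \<noteq> m" and half: "even m \<Longrightarrow> j = r \<or> j = Suc r \<Longrightarrow> lab j \<notin> S"
  obtains l where "l \<le> N" "a (cls j) = d l"
proof -
  obtain s where s: "s \<in> J" "lab s \<in> S" "cls j = cls s" "height s \<le> height j" using has_rep[OF j(1)] by metis
  have lt: "height s < height j" if "j \<noteq> s" using rep_values(2)[OF s(1,2) j(1) s(3)] that by simp
  have "2 * height j \<le> m" using height_le[OF j] .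
  from s(1) have "2 * s < m"
  proof (cases rule: J_cases)
    case r
    then have "j \<noteq> s" using half s(2) by auto
    then show ?thesis using lt half_values(4)[of s] r \<open>2 * height j \<le> m\<close> by auto
  next
    case r'
    then have "j \<noteq> s" using half s(2) by auto
    then show ?thesis using lt half_values(4)[of s] r' \<open>2 * height j \<le> m\<close> by auto
  next
    case sign
    then show ?thesis using s(4) \<open>2 * height j \<le> m\<close> m3 by simp
  qed (use m3 in auto)
  then obtain l where "l \<le> N" "s = d l" using lab_in_S_iff s(2) by auto
  then show ?thesis using that[of l] s(3) d_rep by simp
qed

text \<open>A height below m / 2 determines the index, so the value of \<open>a\<close> determines
  the representative and with it the class.\<close>

lemma cls_d_iff:
  assumes k: "k \<le> N" and j: "j \<in> J"
  shows "cls j = cls (d k) \<longleftrightarrow> a (cls j) = d k"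
proof
  assume a: "a (cls j) = d k"
  obtain s where s: "s \<in> J" "lab s \<in> S" "cls j = cls s" using has_rep[OF j] by metis
  then have "height s = d k" using rep_values(1) a by simp
  with s(1) have "s = d k"
    using d_less[OF k] by (cases rule: J_cases) (auto simp: height_def split: if_splits)
  then show "cls j = cls (d k)" using s by simp
qed (simp add: d_rep[OF k])

lemma E_mono: "k \<le> l \<Longrightarrow> l \<le> N \<Longrightarrow> E l \<subseteq> E k"
  using d_inj[of k l] by (cases "k = l") (auto simp: E_def)

lemma half_in_E:
  assumes "even m" "j = r \<or> j = Suc r" "lab j \<in> S" "k \<le> N"
  shows "j \<in> E k"
proof -
  have "2 * d k < m" "a (cls j) = r" using assms half_rep d_less by auto
  then show ?thesis using assms half_in_J by (auto simp: E_def)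
qed

text \<open>All of \<open>E N\<close> except the sign is one class C, on which \<open>P\<close> is
  \<open>q^(d N)\<close> times the identity; hence \<open>q^(d N) M(v,c)\<close> is the sum of
  \<open>P(v,x) M(x,c)\<close> over x in C. For c = u the left side is 0, whereas every
  \<open>M(x,u)\<close> is positive at q = 2, so nonnegativity forces each \<open>P(v,x)\<close> to
  vanish at 2. The column of \<open>d N\<close> contradicts this. The point 2 is a positive integer
  at which \<open>q^m - 1\<close> is nonzero.\<close>

lemma half_split_False:
  assumes m: "even m" and S: "lab r \<notin> S" "lab (Suc r) \<notin> S"
    and uv: "{u, v} = {r, Suc r}" and u: "u \<in> E N" and v: "v \<notin> E N"
  shows False
proof -
  define C where "C = E N - {m}"
  have finC: "finite C" by (simp add: C_def E_def)
  have u': "u = r \<or> u = Suc r" and v': "v = r \<or> v = Suc r" and "u \<noteq> v" using uv by auto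
  have uC: "u \<in> C" "u \<noteq> m" using u u' m m3 half_values(6)[OF m u'] by (auto simp: C_def)
  have dC: "d N \<in> C" using d_rep[of N] d_less[of N] by (auto simp: C_def E_def)
  have vJ: "v \<in> J" using v' half_in_J m by auto
  have CJ: "C \<subseteq> J" by (auto simp: C_def E_def)
  have clsC: "cls j = cls (d N)" if "j \<in> C" for j
  proof -
    have j: "j \<in> J" "j \<noteq> m" "d N \<le> a (cls j)" using that by (auto simp: C_def E_def)
    obtain l where "l \<le> N" "a (cls j) = d l" by (rule a_eq_d[OF j(1,2)]) (use S in auto)
    then show ?thesis using cls_d_iff[of N j] j d_inj[of l N] by (cases "l = N") auto
  qed
  obtain P \<Lambda> :: "nat \<Rightarrow> nat \<Rightarrow> complex poly" where P:
    "\<And>i j. i \<in> J \<Longrightarrow> j \<in> J \<Longrightarrow> (cls i, cls j) \<in> L \<Longrightarrow> P i j = 0"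
    "\<And>i j. i \<in> J \<Longrightarrow> j \<in> J \<Longrightarrow> cls i = cls j \<Longrightarrow> P i j = (if i = j then monom 1 (a (cls i)) else 0)"
    "\<And>i j. i \<in> J \<Longrightarrow> j \<in> J \<Longrightarrow> cls i \<noteq> cls j \<Longrightarrow> \<Lambda> i j = 0"
    "\<And>i j. i \<in> J \<Longrightarrow> j \<in> J \<Longrightarrow> fdeg i * fdeg j + (monom 1 m - 1) * M i j =
        (\<Sum>k\<in>J. \<Sum>l\<in>J. P i k * \<Lambda> k l * P j l)"
    "\<And>i j n. i \<in> J \<Longrightarrow> j \<in> J \<Longrightarrow> coeff (P i j) n \<in> \<nat>"
    by (rule polynomials, rule that)
  have main: "2 ^ d N * poly (M v c) 2 = (\<Sum>x\<in>C. poly (P v x) 2 * poly (M x c) 2)" if c: "c \<in> C" for c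
  proof -
    define t where "t = (\<lambda>x. if x = c then 1 else 0 :: complex)"
    define t' where "t' = (\<lambda>c. if c = m then - (\<Sum>c\<in>E N - {m}. [:t c:] * fdeg c) else [:t c:] * monom 1 m)"
    define T where "T x = monom 1 m * ((monom 1 m - 1) * M x c)" for x
    have comb: "(\<Sum>b\<in>E N. t' b * (fdeg x * fdeg b + (monom 1 m - 1) * M x b)) = T x" if "x \<in> J" for x
    proof -
      have "(\<Sum>b\<in>E N - {m}. [:t b:] * M x b) = (\<Sum>b\<in>C. if b = c then M x b else 0)"
        by (intro sum.cong) (auto simp: t_def C_def)
      then have "(\<Sum>b\<in>E N - {m}. [:t b:] * M x b) = M x c" using c finC by simp
      then show ?thesis using Omega_combination[OF le_refl that, of t] unfolding t'_def T_def by simp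
    qed
    \<comment> \<open>With \<open>G = 1\<close> the divisibility hypotheses are trivial; only the
      expansion of the combination through \<open>P\<close> is wanted.\<close>
    have "\<exists>w. (\<forall>k. k \<notin> E N \<longrightarrow> w k = 0) \<and>
      (\<forall>x\<in>J. (\<Sum>b\<in>E N. t' b * (fdeg x * fdeg b + (monom 1 m - 1) * M x b)) = (\<Sum>k\<in>J. P x k * w k))"
      by (rule block_triangular_dvd(2)[where G = 1 and i = m and P = P and \<Lambda> = \<Lambda> and cl = cls and X = X and L = L and a = a])
        (use P E_lower order_L finite_X m_J in \<open>auto simp: E_def cls_in\<close>)
    then obtain w where w0: "\<And>k. k \<notin> E N \<Longrightarrow> w k = 0" and wT: "\<And>x. x \<in> J \<Longrightarrow> T x = (\<Sum>k\<in>J. P x k * w k)"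
      using comb by auto
    have PC: "(\<Sum>k\<in>J. P x k * w k) = P x m * w m + (\<Sum>k\<in>C. P x k * w k)" if "x \<in> J" for x
    proof -
      have "(\<Sum>k\<in>J. P x k * w k) = (\<Sum>k\<in>E N. P x k * w k)"
        by (rule sum.mono_neutral_right) (auto simp: w0 E_def)
      also have "\<dots> = P x m * w m + (\<Sum>k\<in>C. P x k * w k)"
        unfolding C_def by (rule sum.remove) (use m_in_E[of N] in \<open>auto simp: E_def\<close>)
      finally show ?thesis .
    qed
    \<comment> \<open>In the sign row \<open>P\<close> vanishes on C and \<open>M\<close> vanishes
      altogether, so the sign coordinate of w is 0.\<close>
    have "P m k = 0" if "k \<in> C" for k
    proof -
      have kJ: "k \<in> J" using that CJ by auto
      have "a (cls k) < a (cls m)"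
        using clsC[OF that] d_rep[of N] d_less[of N] sign_rep by simp
      then show ?thesis using P(1)[OF m_J kJ] a_less_L[OF cls_in[OF m_J] cls_in[OF kJ]] by simp
    qed
    then have "(\<Sum>k\<in>C. P m k * w k) = 0" by simp
    moreover have "T m = 0" by (simp add: T_def M_def)
    ultimately have "P m m * w m = 0" using wT[OF m_J] PC[OF m_J] by simp
    then have wm: "w m = 0" using P(2)[OF m_J m_J] by simp
    have TC: "T x = monom 1 (d N) * w x" if "x \<in> C" for x
    proof -
      have xJ: "x \<in> J" using that CJ by auto
      have "T x = (\<Sum>k\<in>C. P x k * w k)" using wT[OF xJ] PC[OF xJ] wm by simp
      also have "\<dots> = (\<Sum>k\<in>C. if k = x then monom 1 (d N) * w x else 0)"
      proof (rule sum.cong)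
        fix k assume k: "k \<in> C"
        then show "P x k * w k = (if k = x then monom 1 (d N) * w x else 0)"
          using P(2)[OF xJ, of k] CJ clsC[OF k] clsC[OF that] d_rep[of N] by auto
      qed simp
      finally show ?thesis using that finC by simp
    qed
    have "monom 1 (d N) * T v = (\<Sum>x\<in>C. P v x * (monom 1 (d N) * w x))"
      using wT[OF vJ] PC[OF vJ] wm by (simp add: sum_distrib_left mult_ac)
    also have "\<dots> = (\<Sum>x\<in>C. P v x * T x)" by (intro sum.cong refl) (simp add: TC)
    finally have "poly (monom 1 (d N) * T v) 2 = poly (\<Sum>x\<in>C. P v x * T x) 2" by simp
    then have "2 ^ m * (2 ^ m - 1) * (2 ^ d N * poly (M v c) 2) =
        2 ^ m * (2 ^ m - 1) * (\<Sum>x\<in>C. poly (P v x) 2 * poly (M x c) 2)"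
      by (simp add: T_def poly_sum poly_monom sum_distrib_left mult_ac)
    moreover have "2 ^ m \<noteq> (1 :: complex)"
    proof
      assume "2 ^ m = (1 :: complex)"
      then have "norm (2 :: complex) ^ m = 1" by (metis norm_one norm_power)
      moreover have "(1 :: real) < 2 ^ m" using m3 by (intro one_less_power) auto
      ultimately show False by simp
    qed
    ultimately show ?thesis by simp
  qed
  have "poly (M v u) 2 = 0" using uv poly_M_half_half(3,4)[OF m] by (auto simp: doubleton_eq_iff)
  then have sum0: "(\<Sum>x\<in>C. poly (P v x) 2 * poly (M x u) 2) = 0" using main[OF uC(1)] by simp
  have "\<forall>x\<in>C. \<exists>k. poly (P v x) 2 = of_nat k"
  proof
    fix x assume "x \<in> C"
    then have "poly (P v x) 2 \<in> \<nat>" using CJ by (intro poly_2_Nats P(5) vJ) auto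
    then show "\<exists>k. poly (P v x) 2 = of_nat k" by (auto elim: Nats_cases)
  qed
  from bchoice[OF this] obtain p where p: "\<And>x. x \<in> C \<Longrightarrow> poly (P v x) 2 = of_nat (p x)" by blast
  have Mu: "\<exists>n>0. poly (M x u) 2 = of_nat n" if "x \<in> C" for x
  proof -
    from that have "x \<in> E N - {m}" by (simp add: C_def)
    then show ?thesis
    proof (cases rule: E_cases)
      case 1
      then show ?thesis using poly_M_half(2)[OF m u'] by (intro exI[of _ "2 ^ (x + r)"]) simp
    next
      case 2
      then have "x = u" using that v uv by (auto simp: C_def doubleton_eq_iff)
      then show ?thesis using poly_M_half_half(1,2)[OF m] u' by (intro exI[of _ "2 ^ (r + r)"]) auto
    qed
  qed
  then have "\<forall>x\<in>C. \<exists>n>0. poly (M x u) 2 = of_nat n" by blast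
  from bchoice[OF this] obtain n where n: "\<And>x. x \<in> C \<Longrightarrow> n x > 0 \<and> poly (M x u) 2 = of_nat (n x)" by blast
  have "(\<Sum>x\<in>C. poly (P v x) 2 * poly (M x u) 2) = of_nat (\<Sum>x\<in>C. p x * n x)"
    unfolding of_nat_sum by (intro sum.cong refl) (simp add: p n)
  then have "of_nat (\<Sum>x\<in>C. p x * n x) = (0 :: complex)" using sum0 by (rule trans[OF sym])
  then have "(\<Sum>x\<in>C. p x * n x) = 0" by (simp only: of_nat_eq_0_iff)
  then have "p x = 0" if "x \<in> C" for x using that n[OF that] finC by auto
  then have "poly (M v (d N)) 2 = 0" using main[OF dC] p by simp
  then show False using poly_M_half(1)[OF m v' d_bound] by simp
qed

text \<open>\<open>E_upper\<close> forces one of the two into \<open>E N\<close>, and the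
  impossibility of a split adds the other; \<open>E N\<close> lies in every
  \<open>E k\<close>.\<close>

lemma half_in_E_of_not_S:
  assumes m: "even m" and S: "lab r \<notin> S" "lab (Suc r) \<notin> S" and k: "k \<le> N"
  shows "r \<in> E k \<and> Suc r \<in> E k"
proof -
  have "r \<in> E N \<or> Suc r \<in> E N"
  proof (rule ccontr)
    assume none: "\<not> ?thesis"
    have "d N \<in> E N" using d_rep[of N] by (simp add: E_def)
    moreover have "d N < r" "r \<noteq> m" using d_bound m m3 by presburger+
    ultimately have "r \<in> E N"
      using none by (intro E_upper[OF le_refl _ _ d_bound _ half_in_J(1)[OF m]]) simp_all
    then show False using none by blast
  qed
  then have "r \<in> E N \<and> Suc r \<in> E N"
    using half_split_False[OF m S, of r "Suc r"] half_split_False[OF m S, of "Suc r" r] by auto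
  then show ?thesis using E_mono[OF k le_refl] by blast
qed

end

section \<open>Lower sets as intervals of the path, and the shape of the classes\<close>

context springer_datum
begin

definition exceptional :: bool where
  "exceptional \<longleftrightarrow> even m \<and> \<chi>r \<notin> S \<and> \<chi>r' \<in> S"

text \<open>The right end of the path. In the exceptional case \<open>\<chi>r\<close> is its last
  point: once \<open>\<chi>r'\<close> is eliminated, the kernel is \<open>q^(m-|i-j|)\<close> up to
  and including index r. Otherwise the path ends at the last planar character.\<close>

definition top :: nat where
  "top = (if exceptional then r else (m - 1) div 2)"

lemma top_bound: "2 * top \<le> m" "exceptional \<Longrightarrow> top = r" "\<not> exceptional \<Longrightarrow> 2 * top < m"
  using m3 by (auto simp: top_def)

lemma d_le_top: "k \<le> N \<Longrightarrow> d k \<le> top"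
  using d_less[of k] by (auto simp: top_def)

lemma half_S: "even m \<Longrightarrow> lab r \<in> S \<longleftrightarrow> \<chi>r \<in> S" "even m \<Longrightarrow> lab (Suc r) \<in> S \<longleftrightarrow> \<chi>r' \<in> S"
  by (simp_all add: lab_simps)

lemma regular_cases:
  assumes "\<not> exceptional"
  obtains "odd m" | "even m" "\<chi>r \<in> S" "\<chi>r' \<in> S" | "even m" "\<chi>r \<notin> S" "\<chi>r' \<notin> S"
  using assms S_label by (auto simp: exceptional_def)

lemma J_top: "i \<in> J \<Longrightarrow> i \<le> top \<or> even m \<and> (i = r \<or> i = Suc r) \<or> i = m"
  using m3 by (auto simp: J_def top_def split: if_splits)

lemma top_J: "i \<le> top \<Longrightarrow> i \<in> J"
  using m3 by (auto simp: J_def top_def exceptional_def split: if_splits)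

end

context springer
begin

text \<open>In the regular case the right end is set to the constant \<open>top\<close>, which
  \<open>E_interval\<close> shows to be correct for k <= N. Being independent of the correspondence,
  it yields uniqueness later.\<close>

definition f :: "nat \<Rightarrow> nat" where
  "f k = (if exceptional then Max (E k \<inter> {..top}) else top)"

lemma d_in_E: "k \<le> N \<Longrightarrow> d k \<in> E k"
  using d_rep[of k] by (simp add: E_def)

text \<open>The left end is \<open>d k\<close> because \<open>a\<close> never exceeds the height of
  a member. In the regular case either m is odd and \<open>E_upper\<close> applies, or both
  \<open>r\<close> and \<open>Suc r\<close> lie in \<open>E k\<close> and close the path on the
  right. In the exceptional case \<open>Suc r\<close> lies in \<open>E k\<close> but
  \<open>r\<close> need not, so the right end is free.\<close>

lemma E_interval:
  assumes k: "k \<le> N"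
  shows "E k \<inter> {..top} = {d k..f k}" and "d k \<le> f k" "f k \<le> top"
proof -
  have fin: "finite (E k \<inter> {..top})" by simp
  have dk: "d k \<in> E k \<inter> {..top}" using d_in_E[OF k] d_le_top[OF k] by simp
  have low: "d k \<le> j" if "j \<in> E k \<inter> {..top}" for j
  proof -
    have "d k \<le> a (cls j)" "j \<in> J" using that by (auto simp: E_def)
    then show ?thesis using a_le_height[of j] height_planar[of j] top_bound(1) that by auto
  qed
  have fE: "f k \<in> E k \<inter> {..top}" if exceptional
  proof -
    have "Max (E k \<inter> {..top}) \<in> E k \<inter> {..top}" using Max_in[OF fin] dk by blast
    then show ?thesis using that by (simp add: f_def)
  qed
  have "d k \<le> f k \<and> f k \<le> top \<and> E k \<inter> {..top} = {d k..f k}"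
  proof (cases exceptional)
    case True
    note fE = fE[OF True]
    have e: "even m" "lab (Suc r) \<in> S" using True half_S by (auto simp: exceptional_def)
    have "j \<in> E k" if "d k < j" "j < f k" for j
    proof (cases "f k = r")
      case True
      then show ?thesis
        using E_no_gap_half[OF k e(1) _ half_in_E[OF e(1) _ e(2) k], of "d k" j] fE dk that by auto
    next
      case False
      have "r + r = m" using e(1) by presburger
      then have "2 * f k < m" using False fE top_bound(2)[OF True] by auto
      then show ?thesis using E_no_gap[OF k _ _ that] fE dk by auto
    qed
    note between = this
    have high: "j \<le> f k" if "j \<in> E k \<inter> {..top}" for j
      using True fin that by (simp add: f_def)
    have "E k \<inter> {..top} = {d k..f k}"
    proof (intro equalityI subsetI)
      fix j assume "j \<in> {d k..f k}"
      then consider "j = d k" | "j = f k" | "d k < j" "j < f k"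
        using atLeastAtMost_iff le_less by metis
      then show "j \<in> E k \<inter> {..top}" using fE dk between[of j] by cases auto
    qed (use low high in auto)
    then show ?thesis using fE low[OF fE] by blast
  next
    case False
    have "j \<in> E k" if j: "d k < j" "j \<le> top" for j
    proof -
      have jm: "2 * j < m" using j top_bound(3)[OF False] by simp
      from False show ?thesis
      proof (cases rule: regular_cases)
        case 1
        then show ?thesis using E_upper[OF k _ d_in_E[OF k] d_less[OF k] j(1)] jm planar_in_J[OF jm] by auto
      next
        case 2
        then have "r \<in> E k" "Suc r \<in> E k" using half_in_E half_S k by auto
        then show ?thesis using E_no_gap_half[OF k 2(1) _ _ d_in_E[OF k] j(1)] jm 2(1) by auto
      next
        case 3
        then have "r \<in> E k" "Suc r \<in> E k" using half_in_E_of_not_S[OF 3(1) _ _ k] half_S by auto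
        then show ?thesis using E_no_gap_half[OF k 3(1) _ _ d_in_E[OF k] j(1)] jm 3(1) by auto
      qed
    qed
    note between = this
    have "E k \<inter> {..top} = {d k..top}"
    proof (intro equalityI subsetI)
      fix j assume "j \<in> {d k..top}"
      then consider "j = d k" | "d k < j" "j \<le> top"
        using atLeastAtMost_iff le_less by metis
      then show "j \<in> E k \<inter> {..top}" using dk between[of j] by cases auto
    qed (use low in auto)
    then show ?thesis using False d_le_top[OF k] by (simp add: f_def)
  qed
  then show "E k \<inter> {..top} = {d k..f k}" "d k \<le> f k" "f k \<le> top" by auto
qed

lemma f_decreasing: "k \<le> l \<Longrightarrow> l \<le> N \<Longrightarrow> f l \<le> f k"
proof -
  assume kl: "k \<le> l" "l \<le> N"
  have "f l \<in> {d l..f l}" using E_interval(2)[OF kl(2)] by simp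
  then have "f l \<in> E k \<inter> {..top}" using E_interval(1)[OF kl(2)] E_mono[OF kl] by auto
  then show ?thesis using E_interval(1)[of k] kl by auto
qed

text \<open>Indices off the path lie in all these lower sets, so they cancel in the differences that
  describe the classes.\<close>

lemma E_above_top:
  assumes j: "j \<in> J" "\<not> j \<le> top" and k: "k \<le> N"
  shows "j \<in> E k"
proof (cases "j = m")
  case False
  then have e: "even m" "j = r \<or> j = Suc r" using J_top[OF j(1)] j(2) by auto
  show ?thesis
  proof (cases exceptional)
    case True
    then have "j = Suc r" "lab j \<in> S" using e j(2) top_bound(2) half_S by (auto simp: exceptional_def)
    then show ?thesis using half_in_E[OF e(1) _ _ k] by auto
  next
    case False
    then show ?thesis using half_in_E[OF e _ k] half_in_E_of_not_S[OF e(1) _ _ k] half_S e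
      by (cases rule: regular_cases) auto
  qed
qed (use m_in_E[OF k] in simp)

lemma cls_d_eq:
  assumes k: "k \<le> N"
  shows "cls (d k) = lab ` {j \<in> J. a (cls j) = d k}"
proof -
  have "{j \<in> J. cls j = cls (d k)} = {j \<in> J. a (cls j) = d k}" using cls_d_iff[OF k] by auto
  then show ?thesis using class_eq[OF cls_in[OF d_J[OF k]]] by (simp only:)
qed

text \<open>By \<open>a_eq_d\<close> no value of \<open>a\<close> lies strictly between consecutive
  values of d, so the class is \<open>E k - E (Suc k)\<close>, a difference of nested intervals: one
  piece on each side.\<close>

lemma cls_middle:
  assumes k: "Suc k \<le> N"
  shows "cls (d k) = lab ` ({d k..<d (Suc k)} \<union> {f (Suc k)<..f k})"
proof -
  have k': "k \<le> N" using k by simp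
  have "{j \<in> J. a (cls j) = d k} = E k - E (Suc k)"
  proof (intro equalityI subsetI)
    fix j assume "j \<in> {j \<in> J. a (cls j) = d k}"
    then show "j \<in> E k - E (Suc k)" using d_inj[of k "Suc k"] k by (auto simp: E_def)
  next
    fix j assume "j \<in> E k - E (Suc k)"
    then have j: "j \<in> J" "d k \<le> a (cls j)" "a (cls j) < d (Suc k)" by (auto simp: E_def)
    have "j \<noteq> m" using j sign_rep d_less[OF k] by auto
    moreover have "lab j \<notin> S" if "even m" "j = r \<or> j = Suc r"
      using half_rep[OF that] j(3) d_less[OF k] that by auto
    ultimately obtain l where "l \<le> N" "a (cls j) = d l" using a_eq_d[OF j(1)] by metis
    then show "j \<in> {j \<in> J. a (cls j) = d k}"
      using j d_inj[of l "Suc k"] d_inj[of l k] k by (cases "l < k") (auto simp: less_Suc_eq)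
  qed
  also have "\<dots> = E k \<inter> {..top} - E (Suc k) \<inter> {..top}"
    using E_above_top[OF _ _ k] by (auto simp: E_def)
  also have "\<dots> = {d k..f k} - {d (Suc k)..f (Suc k)}"
    using E_interval(1)[OF k'] E_interval(1)[OF k] by simp
  also have "\<dots> = {d k..<d (Suc k)} \<union> {f (Suc k)<..f k}"
    using E_interval(2)[OF k] f_decreasing[of k "Suc k"] k d_inj[of k "Suc k"] by auto
  finally show ?thesis using cls_d_eq[OF k'] by simp
qed

lemma cls_last:
  "cls (d N) = lab ` ({d N..f N} \<union> (if even m \<and> \<chi>r \<notin> S \<and> \<chi>r' \<notin> S then {r, Suc r} else {}))"
proof -
  have "{j \<in> J. a (cls j) = d N} = {j \<in> E N. j \<noteq> m \<and> \<not> (even m \<and> (j = r \<or> j = Suc r) \<and> lab j \<in> S)}"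
  proof (intro equalityI subsetI)
    fix j assume "j \<in> {j \<in> J. a (cls j) = d N}"
    then show "j \<in> {j \<in> E N. j \<noteq> m \<and> \<not> (even m \<and> (j = r \<or> j = Suc r) \<and> lab j \<in> S)}"
      using sign_rep d_bound half_rep[of j] by (auto simp: E_def)
  next
    fix j assume j': "j \<in> {j \<in> E N. j \<noteq> m \<and> \<not> (even m \<and> (j = r \<or> j = Suc r) \<and> lab j \<in> S)}"
    then have j: "j \<in> J" "d N \<le> a (cls j)" by (auto simp: E_def)
    obtain l where "l \<le> N" "a (cls j) = d l" using a_eq_d[OF j(1)] j' by blast
    then show "j \<in> {j \<in> J. a (cls j) = d N}" using j d_inj[of l N] by (cases "l = N") auto
  qed
  also have "\<dots> = {d N..f N} \<union> (if even m \<and> \<chi>r \<notin> S \<and> \<chi>r' \<notin> S then {r, Suc r} else {})" (is "?A = ?B")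
  proof (intro equalityI subsetI)
    fix j assume j: "j \<in> ?A"
    then have jJ: "j \<in> J" by (auto simp: E_def)
    show "j \<in> ?B"
    proof (cases "j \<le> top")
      case True
      then show ?thesis using j E_interval(1)[of N] by auto
    next
      case False
      then have e: "even m" "j = r \<or> j = Suc r" "lab j \<notin> S" using J_top[OF jJ] j by auto
      then have "\<not> exceptional" using False top_bound(2) half_S by (auto simp: exceptional_def)
      then have "\<chi>r \<notin> S \<and> \<chi>r' \<notin> S" using e half_S by (cases rule: regular_cases) auto
      then show ?thesis using e by auto
    qed
  next
    have int: "{d N..f N} \<subseteq> E N \<inter> {..top}" using E_interval(1)[of N] by simp
    fix j assume "j \<in> ?B"
    then consider "j \<in> E N" "j \<le> top" | "even m" "\<chi>r \<notin> S" "\<chi>r' \<notin> S" "j = r \<or> j = Suc r"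
      using int by (cases "even m \<and> \<chi>r \<notin> S \<and> \<chi>r' \<notin> S") auto
    then show "j \<in> ?A"
    proof cases
      case 1
      have "lab j \<notin> S" if "even m" "j = r \<or> j = Suc r"
      proof (cases exceptional)
        case True
        then show ?thesis using that 1(2) top_bound(2) half_S by (auto simp: exceptional_def)
      next
        case False
        have "2 * r = m" using that by simp
        then show ?thesis using that 1(2) top_bound(3)[OF False] by linarith
      qed
      moreover have "j \<noteq> m" using 1(2) top_bound(1) m3 by auto
      ultimately show ?thesis using 1(1) by auto
    next
      case 2
      then have "j \<in> E N" using half_in_E_of_not_S[OF 2(1) _ _ le_refl] half_S by auto
      then show ?thesis using 2 half_S half_values(6)[OF 2(1,4)] by auto
    qed
  qed
  finally show ?thesis using cls_d_eq[of N] by simp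
qed

text \<open>Condition (3) enters here: the nonspecial members of the large family lie in or below
  the class of \<open>lab 1\<close>, so every index other than 0 has a positive value of
  \<open>a\<close>.\<close>

lemma cls_0: "cls 0 = {trivial_char m}"
proof -
  have pos: "0 < a (cls j)" if j: "j \<in> J" "j \<noteq> 0" for j
  proof -
    consider "j = m" | "j = 1" | "j \<noteq> m" "j \<noteq> 1" by blast
    then show ?thesis
    proof cases
      case 1
      then show ?thesis using sign_rep by simp
    next
      case 2
      then show ?thesis using d_rep[OF N_pos] d_start by simp
    next
      case 3
      have J1: "1 \<in> J" "0 \<in> J" using m3 by (auto simp: J_def)
      have sp: "special_chars m = {lab 0, lab 1, lab m}"
        using m3 by (simp add: special_chars_def lab_simps trivial_char_eq sign_char_eq two_dim_char_eq)
      have ts: "trivial_char m = lab 0" "sign_char m = lab m"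
        by (simp_all add: lab_simps trivial_char_eq sign_char_eq)
      have ne: "lab j \<noteq> lab 0" "lab j \<noteq> lab m" "lab j \<noteq> lab 1" "lab 1 \<noteq> lab 0" "lab 1 \<noteq> lab m"
        using 3 j J1 m3 by (simp_all add: inj_on_eq_iff[OF inj_on_lab])
      let ?F = "Irr (I2 m) - {trivial_char m, sign_char m}"
      have "?F \<in> families m" by (simp add: families_def)
      moreover have "lab 1 \<in> ?F \<inter> special_chars m" using ne J1 Irr_eq unfolding ts sp by auto
      moreover have "lab j \<in> ?F - special_chars m" using ne j Irr_eq unfolding ts sp by auto
      moreover have "\<forall>F\<in>families m. \<forall>\<chi>\<in>F \<inter> special_chars m. \<forall>\<chi>'\<in>F - special_chars m.
          supp X \<chi>' = supp X \<chi> \<or> (supp X \<chi>', supp X \<chi>) \<in> L"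
        using corr unfolding springer_correspondence_def by (elim conjE)
      ultimately have "cls j = cls 1 \<or> (cls j, cls 1) \<in> L"
        unfolding cls_def by (metis (no_types, lifting))
      then have "a (cls 1) \<le> a (cls j)" using a_L by auto
      then show ?thesis using d_rep[OF N_pos] d_start by simp
    qed
  qed
  have "cls 0 = lab ` {j \<in> J. a (cls j) = 0}" using cls_d_eq[of 0] d_start by simp
  also have "{j \<in> J. a (cls j) = 0} = {0}"
  proof (intro equalityI subsetI)
    fix j assume "j \<in> {j \<in> J. a (cls j) = 0}"
    then show "j \<in> {0}" using pos[of j] by (cases "j = 0") auto
  qed (use d_rep[of 0] d_start d_J[of 0] in auto)
  finally show ?thesis by (simp add: lab_simps trivial_char_eq)
qed

lemma unipotent_class_cls:
  assumes s: "s \<in> J" "lab s \<in> S"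
  shows "unipotent_class m X (lab s) (cls s)"
proof -
  obtain C where C: "C \<in> X" "springer_rep m C (lab s)" using s reps by (auto simp: springer_reps_def)
  then have "cls s = C" using cls_eqI by (simp add: springer_rep_def)
  then show ?thesis using C by (simp add: unipotent_class_def)
qed

text \<open>Any other member of the class would have height above r, which only the sign has, and
  the sign has a different value of \<open>a\<close>.\<close>

lemma cls_half:
  assumes m: "even m" and s: "s = r \<or> s = Suc r" "lab s \<in> S"
  shows "cls s = {lab s}"
proof -
  have sJ: "s \<in> J" using half_in_J m s by auto
  have "j = s" if j: "j \<in> J" "cls j = cls s" for j
  proof (rule ccontr)
    assume "j \<noteq> s"
    then have "r < height j" using rep_values(2)[OF sJ s(2) j] half_values(4)[OF m s(1)] by simp
    then have "\<not> 2 * height j \<le> m" by linarith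
    then have "j = m" using height_le[OF j(1)] by blast
    then show False using half_rep[OF m s] sign_rep j(2) m3 by auto
  qed
  then have "{j \<in> J. cls j = cls s} = {s}" using sJ by auto
  then show ?thesis using class_eq[OF cls_in[OF sJ]] by (simp only: image_insert image_empty)
qed

lemma cls_sign: "cls m = {sign_char m}"
proof -
  have "j = m" if j: "j \<in> J" "cls j = cls m" for j
    using rep_values(2)[OF m_J sign_S j] height_le[OF j(1)] by (cases "j = m") auto
  then have "{j \<in> J. cls j = cls m} = {m}" by auto
  then have "cls m = {lab m}" using class_eq[OF cls_in[OF m_J]] by (simp only: image_insert image_empty)
  then show ?thesis by (simp add: lab_simps sign_char_eq)
qed

lemma chi_image: "A \<subseteq> {..top} \<Longrightarrow> chi m \<chi>r ` A = lab ` A"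
  using top_bound(1) by (intro image_cong refl chi_eq_lab) auto

lemma shape: "has_shape m \<chi>r \<chi>r' S N d f X"
proof -
  have u: "unipotent_class m X (chi m \<chi>r (d k)) (cls (d k))" if "k \<le> N" for k
    using unipotent_class_cls[OF d_J[OF that]] lab_in_S_iff[OF d_less[OF that]] that
      chi_eq_lab[of "d k"] d_less[OF that] by auto
  have h1: "unipotent_class m X (chi m \<chi>r (d 0)) {trivial_char m}"
    using u[of 0] cls_0 d_start by simp
  have h2: "unipotent_class m X (chi m \<chi>r (d k))
      (chi m \<chi>r ` {d k..<d (Suc k)} \<union> chi m \<chi>r ` {f (Suc k)<..f k})" if k: "k < N" for k
  proof -
    have "d (Suc k) \<le> top" "f k \<le> top" using k d_le_top E_interval(3) by auto
    then have "chi m \<chi>r ` ({d k..<d (Suc k)} \<union> {f (Suc k)<..f k}) = lab ` ({d k..<d (Suc k)} \<union> {f (Suc k)<..f k})"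
      by (intro chi_image) auto
    then show ?thesis using u[of k] cls_middle[of k] k by (simp add: image_Un)
  qed
  have last: "chi m \<chi>r ` {d N..f N} = lab ` {d N..f N}"
    using E_interval(3)[of N] by (intro chi_image) auto
  have h3: "unipotent_class m X (chi m \<chi>r (d N)) (chi m \<chi>r ` {d N..(m - 1) div 2})"
    if "odd m \<or> (\<chi>r \<in> S \<and> \<chi>r' \<in> S)"
  proof -
    have "\<not> exceptional" using that by (auto simp: exceptional_def)
    then have "f N = (m - 1) div 2" by (simp add: f_def top_def)
    moreover have "cls (d N) = lab ` {d N..f N}" using that cls_last by auto
    ultimately show ?thesis using u[of N] last by simp
  qed
  have h4: "unipotent_class m X (chi m \<chi>r (d N)) (chi m \<chi>r ` {d N..f N})"
    if "even m \<and> \<chi>r \<notin> S \<and> \<chi>r' \<in> S"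
    using u[of N] last cls_last that by simp
  have h5: "unipotent_class m X (chi m \<chi>r (d N)) (chi m \<chi>r ` {d N..<m div 2} \<union> {\<chi>r, \<chi>r'})"
    if S: "even m \<and> \<chi>r \<notin> S \<and> \<chi>r' \<notin> S"
  proof -
    have "\<not> exceptional" using that by (auto simp: exceptional_def)
    then have "f N = (m - 1) div 2" by (simp add: f_def top_def)
    moreover have "even m" using S by simp
    then have A: "x \<le> (m - 1) div 2 \<longleftrightarrow> x < m div 2" for x using m3 by presburger
    have "{d N..(m - 1) div 2} = {d N..<m div 2}"
      by (simp only: set_eq_iff atLeastAtMost_iff atLeastLessThan_iff A simp_thms)
    ultimately have "cls (d N) = chi m \<chi>r ` {d N..<m div 2} \<union> {\<chi>r, \<chi>r'}"
      unfolding cls_last using S last by (simp add: image_Un lab_simps)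
    then show ?thesis using u[of N] by simp
  qed
  have h6: "unipotent_class m X \<chi>r {\<chi>r}" if "even m \<and> \<chi>r \<in> S"
    using that unipotent_class_cls[of r] cls_half[of r] half_in_J by (simp add: lab_simps)
  have h7: "unipotent_class m X \<chi>r' {\<chi>r'}" if "even m \<and> \<chi>r' \<in> S"
    using that unipotent_class_cls[of "Suc r"] cls_half[of "Suc r"] half_in_J by (simp add: lab_simps)
  have h8: "unipotent_class m X (sign_char m) {sign_char m}"
    using unipotent_class_cls[OF m_J sign_S] cls_sign by (simp add: lab_simps sign_char_eq)
  show ?thesis
    unfolding has_shape_def
    by (intro conjI allI impI; (rule h1 h3 h4 h5 h6 h7 h8 | rule h2); (assumption | simp))
qed

end

section \<open>Construction of Springer correspondences\<close>

locale springer_choice = springer_datum m \<chi>r \<chi>r' S N d for m \<chi>r \<chi>r' S N d +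
  fixes f :: "nat \<Rightarrow> nat"
  assumes f_first: "f 1 = top"
    and f_step: "\<And>k. 1 \<le> k \<Longrightarrow> k < N \<Longrightarrow> f (Suc k) \<le> f k \<and> f k - f (Suc k) \<le> d (Suc k) - d k"
    and f_last: "d N \<le> f N"
    and f_regular: "\<not> exceptional \<Longrightarrow> f N = top"
begin

text \<open>Extends f to k = 0, so that the class of the trivial character is cut off like the
  others: \<open>d\<close> rises from 0 to 1 while the right end stays at
  \<open>top\<close>.\<close>

definition F :: "nat \<Rightarrow> nat" where
  "F k = (if k = 0 then top else f k)"

lemma F_step: "k < N \<Longrightarrow> F (Suc k) \<le> F k \<and> F k - F (Suc k) \<le> d (Suc k) - d k"
  using f_step[of k] f_first by (auto simp: F_def)

text \<open>\<open>F\<close> falls no faster than \<open>d\<close> rises. The second inequality,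
  \<open>F + d\<close> weakly increasing, controls the exponents \<open>d p + F p - i\<close> of
  \<open>coef\<close>.\<close>

lemma F_diff: "k \<le> l \<Longrightarrow> l \<le> N \<Longrightarrow> F l \<le> F k \<and> F k + d k \<le> F l + d l"
proof (induction l rule: dec_induct)
  case (step n)
  then show ?case using F_step[of n] d_inj[of n "Suc n"] by auto
qed simp

lemma F_le_top: "k \<le> N \<Longrightarrow> F k \<le> top"
  using F_diff[of 0 k] by (simp add: F_def)

lemma d_le_F: "k \<le> N \<Longrightarrow> d k \<le> F k"
proof -
  assume k: "k \<le> N"
  have "d k \<le> d N" using d_inj[of k N] k by (cases "k = N") auto
  also have "\<dots> \<le> F N" using f_last N_pos by (simp add: F_def)
  also have "\<dots> \<le> F k" using F_diff[OF k] by simp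
  finally show ?thesis .
qed

lemma F_regular: "\<not> exceptional \<Longrightarrow> k \<le> N \<Longrightarrow> F k = top"
  using F_diff[of k N] f_regular N_pos F_le_top[of k] by (auto simp: F_def)

text \<open>Marks those of the two remaining linear characters that are Springer representations;
  this is not the notion of special character attached to families.\<close>

definition special :: "nat \<Rightarrow> bool" where
  "special i \<longleftrightarrow> even m \<and> (i = r \<or> i = Suc r) \<and> lab i \<in> S"

lemma special_r: "special i \<Longrightarrow> \<not> i \<le> top"
  using top_bound half_S by (auto simp: special_def exceptional_def top_def)

text \<open>The position of the class counted from the top: a larger rank is lower in the order. The
  intervals from \<open>d k\<close> to \<open>F k\<close> are nested and \<open>Max\<close> selects
  the innermost one containing i. Linear characters that are off the path and not Springer
  representations join the last class N. Ranks N + 1 and N + 2 may be empty.\<close>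

definition rank :: "nat \<Rightarrow> nat" where
  "rank i = (if i = m then N + 3 else if special i then N + 1 + (i - r)
     else if i \<le> top then Max {k. k \<le> N \<and> d k \<le> i \<and> i \<le> F k} else N)"

lemma top_less_m: "i \<le> top \<Longrightarrow> i < m"
  using top_bound(1) m3 by auto

lemma rank_plain:
  assumes "i \<le> top"
  shows "rank i = Max {k. k \<le> N \<and> d k \<le> i \<and> i \<le> F k}" "rank i \<le> N" "d (rank i) \<le> i" "i \<le> F (rank i)"
proof -
  show eq: "rank i = Max {k. k \<le> N \<and> d k \<le> i \<and> i \<le> F k}"
    using special_r[of i] top_less_m[OF assms] assms by (auto simp: rank_def)
  have "0 \<in> {k. k \<le> N \<and> d k \<le> i \<and> i \<le> F k}" using assms d_start by (simp add: F_def)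
  then have "Max {k. k \<le> N \<and> d k \<le> i \<and> i \<le> F k} \<in> {k. k \<le> N \<and> d k \<le> i \<and> i \<le> F k}"
    by (intro Max_in) auto
  then show "rank i \<le> N" "d (rank i) \<le> i" "i \<le> F (rank i)" unfolding eq by auto
qed

lemma rank_ge_iff:
  assumes "i \<le> top" "p \<le> N"
  shows "p \<le> rank i \<longleftrightarrow> d p \<le> i \<and> i \<le> F p"
proof
  assume p: "p \<le> rank i"
  then have "d p \<le> d (rank i)" using d_inj[of p "rank i"] rank_plain(2)[OF assms(1)] by (cases "p = rank i") auto
  moreover have "F (rank i) \<le> F p" using F_diff[OF p rank_plain(2)[OF assms(1)]] by simp
  ultimately show "d p \<le> i \<and> i \<le> F p" using rank_plain(3,4)[OF assms(1)] by auto
next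
  assume "d p \<le> i \<and> i \<le> F p"
  then show "p \<le> rank i" unfolding rank_plain(1)[OF assms(1)] using assms(2) by (intro Max_ge) auto
qed

lemma rank_d: "p \<le> N \<Longrightarrow> rank (d p) = p"
proof -
  assume p: "p \<le> N"
  have t: "d p \<le> top" using d_le_top p by simp
  have "p \<le> rank (d p)" using rank_ge_iff[OF t p] d_le_F[OF p] by simp
  moreover have "\<not> p < rank (d p)"
    using rank_plain(2,3)[OF t] d_inj[of p "rank (d p)"] p by auto
  ultimately show ?thesis by simp
qed

text \<open>Without a strict drop after p the point \<open>F p\<close> also lies in the next
  interval; hence the test \<open>rank (F p) = p\<close> in \<open>coef\<close>.\<close>

lemma rank_F: "p \<le> N \<Longrightarrow> p = N \<or> F (Suc p) < F p \<Longrightarrow> rank (F p) = p"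
proof -
  assume p: "p \<le> N" "p = N \<or> F (Suc p) < F p"
  have t: "F p \<le> top" using F_le_top p by simp
  have "p \<le> rank (F p)" using rank_ge_iff[OF t p(1)] d_le_F[OF p(1)] by simp
  moreover have "\<not> Suc p \<le> rank (F p)"
    using rank_ge_iff[OF t, of "Suc p"] rank_plain(2)[OF t] p by (cases "p = N") auto
  ultimately show ?thesis by simp
qed

lemma J_kinds:
  assumes "i \<in> J"
  obtains "i = m" | "special i" "i \<noteq> m" | "i \<le> top" | "even m" "i = r \<or> i = Suc r" "lab r \<notin> S" "lab (Suc r) \<notin> S" "top < r"
    "i \<noteq> m" "\<not> special i" "\<not> i \<le> top"
proof -
  consider "i = m" | "i \<le> top" | "i \<noteq> m" "\<not> i \<le> top" by blast
  then show ?thesis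
  proof cases
    case 3
    then have e: "even m" "i = r \<or> i = Suc r" using J_top[OF assms] by auto
    show ?thesis
    proof (cases "lab i \<in> S")
      case True
      then show ?thesis using that(2) e 3 by (simp add: special_def)
    next
      case False
      then have ne: "\<not> exceptional" using e 3 top_bound(2) half_S by (auto simp: exceptional_def)
      then have S: "lab r \<notin> S" "lab (Suc r) \<notin> S" using S_label e half_S False by (auto simp: exceptional_def)
      have "top < r" using top_bound(3)[OF ne] e by auto
      then show ?thesis using that(4) e S 3 False by (simp add: special_def)
    qed
  qed (use that in auto)
qed

lemma rank_sign: "rank m = N + 3"
  by (simp add: rank_def)

lemma rank_special: "special i \<Longrightarrow> i \<noteq> m \<Longrightarrow> rank i = N + 1 + (i - r)"
  by (simp add: rank_def)

lemma rank_half: "\<not> special i \<Longrightarrow> \<not> i \<le> top \<Longrightarrow> i \<noteq> m \<Longrightarrow> rank i = N"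
  by (simp add: rank_def)

lemma special_ne_m: "special i \<Longrightarrow> i \<noteq> m"
  using half_values(6) by (auto simp: special_def)

lemma special_J: "special i \<Longrightarrow> i \<in> J"
  by (auto simp: special_def J_def)

lemma rank_le: "i \<in> J \<Longrightarrow> rank i \<le> N + 3"
  by (erule J_kinds) (auto simp: rank_sign rank_special rank_half special_def dest: rank_plain(2))

definition aval :: "nat \<Rightarrow> nat" where
  "aval p = (if p = N + 3 then m else if N < p then r else d p)"

definition rep :: "nat \<Rightarrow> nat" where
  "rep i = (if rank i \<le> N then d (rank i) else i)"

lemma rep:
  assumes i: "i \<in> J"
  shows "rep i \<in> J" "rank (rep i) = rank i" "lab (rep i) \<in> S" "height (rep i) = aval (rank i)"
proof -
  have "rep i \<in> J \<and> rank (rep i) = rank i \<and> lab (rep i) \<in> S \<and> height (rep i) = aval (rank i)"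
  proof (cases "rank i \<le> N")
    case True
    have "2 * d (rank i) < m" using d_less True by simp
    then show ?thesis
      using True rank_d lab_in_S_iff[of "d (rank i)"] by (auto simp: rep_def aval_def height_def)
  next
    case False
    from i show ?thesis
    proof (cases rule: J_kinds)
      case 1
      then show ?thesis using sign_S i m3 by (auto simp: rep_def rank_sign aval_def height_def)
    next
      case 2
      then show ?thesis using i half_values(4)[of i] by (auto simp: rep_def rank_special aval_def special_def)
    qed (use False rank_plain(2) rank_half in auto)
  qed
  then show "rep i \<in> J" "rank (rep i) = rank i" "lab (rep i) \<in> S" "height (rep i) = aval (rank i)" by auto
qed

lemma rep_less:
  assumes i: "i \<in> J" and j: "j \<in> J" "rank j = rank i" "j \<noteq> rep i"
  shows "height (rep i) < height j"
proof (cases "rank i \<le> N")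
  case True
  have h: "height (rep i) = d (rank i)" "rep i = d (rank i)" using rep(4)[OF i] True by (auto simp: aval_def rep_def)
  from j(1) show ?thesis
  proof (cases rule: J_kinds)
    case 3
    then have "height j = j" using top_bound(1) by (auto simp: height_def)
    then show ?thesis using rank_plain(3)[OF 3] j h by auto
  next
    case 4
    then show ?thesis using h True half_values(4)[of j] d_less[of "rank i"] by auto
  qed (use True j rank_sign rank_special in auto)
next
  case False
  then have ri: "rep i = i" by (simp add: rep_def)
  have "j = i"
    using i
  proof (cases rule: J_kinds)
    case 1
    from j(1) show ?thesis
      by (cases rule: J_kinds) (use 1 j(2) rank_sign rank_special[of j] rank_half[of j] rank_plain(2)[of j] in \<open>auto simp: special_def\<close>)
  next
    case 2
    from j(1) show ?thesis
      by (cases rule: J_kinds) (use 2 j(2) rank_sign rank_special[of j] rank_special[of i] rank_half[of j] rank_plain(2)[of j] in \<open>auto simp: special_def\<close>)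
  qed (use False rank_plain(2) rank_half in auto)
  then show ?thesis using j ri by simp
qed

lemma aval_mono: "i \<in> J \<Longrightarrow> j \<in> J \<Longrightarrow> rank i \<le> rank j \<Longrightarrow> aval (rank i) \<le> aval (rank j)"
proof -
  assume i: "i \<in> J" and j: "j \<in> J" and le: "rank i \<le> rank j"
  have "rank j \<le> N + 3" using rank_le j by simp
  moreover have "d (rank i) \<le> d (rank j)" if "rank j \<le> N"
    using that le d_inj[of "rank i" "rank j"] by (cases "rank i = rank j") auto
  moreover have "d (rank i) \<le> r" if "rank i \<le> N" using d_less[OF that] by simp
  ultimately show ?thesis using le unfolding aval_def by auto
qed

section \<open>The partition, the order and the datum\<close>

definition kls :: "nat \<Rightarrow> class_fun set" where
  "kls i = lab ` {j \<in> J. rank j = rank i}"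

definition X :: "class_fun set set" where
  "X = kls ` J"

definition L :: "class_fun set rel" where
  "L = {(kls i, kls j) | i j. i \<in> J \<and> j \<in> J \<and> rank j < rank i}"

definition a :: "class_fun set \<Rightarrow> nat" where
  "a C = Min (b_invariant m ` C)"

lemma lab_in_kls: "i \<in> J \<Longrightarrow> j \<in> J \<Longrightarrow> lab i \<in> kls j \<longleftrightarrow> rank i = rank j"
  using inj_onD[OF inj_on_lab] by (auto simp: kls_def)

lemma kls_eq_iff: "i \<in> J \<Longrightarrow> j \<in> J \<Longrightarrow> kls i = kls j \<longleftrightarrow> rank i = rank j"
  using lab_in_kls[of i j] lab_in_kls[of i i] by (auto simp: kls_def)

lemma L_iff: "i \<in> J \<Longrightarrow> j \<in> J \<Longrightarrow> (kls i, kls j) \<in> L \<longleftrightarrow> rank j < rank i"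
  unfolding L_def using kls_eq_iff by force

lemma a_kls:
  assumes i: "i \<in> J"
  shows "a (kls i) = aval (rank i)"
proof -
  have "b_invariant m ` kls i = height ` {j \<in> J. rank j = rank i}"
    unfolding kls_def image_image by (intro image_cong) (auto simp: b_invariant_lab)
  moreover have "Min (height ` {j \<in> J. rank j = rank i}) = aval (rank i)"
  proof (rule Min_eqI)
    fix y assume "y \<in> height ` {j \<in> J. rank j = rank i}"
    then obtain j where j: "j \<in> J" "rank j = rank i" "y = height j" by auto
    then show "aval (rank i) \<le> y" using rep_less[OF i j(1,2)] rep(4)[OF i] by (cases "j = rep i") auto
  qed (use rep[OF i] in \<open>auto intro!: image_eqI[of _ _ "rep i"]\<close>)
  ultimately show ?thesis by (simp add: a_def)
qed

lemma springer_rep_kls: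
  assumes i: "i \<in> J"
  shows "springer_rep m (kls i) (lab (rep i))"
  unfolding springer_rep_def
proof (intro conjI ballI)
  show "lab (rep i) \<in> kls i" using lab_in_kls[OF rep(1)[OF i] i] rep(2)[OF i] by simp
  fix \<chi> assume "\<chi> \<in> kls i - {lab (rep i)}"
  then obtain j where "j \<in> J" "rank j = rank i" "\<chi> = lab j" "j \<noteq> rep i" by (auto simp: kls_def)
  then show "b_invariant m (lab (rep i)) < b_invariant m \<chi>"
    using rep_less[OF i] rep(1)[OF i] by (simp add: b_invariant_lab)
qed

lemma partition: "partition_on (Irr (I2 m)) X"
proof (rule partition_onI)
  show "\<Union> X = Irr (I2 m)" unfolding Irr_eq X_def by (auto simp: kls_def)
  fix C D assume "C \<in> X" "D \<in> X" "C \<noteq> D"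
  then obtain i j where ij: "i \<in> J" "j \<in> J" "C = kls i" "D = kls j" by (auto simp: X_def)
  then have "rank i \<noteq> rank j" using kls_eq_iff \<open>C \<noteq> D\<close> by auto
  moreover have "rank i = rank j" if \<chi>: "\<chi> \<in> C" "\<chi> \<in> D" for \<chi>
  proof -
    obtain x where "x \<in> J" "\<chi> = lab x" using \<chi> ij by (auto simp: kls_def)
    then show ?thesis using lab_in_kls ij \<chi> by metis
  qed
  ultimately show "disjnt C D" by (auto simp: disjnt_def)
next
  show "{} \<notin> X" by (auto simp: X_def kls_def)
qed

lemma supp_lab: "i \<in> J \<Longrightarrow> supp X (lab i) = kls i"
proof -
  assume i: "i \<in> J"
  have in_iff: "kls i \<in> X" "lab i \<in> kls i" using i lab_in_kls by (auto simp: X_def)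
  show ?thesis unfolding supp_def
    using in_iff partition by (intro the_equality) (auto simp: partition_on_def disjoint_def)
qed

lemma datum: "lusztig_shoji_datum m X L a"
  unfolding lusztig_shoji_datum_def
proof (intro conjI)
  show "partition_on (Irr (I2 m)) X" by (rule partition)
  show "L \<subseteq> X \<times> X" by (auto simp: L_def X_def)
  have "trans L"
  proof (rule transI)
    fix A B C assume "(A, B) \<in> L" "(B, C) \<in> L"
    then obtain i j j' k where "i \<in> J" "j \<in> J" "j' \<in> J" "k \<in> J" "A = kls i" "B = kls j" "B = kls j'" "C = kls k"
      "rank j < rank i" "rank k < rank j'" by (auto simp: L_def)
    then show "(A, C) \<in> L" using kls_eq_iff[of j j'] L_iff[of i k] by auto
  qed
  moreover have "irrefl L" using L_iff by (fastforce simp: irrefl_def L_def)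
  moreover have "total_on X L"
  proof (rule total_onI)
    fix A B assume "A \<in> X" "B \<in> X" "A \<noteq> B"
    then obtain i j where ij: "i \<in> J" "j \<in> J" "A = kls i" "B = kls j" by (auto simp: X_def)
    then show "(A, B) \<in> L \<or> (B, A) \<in> L" using L_iff[of i j] L_iff[of j i] kls_eq_iff[of i j] \<open>A \<noteq> B\<close> by auto
  qed
  ultimately show "strict_linear_order_on X L" by (simp add: strict_linear_order_on_def)
  show "\<forall>(C, C')\<in>L. a C' \<le> a C" using a_kls aval_mono by (auto simp: L_def)
qed

end

text \<open>Made for a row of \<open>P\<close>, which has at most one nonzero entry in each class:
  the sum over all indices becomes a sum over classes.\<close>

lemma sum_by_rank:
  assumes J: "finite J" and rk: "\<And>k. k \<in> J \<Longrightarrow> rk k \<le> (Q :: nat)"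
    and u: "\<And>k. k \<in> J \<Longrightarrow> u k = (if k = \<pi> (rk k) then c (rk k) else (0 :: 'a :: comm_ring_1))"
    and \<pi>: "\<And>p. p \<le> Q \<Longrightarrow> c p \<noteq> 0 \<Longrightarrow> \<pi> p \<in> J \<and> rk (\<pi> p) = p"
  shows "(\<Sum>k\<in>J. u k * g k) = (\<Sum>p\<le>Q. c p * g (\<pi> p))"
proof -
  have "(\<Sum>k\<in>J. u k * g k) = (\<Sum>p\<le>Q. \<Sum>k\<in>{k \<in> J. rk k = p}. u k * g k)"
    by (rule sum.group[symmetric]) (use J rk in auto)
  also have "\<dots> = (\<Sum>p\<le>Q. c p * g (\<pi> p))"
  proof (rule sum.cong)
    fix p assume p: "p \<in> {..Q}"
    have "(\<Sum>k\<in>{k \<in> J. rk k = p}. u k * g k) = (\<Sum>k\<in>{k \<in> J. rk k = p}. if k = \<pi> p then c p * g (\<pi> p) else 0)"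
      using u by (intro sum.cong) auto
    also have "\<dots> = (if \<pi> p \<in> {k \<in> J. rk k = p} then c p * g (\<pi> p) else 0)"
      using J by (subst sum.delta) auto
    also have "\<dots> = c p * g (\<pi> p)" using \<pi>[of p] p by (cases "c p = 0") auto
    finally show "(\<Sum>k\<in>{k \<in> J. rk k = p}. u k * g k) = c p * g (\<pi> p)" .
  qed simp
  finally show ?thesis .
qed

section \<open>Explicit Green functions\<close>

context springer_choice
begin

definition sp :: "nat \<Rightarrow> nat" where
  "sp p = (if p = N + 1 then r else Suc r)"

definition proj :: "nat \<Rightarrow> nat \<Rightarrow> nat" where
  "proj p i = (if p = N + 3 then m else if N < p then sp p
     else if rank i = p then i else if i < d p then d p else F p)"

text \<open>This is \<open>q^a * K(i,e) / K(e,e)\<close> with e = \<open>proj p i\<close> and K the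
  kernel at that stage; on the path it is \<open>q\<close> to the power \<open>d p\<close> minus the
  distance from i to e. If \<open>F p\<close> is not of rank p, the right part of the class is empty
  and the entry there is 0.\<close>

definition coef :: "nat \<Rightarrow> nat \<Rightarrow> complex poly" where
  "coef p i = (if p = N + 3 then fdeg i
     else if N < p then
       (if special (sp p) then (if i = sp p then monom 1 r else if 2 * i < m then monom 1 i else 0) else 0)
     else if rank i = p then monom 1 (d p)
     else if rank i < p \<and> i < d p then monom 1 i
     else if rank i < p \<and> rank (F p) = p then monom 1 (d p + F p - i) else 0)"

text \<open>Negative exponents are truncated to 0; \<open>poly_block\<close> checks that the
  exponents occurring inside a class are nonnegative.\<close>

definition mono :: "int \<Rightarrow> complex poly" where
  "mono n = monom 1 (nat n)"

text \<open>The coefficient of \<open>q^(i+j)\<close> that survives on the path: 1 in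
  \<open>M\<close>, reduced by 1 for each eliminated linear character. It is 0 in the exceptional
  case.\<close>

definition sgn_tail :: int where
  "sgn_tail = 1 - (if special r then 1 else 0) - (if special (Suc r) then 1 else 0)"

text \<open>The kernel \<open>before p\<close> divided by \<open>q^(2 d p)\<close>, which undoes the
  diagonal entries \<open>q^(d p)\<close> of \<open>P\<close> on both sides; therefore
  \<open>w\<close> stands in place of m.\<close>

definition block :: "nat \<Rightarrow> nat \<Rightarrow> nat \<Rightarrow> complex poly" where
  "block p i j = (let w = int m - 2 * int (d p) in
     if p < N then
       if i < d (Suc p) \<and> j < d (Suc p) then
         mono (w - \<bar>int i - int j\<bar>) - mono (w + int i + int j - 2 * int (d (Suc p)))
       else if F (Suc p) < i \<and> F (Suc p) < j then
         mono (w - \<bar>int i - int j\<bar>) - mono (w + 2 * int (F (Suc p)) - int i - int j)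
       else 0
     else if i \<le> top \<and> j \<le> top then
       mono (w - \<bar>int i - int j\<bar>) + of_int sgn_tail * mono (int i + int j - 2 * int (d p))
     else if i = j then mono w
     else if i \<le> top \<or> j \<le> top then mono (int (min i j) + int r - 2 * int (d p)) else 0)"

definition \<Lambda> :: "nat \<Rightarrow> nat \<Rightarrow> complex poly" where
  "\<Lambda> i j = (if rank i \<noteq> rank j then 0 else if rank i = N + 3 then 1
     else if N < rank i then monom 1 m - 1 else (monom 1 m - 1) * block (rank i) i j)"

definition P :: "nat \<Rightarrow> nat \<Rightarrow> complex poly" where
  "P i j = (if j = proj (rank j) i then coef (rank j) i else 0)"

text \<open>The kernels \<open>before p\<close> and \<open>after p\<close>, as functions of \<open>q = z\<close>, are \<open>\<Omega>\<close> divided by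
  \<open>q\<^sup>m - 1\<close> before and after the elimination of the class number \<open>p\<close>.\<close>

definition after :: "complex \<Rightarrow> nat \<Rightarrow> nat \<Rightarrow> nat \<Rightarrow> complex" where
  "after z p i j =
     (if i < d p \<and> j < d p then
        z powi (int m - \<bar>int i - int j\<bar>) - z powi (int m + int i + int j - 2 * int (d p))
      else if F p < i \<and> F p < j \<and> i \<le> top \<and> j \<le> top then
        z powi (int m - \<bar>int i - int j\<bar>) - z powi (int m + 2 * int (F p) - int i - int j)
      else 0)"

definition before :: "complex \<Rightarrow> nat \<Rightarrow> nat \<Rightarrow> nat \<Rightarrow> complex" where
  "before z p i j =
     (if p < N then after z (Suc p) i j
      else if special i \<or> special j then 0
      else if i \<le> top \<and> j \<le> top then
        z powi (int m - \<bar>int i - int j\<bar>) + of_int sgn_tail * z powi (int i + int j)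
      else if i = j then z powi (int m)
      else if i \<le> top \<or> j \<le> top then z powi (int (min i j) + int r) else 0)"

lemma after_commute: "after z p i j = after z p j i"
  by (auto simp: after_def abs_minus_commute add_ac algebra_simps)

lemma before_commute: "before z p i j = before z p j i"
  by (auto simp: before_def after_commute[of z "Suc p" i j] abs_minus_commute add_ac min.commute)

lemma poly_mono: "0 \<le> n \<Longrightarrow> z \<noteq> 0 \<Longrightarrow> poly (mono n) z = z powi n"
  by (simp add: mono_def poly_monom power_int_def)

text \<open>The five positions relative to class p: inside the next interval, in the left or right
  part of the class, and to the left or right of the p-th interval.\<close>

lemma rank_plain_cases:
  assumes i: "i \<le> top" and p: "p < N"
  obtains "p < rank i" "d (Suc p) \<le> i" "i \<le> F (Suc p)" | "rank i = p" "d p \<le> i" "i < d (Suc p)"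
    | "rank i = p" "F (Suc p) < i" "i \<le> F p" | "rank i < p" "i < d p" | "rank i < p" "F p < i"
proof -
  have 1: "p \<le> rank i \<longleftrightarrow> d p \<le> i \<and> i \<le> F p" and 2: "Suc p \<le> rank i \<longleftrightarrow> d (Suc p) \<le> i \<and> i \<le> F (Suc p)"
    using rank_ge_iff[OF i] p by auto
  show ?thesis
  proof (cases "rank i" p rule: linorder_cases)
    case less
    then have "i < d p \<or> F p < i" using 1 by linarith
    then show ?thesis using that(4,5) less by blast
  next
    case equal
    then have "d p \<le> i" "i \<le> F p" "i < d (Suc p) \<or> F (Suc p) < i" using 1 2 by linarith+
    then show ?thesis using that(2,3) equal by blast
  next
    case greater
    then have "d (Suc p) \<le> i" "i \<le> F (Suc p)" using 2 by linarith+
    then show ?thesis using that(1) greater by blast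
  qed
qed

lemma poly_block:
  assumes x: "x \<in> J" "rank x = p" and y: "y \<in> J" "rank y = p" and p: "p \<le> N" and z: "z \<noteq> 0"
  shows "poly (block p x y) z * z ^ d p * z ^ d p = before z p x y"
proof -
  let ?w = "int m - 2 * int (d p)"
  have zd: "z ^ d p * z ^ d p = z powi (2 * int (d p))" 
  proof -
    have "2 * int (d p) = int (d p + d p)" by simp
    then show ?thesis by (simp only: power_int_of_nat power_add)
  qed
  have shift: "poly (mono n) z * (z ^ d p * z ^ d p) = z powi (n + 2 * int (d p))" if "0 \<le> n" for n
    unfolding zd using that z by (simp add: poly_mono power_int_add)
  have "\<not> special i \<and> i \<noteq> m" if "rank i = p" for i
    using rank_special[of i] special_ne_m[of i] rank_sign p that by (cases "i = m") auto
  then have nsp: "\<not> special x" "\<not> special y" "x \<noteq> m" "y \<noteq> m" using x y by auto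
  show ?thesis
  proof (cases "p < N")
    case True
    have xt: "x \<le> top" "y \<le> top" using x y True nsp rank_half[of x] rank_half[of y] by auto
    have range: "d p \<le> x" "x \<le> F p" "d p \<le> y" "y \<le> F p"
      using rank_plain(3,4)[OF xt(1)] rank_plain(3,4)[OF xt(2)] x y by auto
    have step: "F (Suc p) \<le> F p" "F p - F (Suc p) \<le> d (Suc p) - d p" "d p < d (Suc p)" "2 * d (Suc p) < m"
      "d (Suc p) \<le> F (Suc p)"
      using F_step[OF True] d_inj[of p "Suc p"] d_less[of "Suc p"] d_le_F[of "Suc p"] True by auto
    consider "x < d (Suc p)" "y < d (Suc p)" | "F (Suc p) < x" "F (Suc p) < y"
      | "\<not> (x < d (Suc p) \<and> y < d (Suc p))" "\<not> (F (Suc p) < x \<and> F (Suc p) < y)" by blast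
    then show ?thesis
    proof cases
      case 1
      have "0 \<le> ?w - \<bar>int x - int y\<bar>" "0 \<le> ?w + int x + int y - 2 * int (d (Suc p))"
        using 1 step range by linarith+
      note s = shift[OF this(1)] shift[OF this(2)]
      have "poly (block p x y) z * z ^ d p * z ^ d p =
          poly (mono (?w - \<bar>int x - int y\<bar>)) z * (z ^ d p * z ^ d p) -
          poly (mono (?w + int x + int y - 2 * int (d (Suc p)))) z * (z ^ d p * z ^ d p)"
        using 1 True by (simp add: block_def Let_def algebra_simps)
      then show ?thesis unfolding s using 1 True by (simp add: before_def after_def algebra_simps)
    next
      case 2
      \<comment> \<open>The bound on the drop of \<open>F\<close> is used here: x and y are at most
        \<open>F p\<close>, so the second exponent is at least \<open>m - 2 * d (Suc p)\<close>,
        which is positive.\<close>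
      have "0 \<le> ?w - \<bar>int x - int y\<bar>" "0 \<le> ?w + 2 * int (F (Suc p)) - int x - int y"
        using 2 step range by linarith+
      note s = shift[OF this(1)] shift[OF this(2)]
      have "poly (block p x y) z * z ^ d p * z ^ d p =
          poly (mono (?w - \<bar>int x - int y\<bar>)) z * (z ^ d p * z ^ d p) -
          poly (mono (?w + 2 * int (F (Suc p)) - int x - int y)) z * (z ^ d p * z ^ d p)"
        using 2 True step by (simp add: block_def Let_def algebra_simps)
      then show ?thesis unfolding s using 2 True xt step by (simp add: before_def after_def algebra_simps)
    next
      case 3
      then show ?thesis using True by (auto simp: before_def after_def block_def)
    qed
  next
    case False
    then have pN: "p = N" using p by simp
    have dt: "2 * d p < m" "2 * top \<le> m" "d p \<le> r" using d_less[OF p] top_bound by auto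
    consider "x \<le> top" "y \<le> top" | "x = y" "\<not> x \<le> top" | "x \<noteq> y" "x \<le> top" "\<not> y \<le> top"
      | "x \<noteq> y" "\<not> x \<le> top" "y \<le> top" | "x \<noteq> y" "\<not> x \<le> top" "\<not> y \<le> top" by blast
    then show ?thesis
    proof cases
      case 1
      have range: "d p \<le> x" "d p \<le> y" using rank_plain(3)[OF 1(1)] rank_plain(3)[OF 1(2)] x y by auto
      have "0 \<le> ?w - \<bar>int x - int y\<bar>" "0 \<le> int x + int y - 2 * int (d p)"
        using 1 dt range by linarith+
      note s = shift[OF this(1)] shift[OF this(2)]
      have "poly (block p x y) z * z ^ d p * z ^ d p =
          poly (mono (?w - \<bar>int x - int y\<bar>)) z * (z ^ d p * z ^ d p) +
          of_int sgn_tail * (poly (mono (int x + int y - 2 * int (d p))) z * (z ^ d p * z ^ d p))"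
        using 1 False by (simp add: block_def Let_def algebra_simps of_int_poly)
      then show ?thesis unfolding s using 1 False nsp by (simp add: before_def)
    next
      case 2
      have "0 \<le> ?w" using dt by linarith
      note s = shift[OF this]
      show ?thesis using 2 False nsp s by (simp add: before_def block_def Let_def mult.assoc)
    next
      case 3
      have "d p \<le> x" using rank_plain(3)[OF 3(2)] x by simp
      then have "0 \<le> int (min x y) + int r - 2 * int (d p)" using 3 dt by auto
      note s = shift[OF this]
      show ?thesis using 3 False nsp s by (simp add: before_def block_def Let_def mult.assoc)
    next
      case 4
      have "d p \<le> y" using rank_plain(3)[OF 4(3)] y by simp
      then have "0 \<le> int (min x y) + int r - 2 * int (d p)" using 4 dt by auto
      note s = shift[OF this]
      show ?thesis using 4 False nsp s by (simp add: before_def block_def Let_def mult.assoc)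
    next
      case 5
      then show ?thesis using False nsp by (simp add: before_def block_def Let_def)
    qed
  qed
qed

lemma not_plain:
  assumes "i \<in> J" "i \<noteq> m" "\<not> i \<le> top"
  shows "even m" "i = r \<or> i = Suc r" "p \<le> N \<Longrightarrow> d p < i" "N \<le> rank i"
proof -
  show e: "even m" "i = r \<or> i = Suc r" using J_top[OF assms(1)] assms by auto
  show "d p < i" if "p \<le> N" using d_less[OF that] e by auto
  show "N \<le> rank i"
    using rank_special[of i] special_ne_m[of i] rank_half[of i] assms by (cases "special i") auto
qed

lemma after_not_plain:
  assumes "i \<in> J" "i \<noteq> m" "\<not> i \<le> top" "p \<le> N"
  shows "after z p i j = 0"
  using not_plain(3)[OF assms] assms(3) by (auto simp: after_def)

text \<open>A Schur complement on each side of the interval already eliminated. With e the end of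
  class p on that side, \<open>K(x,y) - K(x,e) K(e,y) / K(e,e)\<close> exchanges the term measured
  through the inner end for the one measured through e; with an argument inside the class nothing is
  left.\<close>

lemma step_before_last:
  assumes x: "x \<in> J" "x \<noteq> m" and y: "y \<in> J" "y \<noteq> m" and le: "x \<le> y" and p: "p < N" and z: "z \<noteq> 0"
  shows "poly (coef p x) z * poly (coef p y) z * before z p (proj p x) (proj p y) =
    (before z p x y - after z p x y) * (z ^ d p * z ^ d p)"
proof -
  note Z = power_int_add[OF disjI1[OF z], symmetric] power_int_of_nat[symmetric]
  have Zl: "z powi a * (z powi b * w) = z powi (a + b) * w" for a b w
    using z by (simp add: power_int_add)
  have step: "F (Suc p) \<le> F p" "d p < d (Suc p)" "d (Suc p) \<le> F (Suc p)" "d p \<le> F p" "F p \<le> top"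
    using F_step[OF p] d_inj[of p "Suc p"] d_le_F[of "Suc p"] d_le_F[of p] F_le_top[of p] p by auto
  have AL: "after z k i j = z powi (int m - \<bar>int i - int j\<bar>) - z powi (int m + int i + int j - 2 * int (d k))"
    if "i < d k" "j < d k" for i j k
    using that by (simp add: after_def)
  have AR: "after z k i j = z powi (int m - \<bar>int i - int j\<bar>) - z powi (int m + 2 * int (F k) - int i - int j)"
    if "k \<le> N" "F k < i" "F k < j" "i \<le> top" "j \<le> top" for i j k
    using that d_le_F[of k] by (simp add: after_def)
  have A0: "after z k i j = 0" if "\<not> (i < d k \<and> j < d k)" "\<not> (F k < i \<and> F k < j)" for i j k
    using that by (auto simp: after_def)
  have bound: "i \<le> d p + F p" if "i \<le> top" for i
    using F_diff[of 0 p] p that d_start by (simp add: F_def)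
  show ?thesis
  proof (cases "x \<le> top \<and> y \<le> top")
    case False
    then consider "\<not> x \<le> top" | "\<not> y \<le> top" by blast
    then have "poly (coef p x) z = 0 \<or> poly (coef p y) z = 0"
      using not_plain(4)[OF x] not_plain(4)[OF y] p by cases (auto simp: coef_def)
    moreover have "after z (Suc p) x y = 0" "after z p x y = 0"
      using False after_not_plain[OF x, of "Suc p" z y] after_not_plain[OF x, of p z y]
        after_not_plain[OF y, of "Suc p" z x] after_not_plain[OF y, of p z x] p
      by (auto simp: after_commute[of z _ x y])
    ultimately show ?thesis using p by (auto simp: before_def)
  next
    case True
    have plain: "x \<le> top" "y \<le> top" using True by auto
    have L: "coef p i = monom 1 (min i (d p)) \<and> proj p i = max i (d p)" if "i \<le> top" "i < d (Suc p)" for i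
      using that(1) p
      by (cases rule: rank_plain_cases) (use that step p in \<open>auto simp: coef_def proj_def min_def max_def\<close>)
    have O: "coef p i = 0 \<and> after z (Suc p) i j = 0 \<and> after z p i j = 0"
      if "i \<le> top" "d (Suc p) \<le> i" "i \<le> F (Suc p)" for i j
      using that(1) p
      by (cases rule: rank_plain_cases) (use that step p in \<open>auto simp: coef_def after_def\<close>)
    \<comment> \<open>If \<open>F\<close> does not drop at p, the right part of the class is empty
      and the kernel on that side must stay as it is.\<close>
    have R0: "coef p i = 0" if "i \<le> top" "F (Suc p) < i" "F p = F (Suc p)" for i
    proof -
      have rk: "rank (F p) \<noteq> p"
        using rank_ge_iff[of "F p" "Suc p"] that step p by auto
      from that(1) p show ?thesis
        by (cases rule: rank_plain_cases) (use rk that step p in \<open>auto simp: coef_def\<close>)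
    qed
    have R: "coef p i = monom 1 (d p + F p - max i (F p)) \<and> proj p i = min i (F p)"
      if "i \<le> top" "F (Suc p) < i" "F (Suc p) < F p" for i
    proof -
      have rk: "rank (F p) = p" using rank_F[of p] that p by simp
      from that(1) p show ?thesis
        by (cases rule: rank_plain_cases) (use rk that step p in \<open>auto simp: coef_def proj_def min_def max_def\<close>)
    qed
    consider "d (Suc p) \<le> x" "x \<le> F (Suc p)" | "d (Suc p) \<le> y" "y \<le> F (Suc p)"
      | "x < d (Suc p)" "y < d (Suc p)" | "x < d (Suc p)" "F (Suc p) < y" | "F (Suc p) < x" "F (Suc p) < y"
      using le step by linarith
    then show ?thesis
    proof cases
      case 1
      then show ?thesis using O[OF plain(1)] p by (simp add: before_def)
    next
      case 2
      then show ?thesis using O[OF plain(2)] p by (simp add: before_def after_commute[of z _ x y])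
    next
      case 3
      note Lx = L[OF plain(1) 3(1)] and Ly = L[OF plain(2) 3(2)]
      have bxy: "before z p x y = z powi (int m - (int y - int x)) - z powi (int m + int x + int y - 2 * int (d (Suc p)))"
        using AL[OF 3] le p by (simp add: before_def)
      consider "d p \<le> x" "d p \<le> y" | "x < d p" "d p \<le> y" | "x < d p" "y < d p" using le by linarith
      then show ?thesis
      proof cases
        case 1
        have "after z p x y = 0" using 1 3 step by (intro A0) auto
        then show ?thesis using Lx Ly 1 by (simp add: poly_monom max_def min_def)
      next
        case 2
        have a: "after z p x y = 0" using 2 3 step by (intro A0) auto
        have b: "before z p (d p) y = z powi (int m - (int y - int (d p))) - z powi (int m + int (d p) + int y - 2 * int (d (Suc p)))"
          using AL[OF step(2) 3(2)] 2 p by (simp add: before_def)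
        have c: "poly (coef p x) z = z ^ x" "poly (coef p y) z = z ^ d p" "proj p x = d p" "proj p y = y"
          using Lx Ly 2 by (simp_all add: poly_monom)
        show ?thesis unfolding a b bxy c by (simp add: Z Zl algebra_simps del: power_int_of_nat)
      next
        case bothlow: 3
        have a: "after z p x y = z powi (int m - (int y - int x)) - z powi (int m + int x + int y - 2 * int (d p))"
          using AL[OF bothlow] le by simp
        have b: "before z p (d p) (d p) = z powi int m - z powi (int m + int (d p) + int (d p) - 2 * int (d (Suc p)))"
          using AL[OF step(2) step(2)] p by (simp add: before_def)
        have c: "poly (coef p x) z = z ^ x" "poly (coef p y) z = z ^ y" "proj p x = d p" "proj p y = d p"
          using Lx Ly bothlow by (simp_all add: poly_monom)
        show ?thesis unfolding a b bxy c by (simp add: Z Zl algebra_simps del: power_int_of_nat)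
      qed
    next
      \<comment> \<open>Here x and y are on different sides of the eliminated interval, where both
        kernels vanish; the projections remain on their sides.\<close>
      case 4
      have "after z (Suc p) x y = 0" "after z p x y = 0" using 4 step by (auto simp: after_def)
      moreover have "poly (coef p y) z = 0 \<or> after z (Suc p) (proj p x) (proj p y) = 0"
      proof (cases "F (Suc p) < F p")
        case True
        have "proj p x < d (Suc p)" "F (Suc p) < proj p y"
          using L[OF plain(1) 4(1)] R[OF plain(2) 4(2) True] 4 True step by auto
        then show ?thesis using step by (auto simp: after_def)
      next
        case False
        then show ?thesis using R0[OF plain(2) 4(2)] step by auto
      qed
      ultimately show ?thesis using p by (auto simp: before_def)
    next
      case 5
      show ?thesis
      proof (cases "F (Suc p) < F p")
        case False
        then show ?thesis using R0[OF plain(2) 5(2)] step 5 p by (auto simp: before_def after_def)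
      next
        case True
        note R = R[OF plain(1) 5(1) True] R[OF plain(2) 5(2) True]
        have bxy: "before z p x y = z powi (int m - (int y - int x)) - z powi (int m + 2 * int (F (Suc p)) - int x - int y)"
          using AR[OF _ 5 plain] le p by (simp add: before_def)
        consider "x \<le> F p" "y \<le> F p" | "x \<le> F p" "F p < y" | "F p < x" "F p < y" using le by linarith
        then show ?thesis
        proof cases
          case 1
          have "after z p x y = 0" using 1 5 step by (intro A0) auto
          then show ?thesis using R 1 by (simp add: poly_monom max_def min_def)
        next
          case 2
          have a: "after z p x y = 0" using 2 5 step by (intro A0) auto
          have b: "before z p x (F p) = z powi (int m - (int (F p) - int x)) - z powi (int m + 2 * int (F (Suc p)) - int x - int (F p))"
            using AR[OF _ 5(1) True plain(1) step(5)] 2 p by (simp add: before_def)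
          have "int (d p + F p - y) = int (d p) + int (F p) - int y" using bound[OF plain(2)] by simp
          then have c: "poly (coef p x) z = z ^ d p" "poly (coef p y) z = z powi (int (d p) + int (F p) - int y)"
            "proj p x = x" "proj p y = F p"
            using R 2 by (simp_all add: poly_monom flip: power_int_of_nat)
          show ?thesis unfolding a b bxy c by (simp add: Z Zl algebra_simps del: power_int_of_nat)
        next
          case 3
          have a: "after z p x y = z powi (int m - (int y - int x)) - z powi (int m + 2 * int (F p) - int x - int y)"
            using AR[OF _ 3 plain] le p by simp
          have b: "before z p (F p) (F p) = z powi int m - z powi (int m + 2 * int (F (Suc p)) - int (F p) - int (F p))"
            using AR[OF _ True True step(5) step(5)] p by (simp add: before_def)
          have "int (d p + F p - y) = int (d p) + int (F p) - int y"
            "int (d p + F p - x) = int (d p) + int (F p) - int x" using bound plain by simp_all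
          then have c: "poly (coef p x) z = z powi (int (d p) + int (F p) - int x)"
            "poly (coef p y) z = z powi (int (d p) + int (F p) - int y)" "proj p x = F p" "proj p y = F p"
            using R 3 by (simp_all add: poly_monom flip: power_int_of_nat)
          show ?thesis unfolding a b bxy c by (simp add: Z Zl algebra_simps del: power_int_of_nat)
        qed
      qed
    qed
  qed
qed

end

text \<open>The kernels \<open>before\<close> and \<open>after\<close> are built from integer powers
  of z, so identities are tested only at nonzero z.\<close>

lemma poly_eqI_nonzero:
  fixes p q :: "complex poly"
  assumes "\<And>z. z \<noteq> 0 \<Longrightarrow> poly p z = poly q z"
  shows "p = q"
proof -
  have "poly ([:0, 1:] * p) z = poly ([:0, 1:] * q) z" for z
    using assms[of z] by (cases "z = 0") auto
  then have "poly ([:0, 1:] * p) = poly ([:0, 1:] * q)" by (rule ext)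
  then have "[:0, 1:] * p = [:0, 1:] * q" by (simp only: poly_eq_poly_eq_iff)
  then show ?thesis by (subst (asm) mult_cancel_left) simp
qed

context springer_choice
begin

lemma half_kind:
  assumes "i \<in> J" "i \<noteq> m" "\<not> special i" "\<not> i \<le> top"
  shows "even m" "i = r \<or> i = Suc r" "\<not> special r" "\<not> special (Suc r)" "top < r" "F N = top" "rank i = N"
proof -
  from assms(1) have *: "even m \<and> (i = r \<or> i = Suc r) \<and> lab r \<notin> S \<and> lab (Suc r) \<notin> S \<and> top < r"
    by (cases rule: J_kinds) (use assms in auto)
  then have "\<not> exceptional" using half_S by (auto simp: exceptional_def)
  then show "F N = top" using F_regular by simp
  show "even m" "i = r \<or> i = Suc r" "\<not> special r" "\<not> special (Suc r)" "top < r" "rank i = N"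
    using * rank_half[OF assms(3,4,2)] by (auto simp: special_def)
qed

lemma special_zero:
  assumes "special i" "p \<le> N"
  shows "coef p i = 0" "before z N i j = 0" "after z p i j = 0"
  using assms rank_special[of i] special_ne_m[of i] special_J[of i] special_r[of i]
    after_not_plain[of i p z j]
  by (auto simp: coef_def before_def)

lemma before_plain:
  "i \<le> top \<Longrightarrow> j \<le> top \<Longrightarrow> before z N i j =
    z powi (int m - \<bar>int i - int j\<bar>) + of_int sgn_tail * z powi (int i + int j)"
  using special_r by (auto simp: before_def)

text \<open>At the innermost class the kernel on the path is \<open>q^(m-|i-j|) + s q^(i+j)\<close>
  with s = \<open>sgn_tail\<close>. Moving the smaller index from e to i multiplies both terms by
  \<open>q^(i-e)\<close>, so the left end works for every s; moving the larger index scales them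
  differently, so the right end requires s = 0.\<close>

lemma step_last:
  assumes x: "x \<in> J" "x \<noteq> m" and y: "y \<in> J" "y \<noteq> m" and le: "x \<le> y" and z: "z \<noteq> 0"
  shows "poly (coef N x) z * poly (coef N y) z * before z N (proj N x) (proj N y) =
    (before z N x y - after z N x y) * (z ^ d N * z ^ d N)"
proof -
  note Z = power_int_add[OF disjI1[OF z], symmetric] power_int_of_nat[symmetric]
  have Zl: "z powi a * (z powi b * w) = z powi (a + b) * w" for a b w
    using z by (simp add: power_int_add)
  have dF: "d N \<le> F N" "F N \<le> top" "rank (F N) = N" using d_le_F F_le_top rank_F by auto
  have low: "coef N i = monom 1 i \<and> proj N i = d N" if "i < d N" for i
  proof -
    have "i \<le> top" using that dF by simp
    then have "rank i < N" using rank_ge_iff[of i N] that by auto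
    then show ?thesis using that by (simp add: coef_def proj_def)
  qed
  have mid: "coef N i = monom 1 (d N) \<and> proj N i = i" if "d N \<le> i" "i \<le> F N" for i
  proof -
    have "i \<le> top" using that dF by simp
    then have "rank i = N" using rank_ge_iff[of i N] rank_plain(2)[of i] that by auto
    then show ?thesis by (simp add: coef_def proj_def)
  qed
  have high: "poly (coef N i) z = z powi (int (d N) + int (F N) - int i) \<and> proj N i = F N" if "F N < i" "i \<le> top" for i
  proof -
    have "rank i < N" using rank_ge_iff[of i N] that by auto
    moreover have "int (d N + F N - i) = int (d N) + int (F N) - int i"
      using F_diff[of 0 N] d_start that by (simp add: F_def)
    ultimately show ?thesis using that dF
      by (simp add: coef_def proj_def poly_monom flip: power_int_of_nat)
  qed
  consider "special x" | "special y" | "\<not> special x" "\<not> special y" by blast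
  then show ?thesis
  proof cases
    case 1
    then show ?thesis using special_zero[OF 1 le_refl] by simp
  next
    case 2
    then show ?thesis using special_zero[OF 2 le_refl] before_commute[of z N x y] after_commute[of z N x y] by simp
  next
    case nsp: 3
    consider "x \<le> top" "y \<le> top" | "\<not> y \<le> top" using le by linarith
    then show ?thesis
    proof cases
      case plain: 1
      have ab: "\<bar>int x - int y\<bar> = int y - int x" using le by simp
      note B = before_plain[OF plain, of z, unfolded ab]
      \<comment> \<open>A point of the path beyond \<open>F N\<close> exists only in the exceptional
        case, where exactly one of the two linear characters is eliminated.\<close>
      have s0: "sgn_tail = 0" if "F N < y"
      proof -
        have "exceptional" using F_regular that plain by force
        then have "even m" "lab r \<notin> S" "lab (Suc r) \<in> S" using half_S by (auto simp: exceptional_def)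
        then show ?thesis by (simp add: sgn_tail_def special_def)
      qed
      consider "y < d N" | "x < d N" "d N \<le> y" "y \<le> F N" | "x < d N" "F N < y" | "d N \<le> x" "y \<le> F N"
        | "d N \<le> x" "x \<le> F N" "F N < y" | "F N < x" using le dF by linarith
      then show ?thesis
      proof cases
        case 1
        then have a: "after z N x y = z powi (int m - (int y - int x)) - z powi (int m + int x + int y - 2 * int (d N))"
          using le ab by (simp add: after_def)
        have c: "poly (coef N x) z = z ^ x" "poly (coef N y) z = z ^ y" "proj N x = d N" "proj N y = d N"
          using low[of x] low[of y] 1 le by (auto simp: poly_monom)
        have b: "before z N (d N) (d N) = z powi int m + of_int sgn_tail * z powi (int (d N) + int (d N))"
          using before_plain[of "d N" "d N" z] dF by simp
        show ?thesis unfolding a b B c by (simp add: Z Zl algebra_simps del: power_int_of_nat)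
      next
        case 2
        then have a: "after z N x y = 0" by (simp add: after_def)
        have c: "poly (coef N x) z = z ^ x" "poly (coef N y) z = z ^ d N" "proj N x = d N" "proj N y = y"
          using low[of x] mid[of y] 2 by (auto simp: poly_monom)
        have b: "before z N (d N) y = z powi (int m - (int y - int (d N))) + of_int sgn_tail * z powi (int (d N) + int y)"
          using before_plain[of "d N" y z] dF 2 by simp
        show ?thesis unfolding a b B c by (simp add: Z Zl algebra_simps del: power_int_of_nat)
      next
        case 3
        then have a: "after z N x y = 0" using dF by (simp add: after_def)
        have c: "poly (coef N x) z = z ^ x" "poly (coef N y) z = z powi (int (d N) + int (F N) - int y)"
          "proj N x = d N" "proj N y = F N"
          using low[of x] high[of y] 3 plain by (auto simp: poly_monom)
        have b: "before z N (d N) (F N) = z powi (int m - (int (F N) - int (d N)))"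
          using before_plain[of "d N" "F N" z] dF s0 3 by simp
        show ?thesis unfolding a b B c using s0 3 by (simp add: Z Zl algebra_simps del: power_int_of_nat)
      next
        case 4
        then have a: "after z N x y = 0" by (simp add: after_def)
        show ?thesis using mid[of x] mid[of y] 4 le by (simp add: a poly_monom)
      next
        case 5
        then have a: "after z N x y = 0" by (simp add: after_def)
        have c: "poly (coef N x) z = z ^ d N" "poly (coef N y) z = z powi (int (d N) + int (F N) - int y)"
          "proj N x = x" "proj N y = F N"
          using mid[of x] high[of y] 5 plain by (auto simp: poly_monom)
        have b: "before z N x (F N) = z powi (int m - (int (F N) - int x))"
          using before_plain[of x "F N" z] dF s0 5 plain by simp
        show ?thesis unfolding a b B c using s0 5 by (simp add: Z Zl algebra_simps del: power_int_of_nat)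
      next
        case 6
        then have a: "after z N x y = z powi (int m - (int y - int x)) - z powi (int m + 2 * int (F N) - int x - int y)"
          using le ab dF plain by (simp add: after_def)
        have c: "poly (coef N x) z = z powi (int (d N) + int (F N) - int x)"
          "poly (coef N y) z = z powi (int (d N) + int (F N) - int y)" "proj N x = F N" "proj N y = F N"
          using high[of x] high[of y] 6 le plain by auto
        have b: "before z N (F N) (F N) = z powi int m"
          using before_plain[of "F N" "F N" z] dF s0 6 le by simp
        show ?thesis unfolding a b B c using s0 6 le by (simp add: Z Zl algebra_simps del: power_int_of_nat)
      qed
    next
      case yh: 2
      note H = half_kind[OF y nsp(2) yh]
      have cy: "poly (coef N y) z = z ^ d N" "proj N y = y" using H(7) by (simp_all add: coef_def proj_def poly_monom)
      have a: "after z N x y = 0" using after_not_plain[OF y yh le_refl, of z x] after_commute by metis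
      show ?thesis
      proof (cases "x \<le> top")
        case True
        then have "x < y" using yh by simp
        have b: "before z N i y = z powi (int i + int r)" if "i \<le> top" for i
          using that yh nsp special_r[of i] by (auto simp: before_def min_def)
        consider "x < d N" | "d N \<le> x" by linarith
        then show ?thesis
        proof cases
          case 1
          have cx: "poly (coef N x) z = z ^ x" "proj N x = d N" using low[OF 1] by (auto simp: poly_monom)
          have "d N \<le> top" using dF by simp
          show ?thesis unfolding a cx cy b[OF True] b[OF \<open>d N \<le> top\<close>]
            by (simp add: Z Zl algebra_simps del: power_int_of_nat)
        next
          case 2
          have "poly (coef N x) z = z ^ d N" "proj N x = x" using mid[of x] 2 True H(6) by (auto simp: poly_monom)
          then show ?thesis by (simp add: a cy)
        qed
      next
        case False
        have "rank x = N" using half_kind(7)[OF x nsp(1) False] .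
        then have "poly (coef N x) z = z ^ d N" "proj N x = x" by (simp_all add: coef_def proj_def poly_monom)
        then show ?thesis by (simp add: a cy)
      qed
    qed
  qed
qed

lemma coef_special:
  assumes "p = N + 1 \<or> p = N + 2"
  shows "poly (coef p x) z = (if special (sp p) then (if x = sp p then z ^ r else if 2 * x < m then z ^ x else 0) else 0)"
proof -
  have "p \<noteq> N + 3" "N < p" using assms by auto
  then have "coef p x = (if special (sp p) then (if x = sp p then monom 1 r else if 2 * x < m then monom 1 x else 0) else 0)"
    unfolding coef_def by (simp only: if_False if_True)
  then show ?thesis by (simp only: if_distrib[of "\<lambda>p. poly p z"] poly_monom mult_1 poly_0)
qed

text \<open>Elimination of the remaining linear Springer representations: each contributes the rank
  one matrix \<open>q^i q^j\<close> below m / 2, and subtracting it from the tail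
  \<open>q^(i+j)\<close> leaves the coefficient \<open>sgn_tail\<close>.\<close>

lemma M_decomposition:
  assumes x: "x \<in> J" "x \<noteq> m" and y: "y \<in> J" "y \<noteq> m" and le: "x \<le> y" and z: "z \<noteq> 0"
  shows "poly (M x y) z = before z N x y + poly (coef (N + 1) x) z * poly (coef (N + 1) y) z
    + poly (coef (N + 2) x) z * poly (coef (N + 2) y) z"
proof -
  have sp: "sp (N + 1) = r" "sp (N + 2) = Suc r" by (auto simp: sp_def)
  note c = coef_special[of "N + 1", unfolded sp, OF disjI1[OF refl]]
    coef_special[of "N + 2", unfolded sp, OF disjI2[OF refl]]
  have kind: "2 * i < m \<or> even m \<and> (i = r \<or> i = Suc r)" if "i \<in> J" "i \<noteq> m" for i
    using that by (auto simp: J_def split: if_splits)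
  have plain: "i \<le> top" if "2 * i < m" for i using that by (auto simp: top_def)
  consider "2 * y < m" | "even m" "y = r \<or> y = Suc r" "2 * x < m" | "even m" "x = r \<or> x = Suc r" "y = r \<or> y = Suc r"
    using kind[OF x] kind[OF y] le by auto
  then show ?thesis
  proof cases
    case 1
    then have x2: "2 * x < m" using le by simp
    have "before z N x y = z powi (int m - (int y - int x)) + of_int sgn_tail * (z ^ x * z ^ y)"
      using before_plain[OF plain[OF x2] plain[OF 1], of z] le z by (simp add: power_int_add)
    moreover have "int m - (int y - int x) = int (m - y + x)" using 1 by simp
    then have "z powi (int m - (int y - int x)) = z ^ (m - y) * z ^ x" by (simp only: power_int_of_nat power_add)
    moreover have "x \<noteq> r \<or> odd m" "y \<noteq> r \<or> odd m" "x \<noteq> Suc r \<or> odd m" "y \<noteq> Suc r \<or> odd m" using 1 x2 by auto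
    then have "special r \<Longrightarrow> x \<noteq> r \<and> y \<noteq> r" "special (Suc r) \<Longrightarrow> x \<noteq> Suc r \<and> y \<noteq> Suc r" by (auto simp: special_def)
    ultimately show ?thesis
      unfolding c poly_M_planar(1)[OF x2 1 le] using 1 x2
      by (cases "special r"; cases "special (Suc r)"; simp add: sgn_tail_def algebra_simps)
  next
    case 2
    have rm: "r + r = m" using 2(1) by presburger
    have xr: "x \<noteq> r" "x \<noteq> Suc r" "\<not> 2 * y < m" using 2 rm by auto
    have M: "poly (M x y) z = z ^ (x + r)" using poly_M_half(2)[OF 2] .
    consider "special y" | "\<not> special y" "y \<le> top" | "\<not> special y" "\<not> y \<le> top" by blast
    then show ?thesis
    proof cases
      case 1
      then have "before z N x y = 0" by (simp add: before_def)
      then show ?thesis unfolding M c using 1 2 xr by (auto simp: power_add)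
    next
      \<comment> \<open>A remaining linear character on the path has index r, and this occurs only
        in the exceptional case.\<close>
      case 3: 2
      then have "top = r" "y = r" using 2 top_bound rm by auto
      then have ex: exceptional using top_bound(3) rm by fastforce
      then have s: "special (Suc r)" "\<not> special r" using half_S by (auto simp: special_def exceptional_def)
      then have "before z N x y = z powi (int m - (int r - int x))"
        using before_plain[of x y z] 3 plain[OF 2(3)] \<open>y = r\<close> 2(3) by (simp add: sgn_tail_def)
      also have "int m - (int r - int x) = int (x + r)" using rm 2(3) by linarith
      finally have B: "before z N x y = z powi int (x + r)" .
      show ?thesis unfolding M c B power_int_of_nat using s \<open>y = r\<close> rm by simp
    next
      case 4: 3
      note H = half_kind[OF y 4]
      have "before z N x y = z powi (int x + int r)"
        using 4 plain[OF 2(3)] special_r[of x] le by (auto simp: before_def min_def)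
      also have "int x + int r = int (x + r)" by simp
      finally show ?thesis unfolding M c using H(3,4) by (simp only: power_int_of_nat if_False) simp
    qed
  next
    case 3
    have rm: "r + r = m" using 3(1) by presburger
    have nl: "\<not> 2 * r < m" "\<not> 2 * Suc r < m" using rm by auto
    have Zm: "z powi int m = z ^ r * z ^ r" by (simp add: power_add[symmetric] rm)
    show ?thesis
    proof (cases "x = y")
      case True
      have M: "poly (M x y) z = z ^ (r + r)" using 3 True poly_M_half_half(1,2)[OF 3(1)] by auto
      consider "special y" | "\<not> special y" "y \<le> top" | "\<not> special y" "\<not> y \<le> top" by blast
      then show ?thesis
      proof cases
        case 1
        then have "before z N x y = 0" by (simp add: before_def)
        then show ?thesis unfolding M c using 1 3 True nl by (auto simp: power_add)
      next
        case 2
        then have "top = r" "y = r" using 3 top_bound rm by auto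
        then have ex: exceptional using top_bound(3) rm by fastforce
        then have s: "special (Suc r)" "\<not> special r" using half_S by (auto simp: special_def exceptional_def)
        have "before z N x y = z powi int m"
          using before_plain[of x y z] 2 True s by (simp add: sgn_tail_def)
        then show ?thesis unfolding M c Zm using s \<open>y = r\<close> nl by (simp add: power_add)
      next
        case h: 3
        note H = half_kind[OF y h]
        have "before z N x y = z powi int m" using h True by (simp add: before_def)
        then show ?thesis unfolding M c Zm using H(3,4) by (simp add: power_add)
      qed
    next
      case False
      then have xy: "x = r" "y = Suc r" using 3 le by auto
      have "before z N r (Suc r) = 0"
      proof (cases "special r \<or> special (Suc r)")
        case False
        have "\<not> Suc r \<le> top" using top_bound(1) rm by simp
        then have "\<not> r \<le> top" using half_kind(5)[OF y(1,2)] False xy by auto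
        then show ?thesis using \<open>\<not> Suc r \<le> top\<close> by (simp add: before_def)
      qed (auto simp: before_def)
      then show ?thesis unfolding c xy using poly_M_half_half(3)[OF 3(1)] nl by simp
    qed
  qed
qed

end

section \<open>The matrix equation, integrality and divisibility\<close>

definition int_coeffs :: "complex poly \<Rightarrow> bool" where
  "int_coeffs p \<longleftrightarrow> (\<forall>n. coeff p n \<in> \<int>)"

lemma int_coeffs_intros [intro]:
  "int_coeffs 0" "int_coeffs 1" "int_coeffs (monom 1 n)" "int_coeffs (of_int k)"
  "int_coeffs p \<Longrightarrow> int_coeffs q \<Longrightarrow> int_coeffs (p + q)"
  "int_coeffs p \<Longrightarrow> int_coeffs q \<Longrightarrow> int_coeffs (p - q)"
  "int_coeffs p \<Longrightarrow> int_coeffs q \<Longrightarrow> int_coeffs (p * q)"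
  by (auto simp: int_coeffs_def coeff_mult of_int_poly coeff_pCons split: nat.splits)

context springer_choice
begin

lemma proj_rank:
  assumes x: "x \<in> J" and p: "p \<le> N + 3" and c: "coef p x \<noteq> 0"
  shows "proj p x \<in> J \<and> rank (proj p x) = p"
proof -
  consider "p = N + 3" | "N < p" "p \<noteq> N + 3" | "p \<le> N" by linarith
  then show ?thesis
  proof cases
    case 1
    then show ?thesis by (simp add: proj_def rank_sign J_def)
  next
    case 2
    then have s: "special (sp p)" using c by (auto simp: coef_def split: if_splits)
    have "rank (sp p) = p" using rank_special[OF s special_ne_m[OF s]] 2 p by (auto simp: sp_def split: if_splits)
    then show ?thesis using 2 special_J[OF s] by (simp add: proj_def)
  next
    case 3
    consider "rank x = p" | "rank x \<noteq> p" "x < d p" | "rank x \<noteq> p" "\<not> x < d p" by blast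
    then show ?thesis
    proof cases
      case high: 3
      then have "rank (F p) = p" using c 3 by (auto simp: coef_def split: if_splits)
      then show ?thesis using 3 high top_J[OF F_le_top[OF 3]] by (simp add: proj_def)
    qed (use 3 x rank_d in \<open>auto simp: proj_def\<close>)
  qed
qed

lemma \<Lambda>_simps:
  "rank i = N + 3 \<Longrightarrow> rank j = N + 3 \<Longrightarrow> \<Lambda> i j = 1"
  "N < p \<Longrightarrow> p \<noteq> N + 3 \<Longrightarrow> rank i = p \<Longrightarrow> rank j = p \<Longrightarrow> \<Lambda> i j = monom 1 m - 1"
  "p \<le> N \<Longrightarrow> rank i = p \<Longrightarrow> rank j = p \<Longrightarrow> \<Lambda> i j = (monom 1 m - 1) * block p i j"
  by (auto simp: \<Lambda>_def)

text \<open>Cancels \<open>z^(2 d p)\<close> from the two elimination steps. A vanishing coefficient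
  is treated apart, because \<open>poly_block\<close> requires both projections to lie in the
  class.\<close>

lemma block_step:
  assumes x: "x \<in> J" "x \<noteq> m" and y: "y \<in> J" "y \<noteq> m" and p: "p \<le> N" and z: "z \<noteq> 0"
  shows "poly (coef p x) z * poly (coef p y) z * poly (block p (proj p x) (proj p y)) z =
    before z p x y - after z p x y"
proof -
  have step: "poly (coef p x) z * poly (coef p y) z * before z p (proj p x) (proj p y) =
      (before z p x y - after z p x y) * (z ^ d p * z ^ d p)"
  proof (cases "x \<le> y")
    case True
    then show ?thesis
      using step_last[OF x y True z] step_before_last[OF x y True _ z, of p] p by (cases "p = N") auto
  next
    case False
    then have le: "y \<le> x" by simp
    show ?thesis
      using step_last[OF y x le z] step_before_last[OF y x le _ z, of p] p
        before_commute[of z p x y] after_commute[of z p x y] before_commute[of z p "proj p x" "proj p y"]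
      by (cases "p = N") (simp_all add: mult_ac)
  qed
  show ?thesis
  proof (cases "coef p x = 0 \<or> coef p y = 0")
    case True
    then show ?thesis using step z by auto
  next
    case False
    then have "proj p x \<in> J" "rank (proj p x) = p" "proj p y \<in> J" "rank (proj p y) = p"
      using proj_rank[OF x(1), of p] proj_rank[OF y(1), of p] p by auto
    then have "poly (block p (proj p x) (proj p y)) z * z ^ d p * z ^ d p = before z p (proj p x) (proj p y)"
      using poly_block p z by simp
    note B = this
    let ?c = "poly (coef p x) z * poly (coef p y) z" and ?b = "poly (block p (proj p x) (proj p y)) z"
    have "(?c * ?b) * (z ^ d p * z ^ d p) = ?c * (?b * z ^ d p * z ^ d p)" by (simp only: mult_ac)
    also have "\<dots> = (before z p x y - after z p x y) * (z ^ d p * z ^ d p)" by (simp only: B step)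
    finally have "(?c * ?b) * (z ^ d p * z ^ d p) = (before z p x y - after z p x y) * (z ^ d p * z ^ d p)" .
    then show ?thesis using z by simp
  qed
qed

lemma coef_sign: "p < N + 3 \<Longrightarrow> coef p m = 0"
proof -
  assume p: "p < N + 3"
  have "m \<noteq> sp p" if "special (sp p)" using special_ne_m[OF that] by simp
  then show ?thesis using p by (auto simp: coef_def rank_sign)
qed

text \<open>For p < N the kernel \<open>before p\<close> is \<open>after (p + 1)\<close>, and
  \<open>after 0\<close> is zero because the interval from \<open>d 0 = 0\<close> to
  \<open>F 0 = top\<close> is the whole path.\<close>

lemma telescope: "(\<Sum>p\<le>N. before z p x y - after z p x y) = before z N x y"
proof -
  have "(\<Sum>p\<le>n. before z p x y - after z p x y) = before z n x y - after z 0 x y" if "n \<le> N" for n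
    using that by (induction n) (auto simp: before_def)
  moreover have "after z 0 x y = 0" using d_start by (auto simp: after_def F_def)
  ultimately show ?thesis by simp
qed

text \<open>\<Lambda> couples only equal ranks, so the double sum reduces to one over ranks: the
  sign yields \<open>fdeg x * fdeg y\<close>, the ranks N + 1 and N + 2 the linear rank one terms,
  and the ranks up to N the kernel \<open>before N\<close>.\<close>

lemma green_identity:
  assumes x: "x \<in> J" and y: "y \<in> J"
  shows "(\<Sum>k\<in>J. \<Sum>l\<in>J. P x k * \<Lambda> k l * P y l) = fdeg x * fdeg y + (monom 1 m - 1) * M x y"
proof -
  let ?Q = "N + 3"
  have single: "(\<Sum>k\<in>J. P i k * g k) = (\<Sum>p\<le>?Q. coef p i * g (proj p i))" if "i \<in> J" for i g
    by (rule sum_by_rank[where rk = rank]) (use rank_le proj_rank[OF that] in \<open>auto simp: P_def\<close>)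
  have "(\<Sum>k\<in>J. \<Sum>l\<in>J. P x k * \<Lambda> k l * P y l) = (\<Sum>k\<in>J. P x k * (\<Sum>l\<in>J. P y l * \<Lambda> k l))"
    by (simp add: sum_distrib_left mult_ac)
  also have "\<dots> = (\<Sum>p\<le>?Q. coef p x * (\<Sum>q\<le>?Q. coef q y * \<Lambda> (proj p x) (proj q y)))"
    by (simp only: single[OF x] single[OF y])
  also have "\<dots> = (\<Sum>p\<le>?Q. coef p x * (coef p y * \<Lambda> (proj p x) (proj p y)))"
  proof (rule sum.cong)
    fix p assume p: "p \<in> {..?Q}"
    show "coef p x * (\<Sum>q\<le>?Q. coef q y * \<Lambda> (proj p x) (proj q y)) = coef p x * (coef p y * \<Lambda> (proj p x) (proj p y))"
    proof (cases "coef p x = 0")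
      case False
      then have rp: "rank (proj p x) = p" using proj_rank[OF x, of p] p by simp
      have "(\<Sum>q\<le>?Q. coef q y * \<Lambda> (proj p x) (proj q y)) =
          (\<Sum>q\<le>?Q. if q = p then coef p y * \<Lambda> (proj p x) (proj p y) else 0)"
      proof (rule sum.cong)
        fix q assume q: "q \<in> {..?Q}"
        show "coef q y * \<Lambda> (proj p x) (proj q y) = (if q = p then coef p y * \<Lambda> (proj p x) (proj p y) else 0)"
        proof (cases "coef q y = 0")
          case False
          then have "rank (proj q y) = q" using proj_rank[OF y, of q] q by simp
          then show ?thesis using rp by (auto simp: \<Lambda>_def)
        qed auto
      qed simp
      then show ?thesis using p by simp
    qed simp
  qed simp
  also have "\<dots> = fdeg x * fdeg y + (\<Sum>p\<le>N + 2. coef p x * (coef p y * \<Lambda> (proj p x) (proj p y)))"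
  proof -
    have "coef ?Q x * (coef ?Q y * \<Lambda> (proj ?Q x) (proj ?Q y)) = fdeg x * fdeg y"
      by (simp add: coef_def proj_def \<Lambda>_def rank_sign)
    moreover have "{..?Q} = insert ?Q {..N + 2}" by auto
    ultimately show ?thesis by simp
  qed
  also have "(\<Sum>p\<le>N + 2. coef p x * (coef p y * \<Lambda> (proj p x) (proj p y))) = (monom 1 m - 1) * M x y"
  proof (cases "x = m \<or> y = m")
    case True
    then have "coef p x = 0 \<or> coef p y = 0" if "p \<le> N + 2" for p using coef_sign[of p] that by auto
    then have "(\<Sum>p\<le>N + 2. coef p x * (coef p y * \<Lambda> (proj p x) (proj p y))) = 0"
      by (intro sum.neutral) fastforce
    then show ?thesis using True by (auto simp: M_def)
  next
    case False
    have hi: "coef p x * (coef p y * \<Lambda> (proj p x) (proj p y)) = (monom 1 m - 1) * (coef p x * coef p y)"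
      if "N < p" "p \<le> N + 2" for p
    proof (cases "coef p x = 0 \<or> coef p y = 0")
      case False
      then have "rank (proj p x) = p" "rank (proj p y) = p" using proj_rank[OF x, of p] proj_rank[OF y, of p] that by auto
      then have "\<Lambda> (proj p x) (proj p y) = monom 1 m - 1" using that by (intro \<Lambda>_simps(2)) auto
      then show ?thesis by (simp only: mult_ac)
    qed auto
    have lo: "coef p x * (coef p y * \<Lambda> (proj p x) (proj p y)) =
        (monom 1 m - 1) * (coef p x * coef p y * block p (proj p x) (proj p y))" if "p \<le> N" for p
    proof (cases "coef p x = 0 \<or> coef p y = 0")
      case False
      then have "rank (proj p x) = p" "rank (proj p y) = p" using proj_rank[OF x, of p] proj_rank[OF y, of p] that by auto
      then have "\<Lambda> (proj p x) (proj p y) = (monom 1 m - 1) * block p (proj p x) (proj p y)"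
        using that by (intro \<Lambda>_simps(3)) auto
      then show ?thesis by (simp only: mult_ac)
    qed auto
    have split: "{..N + 2} = insert (N + 1) (insert (N + 2) {..N})" by auto
    have "(\<Sum>p\<le>N + 2. t p) = t (N + 1) + (t (N + 2) + (\<Sum>p\<le>N. t p))" for t :: "nat \<Rightarrow> complex poly"
      unfolding split by simp
    moreover have "(\<Sum>p\<le>N. coef p x * (coef p y * \<Lambda> (proj p x) (proj p y))) =
        (\<Sum>p\<le>N. (monom 1 m - 1) * (coef p x * coef p y * block p (proj p x) (proj p y)))"
      by (intro sum.cong refl lo) simp
    moreover have "coef p x * (coef p y * \<Lambda> (proj p x) (proj p y)) = (monom 1 m - 1) * (coef p x * coef p y)"
      if "p = N + 1 \<or> p = N + 2" for p
      by (rule hi) (use that in auto)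
    ultimately have "(\<Sum>p\<le>N + 2. coef p x * (coef p y * \<Lambda> (proj p x) (proj p y))) =
        (monom 1 m - 1) * (coef (N + 1) x * coef (N + 1) y) + ((monom 1 m - 1) * (coef (N + 2) x * coef (N + 2) y) +
        (\<Sum>p\<le>N. (monom 1 m - 1) * (coef p x * coef p y * block p (proj p x) (proj p y))))"
      by (simp only: simp_thms)
    also have "\<dots> = (monom 1 m - 1) * (coef (N + 1) x * coef (N + 1) y + (coef (N + 2) x * coef (N + 2) y +
        (\<Sum>p\<le>N. coef p x * coef p y * block p (proj p x) (proj p y))))"
      by (simp only: distrib_left sum_distrib_left)
    also have "coef (N + 1) x * coef (N + 1) y + (coef (N + 2) x * coef (N + 2) y +
        (\<Sum>p\<le>N. coef p x * coef p y * block p (proj p x) (proj p y))) = M x y"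
    proof (rule poly_eqI_nonzero)
      fix z :: complex assume z: "z \<noteq> 0"
      have "(\<Sum>p\<le>N. poly (coef p x * coef p y * block p (proj p x) (proj p y)) z) =
          (\<Sum>p\<le>N. before z p x y - after z p x y)"
        using block_step[of x y _ z] x y False z by (intro sum.cong refl) simp
      also have "\<dots> = before z N x y" by (rule telescope)
      finally have S: "(\<Sum>p\<le>N. poly (coef p x * coef p y * block p (proj p x) (proj p y)) z) = before z N x y" .
      have "poly (M x y) z = before z N x y + poly (coef (N + 1) x) z * poly (coef (N + 1) y) z
          + poly (coef (N + 2) x) z * poly (coef (N + 2) y) z"
      proof (cases "x \<le> y")
        case True
        then show ?thesis using M_decomposition[of x y z] x y False z by blast
      next
        case yx: False
        then show ?thesis using M_decomposition[of y x z] x y False z M_commute[of x y] before_commute[of z N x y]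
          by (simp add: mult_ac)
      qed
      then show "poly (coef (N + 1) x * coef (N + 1) y + (coef (N + 2) x * coef (N + 2) y +
          (\<Sum>p\<le>N. coef p x * coef p y * block p (proj p x) (proj p y)))) z = poly (M x y) z"
        unfolding poly_add poly_sum S by simp
    qed
    finally show ?thesis .
  qed
  finally show ?thesis .
qed

lemma P_same:
  assumes i: "i \<in> J" and j: "j \<in> J" and eq: "rank i = rank j"
  shows "P i j = (if i = j then monom 1 (aval (rank i)) else 0)"
proof -
  from i have "coef (rank i) i = monom 1 (aval (rank i)) \<and> proj (rank i) i = i"
  proof (cases rule: J_kinds)
    case 1
    then show ?thesis by (simp add: coef_def proj_def rank_sign aval_def sign_values)
  next
    case 2
    then have "rank i = N + 1 + (i - r)" "i = r \<or> i = Suc r" using rank_special by (auto simp: special_def)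
    then have "sp (rank i) = i" "N < rank i" "rank i \<noteq> N + 3" by (auto simp: sp_def)
    then show ?thesis using 2 by (simp add: coef_def proj_def aval_def)
  next
    case 3
    then show ?thesis using rank_plain(2)[OF 3] by (simp add: coef_def proj_def aval_def)
  next
    case 4
    then show ?thesis using rank_half[of i] by (simp add: coef_def proj_def aval_def)
  qed
  then show ?thesis using eq by (auto simp: P_def)
qed

lemma P_lower:
  assumes i: "i \<in> J" and j: "j \<in> J" and less: "rank j < rank i"
  shows "P i j = 0"
proof -
  have "coef (rank j) i = 0"
  proof (cases "rank j \<le> N")
    case True
    then show ?thesis using less by (simp add: coef_def)
  next
    case False
    then have "i \<noteq> sp (rank j) \<or> \<not> special (sp (rank j))" "\<not> 2 * i < m"
    proof -
      have "i = m \<or> special i"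
        using i by (cases rule: J_kinds) (use False less rank_plain(2)[of i] rank_half[of i] in auto)
      then have "i = m \<or> even m \<and> (i = r \<or> i = Suc r)" by (auto simp: special_def)
      then show "\<not> 2 * i < m" by auto
      have "rank (sp (rank j)) = rank j" if s: "special (sp (rank j))"
        using rank_special[OF s special_ne_m[OF s]] False less rank_le[OF i]
        by (auto simp: sp_def split: if_splits)
      then show "i \<noteq> sp (rank j) \<or> \<not> special (sp (rank j))" using less by auto
    qed
    then show ?thesis using False less rank_le[OF i] by (auto simp: coef_def)
  qed
  then show ?thesis by (simp add: P_def)
qed

lemma coef_nonneg: "coeff (coef p i) n \<in> \<nat>"
proof -
  have mon: "coeff (monom 1 k :: complex poly) n \<in> \<nat>" for k by simp
  have "fdeg i \<in> {monom 1 0, monom 1 m, monom 1 r, monom 1 i + monom 1 (m - i)}"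
    by (simp add: fdeg_def)
  then have "coeff (fdeg i) n \<in> \<nat>"
    by (elim insertE emptyE) (simp_all only: mon coeff_add Nats_add)
  moreover have "coef p i \<in> {fdeg i, 0, monom 1 r, monom 1 i, monom 1 (d p), monom 1 (d p + F p - i)}"
    unfolding coef_def by simp
  ultimately show ?thesis
    by (elim insertE emptyE) (simp_all only: mon coeff_0 Nats_0)
qed

lemma P_nonneg: "coeff (P i j) n \<in> \<nat>"
  using coef_nonneg by (simp add: P_def)

lemma int_coeffs_P: "int_coeffs (P i j)"
  using P_nonneg Nats_subset_Ints unfolding int_coeffs_def by blast

lemma int_coeffs_\<Lambda>: "int_coeffs (\<Lambda> i j)"
  unfolding \<Lambda>_def block_def mono_def Let_def by auto

lemma P_dvd:
  assumes i: "i \<in> J" and j: "j \<in> J"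
  shows "monom 1 (aval (rank i)) dvd P i j"
proof -
  have md: "monom 1 k dvd (monom 1 l :: complex poly)" if "k \<le> l" for k l
  proof -
    have "monom 1 l = monom 1 k * (monom 1 (l - k) :: complex poly)" using that by (simp add: mult_monom)
    then show ?thesis by (rule dvdI)
  qed
  have plain: "aval (rank i) \<le> i" if "i \<le> top"
    using rank_plain(2,3)[OF that] by (simp add: aval_def)
  consider "rank j < rank i" | "rank i = rank j" | "rank i < rank j" "j \<noteq> proj (rank j) i"
    | "rank i < rank j" "j = proj (rank j) i" by linarith
  then show ?thesis
  proof cases
    case 4
    have iless: "rank i < N + 3" using 4 rank_le[OF j] by simp
    then have im: "i \<noteq> m" using rank_sign by auto
    consider "rank j = N + 3" | "N < rank j" "rank j \<noteq> N + 3" | "rank j \<le> N" by linarith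
    then have "monom 1 (aval (rank i)) dvd coef (rank j) i"
    proof cases
      case 1
      have "aval (rank i) \<le> height i"
        using rep(4)[OF i] rep_less[OF i i refl] by (cases "i = rep i") auto
      moreover have "monom 1 (height i) dvd fdeg i"
        using i
      proof (cases rule: J_cases)
        case planar
        have "monom 1 i dvd (monom 1 i + monom 1 (m - i) :: complex poly)"
          using planar by (intro dvd_add md) auto
        then show ?thesis using planar_values(4,5)[OF planar] by simp
      next
        case zero
        then show ?thesis using zero_values by (simp add: height_def)
      next
        case r
        then show ?thesis using half_values(3,4)[of i] by simp
      next
        case r'
        then show ?thesis using half_values(3,4)[of i] by simp
      qed (use im in simp)
      ultimately show ?thesis using 1 md dvd_trans by (metis coef_def)
    next
      case 2
      have "coef (rank j) i = 0 \<or> i = sp (rank j) \<and> special i \<or> 2 * i < m \<and> coef (rank j) i = monom 1 i"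
        using 2 by (auto simp: coef_def)
      moreover have "rank i = rank j" if "i = sp (rank j)" "special i"
        using rank_special[OF that(2) im] that(1) 2 rank_le[OF j] by (auto simp: sp_def split: if_splits)
      moreover have "i \<le> top" if "2 * i < m" using that by (auto simp: top_def)
      ultimately show ?thesis using 4 plain md by auto
    next
      case 3
      then have "rank i < N" using 4 by simp
      from i have "i \<le> top"
        using im \<open>rank i < N\<close> by (cases rule: J_kinds) (auto simp: rank_special rank_half)
      have "rank i \<noteq> rank j" using 4 by simp
      show ?thesis
      proof (cases "i < d (rank j)")
        case True
        then have "coef (rank j) i = monom 1 i" using 3 4 by (simp add: coef_def)
        then show ?thesis using md[OF plain[OF \<open>i \<le> top\<close>]] by simp
      next
        case False
        \<comment> \<open>The bound on the drops of f enters condition (5) here: as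
          \<open>F + d\<close> increases with the rank, the exponent \<open>d + F - i\<close> at
          rank j is at least \<open>d (rank i)\<close>.\<close>
        have "i \<le> F (rank i)" using rank_plain(4)[OF \<open>i \<le> top\<close>] .
        moreover have "F (rank i) + d (rank i) \<le> F (rank j) + d (rank j)" using F_diff[of "rank i" "rank j"] 4 3 by simp
        ultimately have "aval (rank i) \<le> d (rank j) + F (rank j) - i"
          using \<open>rank i < N\<close> by (simp add: aval_def)
        moreover have "coef (rank j) i = 0 \<or> coef (rank j) i = monom 1 (d (rank j) + F (rank j) - i)"
          using 3 4 False by (auto simp: coef_def)
        ultimately show ?thesis using md by auto
      qed
    qed
    then show ?thesis using 4 by (simp add: P_def)
  qed (use P_lower[OF i j] P_same[OF i j] in \<open>auto simp: P_def\<close>)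
qed

definition ix :: "class_fun \<Rightarrow> nat" where
  "ix = inv_into J lab"

lemma ix_lab [simp]: "i \<in> J \<Longrightarrow> ix (lab i) = i"
  by (simp add: ix_def inj_on_lab)

lemma rational_of_int_coeffs: "int_coeffs p \<Longrightarrow> to_fract p \<in> rational_ratfuns"
  unfolding rational_ratfuns_def int_coeffs_def
  by (intro CollectI exI[of _ p] exI[of _ 1]) (auto simp: Ints_subset_Rats[THEN subsetD] coeff_pCons split: nat.splits)

lemma green:
  "green_functions m X L a (\<lambda>\<chi> \<chi>'. to_fract (P (ix \<chi>) (ix \<chi>'))) (\<lambda>\<chi> \<chi>'. to_fract (\<Lambda> (ix \<chi>) (ix \<chi>')))"
  unfolding green_functions_def
proof (intro ballI)
  fix \<chi> \<chi>' assume "\<chi> \<in> Irr (I2 m)" "\<chi>' \<in> Irr (I2 m)"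
  then obtain i j where ij: "i \<in> J" "j \<in> J" and \<chi>: "\<chi> = lab i" "\<chi>' = lab j" by (auto simp: Irr_eq)
  have "(\<Sum>\<phi>\<in>Irr (I2 m). \<Sum>\<phi>'\<in>Irr (I2 m). to_fract (P (ix \<chi>) (ix \<phi>)) * to_fract (\<Lambda> (ix \<phi>) (ix \<phi>')) *
      to_fract (P (ix \<chi>') (ix \<phi>'))) = (\<Sum>k\<in>J. \<Sum>l\<in>J. to_fract (P i k * \<Lambda> k l * P j l))"
    unfolding sum_Irr \<chi> using ij by (intro sum.cong refl) simp
  also have "\<dots> = Omega m \<chi> \<chi>'"
    unfolding \<chi> Omega_lab[OF ij] green_identity[OF ij, symmetric] by (simp only: to_fract_sum)
  finally have sum: "(\<Sum>\<phi>\<in>Irr (I2 m). \<Sum>\<phi>'\<in>Irr (I2 m). to_fract (P (ix \<chi>) (ix \<phi>)) * to_fract (\<Lambda> (ix \<phi>) (ix \<phi>')) *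
      to_fract (P (ix \<chi>') (ix \<phi>'))) = Omega m \<chi> \<chi>'" .
  have lab_eq: "lab i = lab j \<longleftrightarrow> i = j" using inj_on_eq_iff[OF inj_on_lab ij] .
  show "to_fract (P (ix \<chi>) (ix \<chi>')) \<in> rational_ratfuns \<and>
      to_fract (\<Lambda> (ix \<chi>) (ix \<chi>')) \<in> rational_ratfuns \<and>
      (\<Sum>\<phi>\<in>Irr (I2 m). \<Sum>\<phi>'\<in>Irr (I2 m). to_fract (P (ix \<chi>) (ix \<phi>)) * to_fract (\<Lambda> (ix \<phi>) (ix \<phi>')) *
        to_fract (P (ix \<chi>') (ix \<phi>'))) = Omega m \<chi> \<chi>' \<and>
      ((supp X \<chi>, supp X \<chi>') \<in> L \<longrightarrow> to_fract (P (ix \<chi>) (ix \<chi>')) = 0) \<and>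
      (supp X \<chi> = supp X \<chi>' \<longrightarrow> to_fract (P (ix \<chi>) (ix \<chi>')) =
        (if \<chi> = \<chi>' then to_fract (monom 1 (a (supp X \<chi>))) else 0)) \<and>
      (supp X \<chi> \<noteq> supp X \<chi>' \<longrightarrow> to_fract (\<Lambda> (ix \<chi>) (ix \<chi>')) = 0)"
  proof (intro conjI impI)
    show "to_fract (P (ix \<chi>) (ix \<chi>')) \<in> rational_ratfuns" "to_fract (\<Lambda> (ix \<chi>) (ix \<chi>')) \<in> rational_ratfuns"
      by (intro rational_of_int_coeffs int_coeffs_P int_coeffs_\<Lambda>)+
    show "to_fract (P (ix \<chi>) (ix \<chi>')) = 0" if "(supp X \<chi>, supp X \<chi>') \<in> L"
      using that ij P_lower[OF ij] by (simp add: \<chi> supp_lab L_iff)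
    show "to_fract (P (ix \<chi>) (ix \<chi>')) = (if \<chi> = \<chi>' then to_fract (monom 1 (a (supp X \<chi>))) else 0)"
      if "supp X \<chi> = supp X \<chi>'"
      using that ij P_same[OF ij] by (simp add: \<chi> supp_lab kls_eq_iff a_kls lab_eq)
    show "to_fract (\<Lambda> (ix \<chi>) (ix \<chi>')) = 0" if "supp X \<chi> \<noteq> supp X \<chi>'"
      using that ij by (simp add: \<chi> supp_lab kls_eq_iff \<Lambda>_def)
  qed (rule sum)
qed

section \<open>Springer representations, the family condition and the shape\<close>

lemma rep_self:
  assumes s: "s \<in> J" "lab s \<in> S"
  shows "rep s = s"
  using s(1)
proof (cases rule: J_kinds)
  case 1
  then show ?thesis by (simp add: rep_def rank_sign)
next
  case 2
  then show ?thesis by (simp add: rep_def rank_special)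
next
  case 3
  show ?thesis
  proof (cases "2 * s < m")
    case True
    then obtain k where "k \<le> N" "s = d k" using lab_in_S_iff s(2) by auto
    then show ?thesis by (simp add: rep_def rank_d)
  next
    case False
    then have "\<not> 2 * top < m" using 3 by simp
    then have "exceptional" using top_bound(3) by blast
    moreover have "s = r" using False 3 top_bound(2)[OF \<open>exceptional\<close>] by simp
    ultimately show ?thesis using s(2) half_S(1) by (simp add: exceptional_def)
  qed
next
  case 4
  then show ?thesis using s(2) by auto
qed

lemma unipotent_class_kls: "s \<in> J \<Longrightarrow> lab s \<in> S \<Longrightarrow> unipotent_class m X (lab s) (kls s)"
  using springer_rep_kls[of s] rep_self[of s] by (simp add: unipotent_class_def X_def)

lemma springer_rep_unique: "springer_rep m C \<chi> \<Longrightarrow> springer_rep m C \<chi>' \<Longrightarrow> \<chi> = \<chi>'"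
  unfolding springer_rep_def by (metis DiffI less_asym singletonD)

lemma springer_reps_X: "springer_reps m X = S"
proof (intro equalityI subsetI)
  fix \<chi> assume "\<chi> \<in> springer_reps m X"
  then obtain i where "i \<in> J" "springer_rep m (kls i) \<chi>" by (auto simp: springer_reps_def X_def)
  then show "\<chi> \<in> S" using springer_rep_unique springer_rep_kls rep(3) by metis
next
  fix \<chi> assume \<chi>: "\<chi> \<in> S"
  then obtain s where "s \<in> J" "\<chi> = lab s" using S_Irr Irr_eq by auto
  then show "\<chi> \<in> springer_reps m X"
    using unipotent_class_kls[of s] \<chi> by (auto simp: springer_reps_def unipotent_class_def)
qed

lemma special_chars_eq: "special_chars m = {lab 0, lab 1, lab m}"
  using m3 by (simp add: special_chars_def lab_simps trivial_char_eq sign_char_eq two_dim_char_eq)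

lemma special_in_S: "lab 0 \<in> S" "lab 1 \<in> S" "lab m \<in> S"
  using zero_S sign_S lab_in_S_iff[of 1] m3 N_pos d_start by (auto intro!: image_eqI[of _ d 1])

text \<open>Only the large family has nonspecial members. Since \<open>d 1 = 1\<close> and
  \<open>f 1 = top\<close>, the interval of rank 1 contains every path index except 0, and indices
  off the path have rank at least N.\<close>

lemma family_condition:
  assumes F: "A \<in> families m" and \<chi>: "\<chi> \<in> A \<inter> special_chars m" and \<chi>': "\<chi>' \<in> A - special_chars m"
  shows "supp X \<chi>' = supp X \<chi> \<or> (supp X \<chi>', supp X \<chi>) \<in> L"
proof -
  have ts: "trivial_char m = lab 0" "sign_char m = lab m"
    by (simp_all add: lab_simps trivial_char_eq sign_char_eq)
  have A: "A = Irr (I2 m) - {lab 0, lab m}"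
    using F \<chi>' unfolding families_def special_chars_eq ts by auto
  then have "\<chi> = lab 1" using \<chi> unfolding special_chars_eq by auto
  obtain j where j: "j \<in> J" "\<chi>' = lab j" using \<chi>' A Irr_eq by auto
  have ne: "j \<noteq> 0" "j \<noteq> m" using \<chi>' j unfolding special_chars_eq by auto
  have "1 \<le> rank j"
  proof (cases "j \<le> top")
    case True
    then show ?thesis using rank_ge_iff[OF True N_pos] ne d_start f_first by (simp add: F_def)
  next
    case False
    then show ?thesis using not_plain(4)[OF j(1) ne(2) False] N_pos by simp
  qed
  moreover have "1 \<in> J" using m3 by (simp add: J_def)
  moreover have "rank 1 = 1" using rank_d[OF N_pos] d_start by simp
  ultimately show ?thesis
    using j L_iff[of j 1] kls_eq_iff[of j 1] by (auto simp: \<open>\<chi> = lab 1\<close> supp_lab)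
qed

lemma correspondence: "springer_correspondence m X L a"
  unfolding springer_correspondence_def
proof (intro conjI)
  show "lusztig_shoji_datum m X L a" by (rule datum)
  show "\<forall>C\<in>X. a C = Min (b_invariant m ` C) \<and> (\<exists>\<chi>. springer_rep m C \<chi>)"
    using springer_rep_kls by (auto simp: a_def X_def)
  show "\<forall>\<chi>\<in>special_chars m. \<exists>C\<in>X. springer_rep m C \<chi>"
    using special_in_S springer_reps_X unfolding special_chars_eq springer_reps_def by blast
  show "\<forall>A\<in>families m. \<forall>\<chi>\<in>A \<inter> special_chars m. \<forall>\<chi>'\<in>A - special_chars m.
      supp X \<chi>' = supp X \<chi> \<or> (supp X \<chi>', supp X \<chi>) \<in> L"
    using family_condition by blast
  let ?P = "\<lambda>\<chi> \<chi>'. to_fract (P (ix \<chi>) (ix \<chi>'))" and ?\<Lambda> = "\<lambda>\<chi> \<chi>'. to_fract (\<Lambda> (ix \<chi>) (ix \<chi>'))"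
  show "\<exists>P \<Lambda>. green_functions m X L a P \<Lambda> \<and>
      (\<forall>\<chi>\<in>Irr (I2 m). \<forall>\<chi>'\<in>Irr (I2 m). \<Lambda> \<chi> \<chi>' \<in> integer_polys \<and> P \<chi> \<chi>' \<in> nonneg_integer_polys) \<and>
      (\<forall>C\<in>X. \<forall>\<chi>\<in>C. \<forall>\<chi>'\<in>Irr (I2 m). \<exists>p. P \<chi> \<chi>' = to_fract (monom 1 (a C) * p))"
  proof (rule exI[of _ ?P], rule exI[of _ ?\<Lambda>], intro conjI ballI green)
    fix \<chi> \<chi>'
    show "?\<Lambda> \<chi> \<chi>' \<in> integer_polys"
      using int_coeffs_\<Lambda> unfolding integer_polys_def int_coeffs_def by blast
    show "?P \<chi> \<chi>' \<in> nonneg_integer_polys"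
      using P_nonneg unfolding nonneg_integer_polys_def by blast
  next
    fix C \<chi> \<chi>' assume "C \<in> X" "\<chi> \<in> C" "\<chi>' \<in> Irr (I2 m)"
    then obtain i k j where ij: "i \<in> J" "k \<in> J" "j \<in> J" "rank k = rank i" "C = kls i" "\<chi> = lab k" "\<chi>' = lab j"
      by (auto simp: X_def kls_def Irr_eq)
    then obtain p where "P k j = monom 1 (aval (rank k)) * p" using P_dvd[of k j] by (auto simp: dvd_def)
    then show "\<exists>p. ?P \<chi> \<chi>' = to_fract (monom 1 (a C) * p)"
      using ij a_kls[of i] by (intro exI[of _ p]) simp
  qed
qed

lemma kls_middle:
  assumes k: "k < N"
  shows "kls (d k) = lab ` ({d k..<d (Suc k)} \<union> {F (Suc k)<..F k})"
proof -
  have step: "d (Suc k) \<le> F (Suc k)" "F (Suc k) \<le> F k" "F k \<le> top" "d k < d (Suc k)"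
    using d_le_F[of "Suc k"] F_step[OF k] F_le_top[of k] d_inj[of k "Suc k"] k by auto
  have iff: "rank j = k \<longleftrightarrow> j \<in> {d k..<d (Suc k)} \<union> {F (Suc k)<..F k}" if "j \<le> top" for j
    using that k by (cases rule: rank_plain_cases) (use step in auto)
  have plain: "j \<le> top" if "j \<in> J" "rank j = k" for j
    using not_plain(4)[OF that(1)] that(2) k rank_sign by (cases "j = m") auto
  have "{j \<in> J. rank j = k} = {d k..<d (Suc k)} \<union> {F (Suc k)<..F k}"
  proof (intro equalityI subsetI)
    fix j assume "j \<in> {j \<in> J. rank j = k}"
    then show "j \<in> {d k..<d (Suc k)} \<union> {F (Suc k)<..F k}" using iff plain by blast
  next
    fix j assume j: "j \<in> {d k..<d (Suc k)} \<union> {F (Suc k)<..F k}"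
    then have "j \<le> top" using step by auto
    then show "j \<in> {j \<in> J. rank j = k}" using iff j top_J by blast
  qed
  then show ?thesis using rank_d[of k] k by (simp add: kls_def)
qed

lemma kls_last:
  assumes ex: exceptional
  shows "kls (d N) = lab ` {d N..F N}"
proof -
  have plain: "j \<le> top" if "j \<in> J" "rank j = N" for j
  proof (rule ccontr)
    assume nt: "\<not> j \<le> top"
    have "j \<noteq> m" "\<not> special j" using that(2) rank_sign rank_special[of j] special_ne_m[of j] by auto
    then have "\<not> special (Suc r)" using half_kind(4)[OF that(1) _ _ nt] by blast
    then show False using ex half_S by (auto simp: special_def exceptional_def)
  qed
  have iff: "rank j = N \<longleftrightarrow> j \<in> {d N..F N}" if "j \<le> top" for j
    using rank_ge_iff[OF that le_refl] rank_plain(2)[OF that] by auto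
  have "{j \<in> J. rank j = N} = {d N..F N}"
  proof (intro equalityI subsetI)
    fix j assume "j \<in> {j \<in> J. rank j = N}"
    then show "j \<in> {d N..F N}" using iff plain by blast
  next
    fix j assume j: "j \<in> {d N..F N}"
    then have "j \<le> top" using F_le_top[of N] by auto
    then show "j \<in> {j \<in> J. rank j = N}" using iff j top_J by blast
  qed
  then show ?thesis using rank_d[of N] by (simp add: kls_def)
qed

lemma kls_single:
  assumes s: "s \<in> J" "lab s \<in> S" "N < rank s"
  shows "kls s = {lab s}"
proof -
  have "j = s" if "j \<in> J" "rank j = rank s" for j
    using rep_self[OF s(1,2)] rep_def[of j] that rep_less[OF s(1) that] rep_less[OF that(1) s(1)] s(3)
    by (cases "j = s") auto
  then have "{j \<in> J. rank j = rank s} = {s}" using s(1) by auto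
  then show ?thesis by (simp add: kls_def)
qed

text \<open>Stated for the exceptional case, where f is prescribed; in the regular case the shape of
  any correspondence comes from rigidity.\<close>

lemma shape:
  assumes ex: exceptional
  shows "has_shape m \<chi>r \<chi>r' S N d f X"
proof -
  have u: "unipotent_class m X (chi m \<chi>r (d k)) (kls (d k))" if "k \<le> N" for k
    using unipotent_class_kls[OF d_J[OF that]] lab_in_S_iff[OF d_less[OF that]] that
      chi_eq_lab[of "d k"] d_less[OF that] by auto
  have chi_image: "chi m \<chi>r ` A = lab ` A" if "A \<subseteq> {..top}" for A
    using that top_bound(1) by (intro image_cong refl chi_eq_lab) auto
  have e: "even m" "\<chi>r \<notin> S" "\<chi>r' \<in> S" using ex by (auto simp: exceptional_def)
  have "kls (d 0) = lab ` {0}"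
    using kls_middle[of 0] N_pos d_start f_first by (simp add: F_def)
  then have h1: "unipotent_class m X (chi m \<chi>r (d 0)) {trivial_char m}"
    using u[of 0] by (simp add: lab_simps trivial_char_eq)
  have h2: "unipotent_class m X (chi m \<chi>r (d k))
      (chi m \<chi>r ` {d k..<d (Suc k)} \<union> chi m \<chi>r ` {f (Suc k)<..f k})" if k: "1 \<le> k" "k < N" for k
  proof -
    have "d (Suc k) \<le> top" "f k = F k" "f (Suc k) = F (Suc k)" "F k \<le> top"
      using k d_le_top[of "Suc k"] F_le_top[of k] by (auto simp: F_def)
    moreover from this have "chi m \<chi>r ` ({d k..<d (Suc k)} \<union> {F (Suc k)<..F k}) = lab ` ({d k..<d (Suc k)} \<union> {F (Suc k)<..F k})"
      by (intro chi_image) auto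
    ultimately show ?thesis using u[of k] kls_middle[of k] k by (simp add: image_Un)
  qed
  have h3: "unipotent_class m X (chi m \<chi>r (d N)) (chi m \<chi>r ` {d N..f N})"
  proof -
    have "f N = F N" using N_pos by (simp add: F_def)
    moreover have "chi m \<chi>r ` {d N..F N} = lab ` {d N..F N}" using F_le_top[of N] by (intro chi_image) auto
    ultimately show ?thesis using u[of N] kls_last[OF ex] by simp
  qed
  have "special (Suc r)" using e half_S by (simp add: special_def)
  then have "kls (Suc r) = {lab (Suc r)}" "unipotent_class m X (lab (Suc r)) (kls (Suc r))"
    using kls_single[of "Suc r"] unipotent_class_kls[of "Suc r"] special_J rank_special[of "Suc r"] special_ne_m[of "Suc r"]
    by (auto simp: special_def)
  then have h4: "unipotent_class m X \<chi>r' {\<chi>r'}" using e by (simp add: lab_simps)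
  have "kls m = {lab m}" "unipotent_class m X (lab m) (kls m)"
    using kls_single[of m] unipotent_class_kls[of m] sign_S rank_sign by (auto simp: J_def)
  then have h5: "unipotent_class m X (sign_char m) {sign_char m}" by (simp add: lab_simps sign_char_eq)
  show ?thesis
    unfolding has_shape_def using h1 h2 h3 h4 h5 e by (intro conjI allI impI) auto
qed

end

section \<open>Uniqueness and conclusion\<close>

lemma (in springer) X_eq: "X = cls ` {s \<in> J. lab s \<in> S}"
proof (intro equalityI subsetI)
  fix C assume C: "C \<in> X"
  then have "C \<noteq> {}" using partition by (auto simp: partition_on_def)
  then obtain i where i: "i \<in> J" "cls i = C" using class_eq[OF C] by auto
  then show "C \<in> cls ` {s \<in> J. lab s \<in> S}" using has_rep[OF i(1)] by (metis (mono_tags, lifting) imageI mem_Collect_eq)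
qed (use cls_in in auto)

text \<open>In the regular case f is the constant \<open>top\<close>, so the formulas for the
  classes depend only on \<open>S\<close> and d, and every class contains a member of
  \<open>S\<close>.\<close>

lemma (in springer_datum) unique:
  assumes ne: "\<not> exceptional"
    and X: "springer m \<chi>r \<chi>r' S N d X L a" and X': "springer m \<chi>r \<chi>r' S N d X' L' a'"
  shows "X = X'"
proof -
  interpret A: springer m \<chi>r \<chi>r' S N d X L a by (rule X)
  interpret B: springer m \<chi>r \<chi>r' S N d X' L' a' by (rule X')
  have f: "A.f = B.f" by (rule ext) (simp add: A.f_def B.f_def ne)
  have "A.cls s = B.cls s" if s: "s \<in> J" "lab s \<in> S" for s
    using s(1)
  proof (cases rule: J_cases)
    case zero
    then show ?thesis using A.cls_0 B.cls_0 by simp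
  next
    case planar
    then obtain k where k: "k \<le> N" "s = d k" using lab_in_S_iff s(2) by auto
    then show ?thesis
      using A.cls_middle[of k] B.cls_middle[of k] A.cls_last B.cls_last f by (cases "k = N") auto
  next
    case r
    then show ?thesis using A.cls_half[of s] B.cls_half[of s] s by simp
  next
    case r'
    then show ?thesis using A.cls_half[of s] B.cls_half[of s] s by simp
  next
    case sign
    then show ?thesis using A.cls_sign B.cls_sign by simp
  qed
  then have "A.cls ` {s \<in> J. lab s \<in> S} = B.cls ` {s \<in> J. lab s \<in> S}" by (intro image_cong) auto
  then show ?thesis by (rule trans[OF A.X_eq trans[OF _ B.X_eq[symmetric]]])
qed

theorem theorem3p2:
  fixes m N :: nat
    and \<chi>r \<chi>r' :: class_fun
    and S :: "class_fun set"
    and d :: "nat \<Rightarrow> nat"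
  assumes m: "m \<ge> 3"
    and labels: "even m \<Longrightarrow> \<chi>r \<noteq> \<chi>r' \<and> {\<chi>r, \<chi>r'} = remaining_linear_chars m"
    and S_Irr: "S \<subseteq> Irr (I2 m)"
    and S_special: "{trivial_char m, chi m \<chi>r 1, sign_char m} \<subseteq> S"
    and S_label: "even m \<Longrightarrow> (\<chi>r \<in> S) \<noteq> (\<chi>r' \<in> S) \<Longrightarrow> \<chi>r' \<in> S"
    and d_start: "d 0 = 0" "d 1 = 1"
    and d_mono: "strict_mono_on {..N} d"
    and d_bound: "2 * d N < m"
    and d_S: "{chi m \<chi>r i | i. 2 * i < m \<and> chi m \<chi>r i \<in> S} = chi m \<chi>r ` d ` {..N}"
  shows
    "((\<exists>X L a. springer_correspondence m X L a \<and> springer_reps m X = S) \<and>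
      (\<forall>X L a. springer_correspondence m X L a \<and> springer_reps m X = S \<longrightarrow>
         (\<exists>f. (\<forall>k. 1 \<le> k \<and> k < N \<longrightarrow> f (Suc k) \<le> f k) \<and> f 1 \<le> m div 2 \<and>
              has_shape m \<chi>r \<chi>r' S N d f X)))
     \<and>
     (\<not> (even m \<and> (\<chi>r \<in> S) \<noteq> (\<chi>r' \<in> S)) \<longrightarrow>
        (\<forall>X L a. springer_correspondence m X L a \<and> springer_reps m X = S \<longrightarrow>
           has_shape m \<chi>r \<chi>r' S N d (\<lambda>k. (m - 1) div 2) X) \<and>
        (\<exists>!X. \<exists>L a. springer_correspondence m X L a \<and> springer_reps m X = S))
     \<and>
     (even m \<and> \<chi>r' \<in> S \<and> \<chi>r \<notin> S \<longrightarrow>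
        (\<forall>f. f 1 = m div 2 \<and> d N \<le> f N \<and>
             (\<forall>k. 1 \<le> k \<and> k < N \<longrightarrow>
                f (Suc k) \<le> f k \<and> f k - f (Suc k) \<le> d (Suc k) - d k) \<longrightarrow>
           (\<exists>X L a. springer_correspondence m X L a \<and> springer_reps m X = S \<and>
              has_shape m \<chi>r \<chi>r' S N d f X)))"
proof -
  interpret springer_datum m \<chi>r \<chi>r' S N d
    by unfold_locales (fact m labels S_Irr S_special S_label d_start d_mono d_bound d_S)+
  have springer: "springer m \<chi>r \<chi>r' S N d X L a"
    if "springer_correspondence m X L a" "springer_reps m X = S" for X L a
    by unfold_locales (fact that)+
  have exists: "\<exists>X L a. springer_correspondence m X L a \<and> springer_reps m X = S"
  proof -
    \<comment> \<open>The constant sequence has no drops, so it satisfies the bounds for every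
      \<open>S\<close>.\<close>
    interpret C: springer_choice m \<chi>r \<chi>r' S N d "\<lambda>k. top"
      by unfold_locales (use d_le_top in auto)
    show ?thesis using C.correspondence C.springer_reps_X by blast
  qed
  have shape: "\<exists>f. (\<forall>k. 1 \<le> k \<and> k < N \<longrightarrow> f (Suc k) \<le> f k) \<and> f 1 \<le> m div 2 \<and>
      has_shape m \<chi>r \<chi>r' S N d f X"
    if "springer_correspondence m X L a" "springer_reps m X = S" for X L a
  proof -
    interpret A: springer m \<chi>r \<chi>r' S N d X L a by (rule springer[OF that])
    have "A.f (Suc k) \<le> A.f k" if "k < N" for k using A.f_decreasing[of k "Suc k"] that by simp
    moreover have "A.f 1 \<le> m div 2" using A.E_interval(3)[OF N_pos] top_bound(1) by linarith
    ultimately show ?thesis using A.shape by blast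
  qed
  have regular: "has_shape m \<chi>r \<chi>r' S N d (\<lambda>k. (m - 1) div 2) X"
    if "\<not> exceptional" "springer_correspondence m X L a" "springer_reps m X = S" for X L a
  proof -
    interpret A: springer m \<chi>r \<chi>r' S N d X L a by (rule springer[OF that(2,3)])
    have "A.f = (\<lambda>k. (m - 1) div 2)" by (rule ext) (simp add: A.f_def that(1) top_def)
    then show ?thesis using A.shape by simp
  qed
  have ex1: "\<exists>!X. \<exists>L a. springer_correspondence m X L a \<and> springer_reps m X = S" if "\<not> exceptional"
    using exists unique[OF that] springer by (metis (no_types, lifting))
  have choice: "\<exists>X L a. springer_correspondence m X L a \<and> springer_reps m X = S \<and>
      has_shape m \<chi>r \<chi>r' S N d f X"
    if ex: exceptional and f: "f 1 = m div 2" "d N \<le> f N"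
      "\<forall>k. 1 \<le> k \<and> k < N \<longrightarrow> f (Suc k) \<le> f k \<and> f k - f (Suc k) \<le> d (Suc k) - d k" for f
  proof -
    interpret C: springer_choice m \<chi>r \<chi>r' S N d f
      by unfold_locales (use ex f top_bound(2) in auto)
    show ?thesis using C.correspondence C.springer_reps_X C.shape[OF ex] by blast
  qed
  have ne: "\<not> exceptional" if "\<not> (even m \<and> (\<chi>r \<in> S) \<noteq> (\<chi>r' \<in> S))"
    using that by (auto simp: exceptional_def)
  have ex: exceptional if "even m \<and> \<chi>r' \<in> S \<and> \<chi>r \<notin> S"
    using that by (simp add: exceptional_def)
  show ?thesis
  proof (intro conjI)
    show "\<forall>X L a. springer_correspondence m X L a \<and> springer_reps m X = S \<longrightarrow>
         (\<exists>f. (\<forall>k. 1 \<le> k \<and> k < N \<longrightarrow> f (Suc k) \<le> f k) \<and> f 1 \<le> m div 2 \<and>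
              has_shape m \<chi>r \<chi>r' S N d f X)"
      using shape by blast
    show "\<not> (even m \<and> (\<chi>r \<in> S) \<noteq> (\<chi>r' \<in> S)) \<longrightarrow>
        (\<forall>X L a. springer_correspondence m X L a \<and> springer_reps m X = S \<longrightarrow>
           has_shape m \<chi>r \<chi>r' S N d (\<lambda>k. (m - 1) div 2) X) \<and>
        (\<exists>!X. \<exists>L a. springer_correspondence m X L a \<and> springer_reps m X = S)"
      using regular[OF ne] ex1[OF ne] by blast
    show "even m \<and> \<chi>r' \<in> S \<and> \<chi>r \<notin> S \<longrightarrow>
        (\<forall>f. f 1 = m div 2 \<and> d N \<le> f N \<and>
             (\<forall>k. 1 \<le> k \<and> k < N \<longrightarrow>
                f (Suc k) \<le> f k \<and> f k - f (Suc k) \<le> d (Suc k) - d k) \<longrightarrow>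
           (\<exists>X L a. springer_correspondence m X L a \<and> springer_reps m X = S \<and>
              has_shape m \<chi>r \<chi>r' S N d f X))"
      using choice[OF ex] by blast
  qed (rule exists)
qed

end
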